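(* Let $\mathbb F$ be a finite field of odd order, let $Q=Q_{a,b}$ be a quadratic quasigroup upon $\mathbb F$, and let $\mathbb K$ be the least subfield of $\mathbb F$ containing $\{a,b\}$. Then $\operatorname{Aut}(Q)=\mathrm{A\Gamma^2L}_1(\mathbb F\mid\mathbb K)$, except in the following cases: (i) If $a=b$, then $\operatorname{Aut}(Q)\cong\operatorname{AGL}_k(\mathbb K)$, where $k=[\mathbb F:\mathbb K]$; the automorphisms of $Q$ are exactly the maps $x\mapsto\sigma(x)+\mu$ with $\mu\in\mathbb F$ and $\sigma:\mathbb F\to\mathbb F$ a $\mathbb K$-linear bijection. (ii) If $b=a^\gamma$ where $\gamma^2=|\mathbb K|$, then $\operatorname{Aut}(Q)=\mathrm{A\Gamma L}^{\mathrm{tw}}_1(\mathbb F\mid\mathbb K)$. (iii) If $|\mathbb F|=7$ and $\{a,b\}=\{3,5\}$, then $\operatorname{Aut}(Q)\cong\operatorname{PSL}_2(7)$.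
   Context: $\chi$ is the quadratic character of $\mathbb F$ ($\chi(0)=0$, $1$ on nonzero squares, $-1$ on nonsquares). For $a,b\in\mathbb F$ with $\chi(a)=\chi(b)\ne0$ and $\chi(1-a)=\chi(1-b)\ne0$, $Q_{a,b}$ is $(\mathbb F,* )$ with $x*y=x+a(y-x)$ if $\chi(y-x)\ge0$ and $x*y=x+b(y-x)$ if $\chi(y-x)=-1$. $\mathrm{A\Gamma L}_1(\mathbb F)$ is the group of maps $x\mapsto\lambda\alpha(x)+\mu$ with $\lambda\in\mathbb F^*$, $\mu\in\mathbb F$, $\alpha\in\operatorname{Aut}(\mathbb F)$; $\mathrm{A\Gamma L}_1(\mathbb F\mid\mathbb K)$ is its subgroup where $\alpha\in\operatorname{Gal}(\mathbb F\mid\mathbb K)$; $\mathrm{A\Gamma^2L}_1(\mathbb F)$ is its subgroup where $\chi(\lambda)=1$; and $\mathrm{A\Gamma^2L}_1(\mathbb F\mid\mathbb K)=\mathrm{A\Gamma^2L}_1(\mathbb F)\cap\mathrm{A\Gamma L}_1(\mathbb F\mid\mathbb K)$. If $\mathbb K$ has a subfield $\mathbb L$ with $[\mathbb K:\mathbb L]=2$, the twist $\mathrm{A\Gamma L}^{\mathrm{tw}}_1(\mathbb F\mid\mathbb K)$ consists of $\mathrm{A\Gamma^2L}_1(\mathbb F\mid\mathbb K)$ together with all maps $x\mapsto\lambda\alpha(x^\gamma)+\mu$ with $\chi(\lambda)=-1$, $\alpha\in\operatorname{Gal}(\mathbb F\mid\mathbb K)$, $\mu\in\mathbb F$, and $\gamma=|\mathbb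 L|$. *)

theory Defs
  imports
    "HOL-Library.Cardinality"
    "HOL-Algebra.Algebraic_Closure_Type"
    "HOL-Algebra.Generated_Fields"
    "HOL-Algebra.Bij"
    "Jordan_Normal_Form.Determinant"
begin

definition quad_char :: "'a::field \<Rightarrow> int" where
  "quad_char x = (if x = 0 then 0 else if \<exists>y. x = y\<^sup>2 then 1 else - 1)"

definition quad_mult :: "'a::field \<Rightarrow> 'a \<Rightarrow> 'a \<Rightarrow> 'a \<Rightarrow> 'a" where
  "quad_mult a b x y =
     (if quad_char (y - x) \<ge> 0 then x + a * (y - x) else x + b * (y - x))"

definition quad_params :: "'a::field \<Rightarrow> 'a \<Rightarrow> bool" where
  "quad_params a b \<longleftrightarrow>
     quad_char a = quad_char b \<and> quad_char a \<noteq> 0 \<and>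
     quad_char (1 - a) = quad_char (1 - b) \<and> quad_char (1 - a) \<noteq> 0"

definition magma_auts :: "('a \<Rightarrow> 'a \<Rightarrow> 'a) \<Rightarrow> ('a \<Rightarrow> 'a) set" where
  "magma_auts m = {f. bij f \<and> (\<forall>x y. f (m x y) = m (f x) (f y))}"

definition magma_aut_group :: "('a \<Rightarrow> 'a \<Rightarrow> 'a) \<Rightarrow> ('a \<Rightarrow> 'a) monoid" where
  "magma_aut_group m = BijGroup UNIV \<lparr>carrier := magma_auts m\<rparr>"

text \<open>
  The ambient field is a type; subfields are subsets of it, treated with the
  notions of HOL-Algebra for the ring record on the whole type.
\<close>

abbreviation F_ring :: "'a::field ring" where
  "F_ring \<equiv> ring_of_type_algebra"

definition least_subfield :: "'a::field set \<Rightarrow> 'a set" where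
  "least_subfield S = generate_field F_ring S"

definition ext_degree :: "'a::field set \<Rightarrow> 'a set \<Rightarrow> nat" where
  "ext_degree E K = ring.dim F_ring K E"

definition field_auts :: "('a::field \<Rightarrow> 'a) set" where
  "field_auts = ring_iso F_ring F_ring"

definition Gal :: "'a::field set \<Rightarrow> ('a \<Rightarrow> 'a) set" where
  "Gal K = {\<alpha> \<in> field_auts. \<forall>c\<in>K. \<alpha> c = c}"

definition AGammaL1_over :: "'a::field set \<Rightarrow> ('a \<Rightarrow> 'a) set" where
  "AGammaL1_over K = {(\<lambda>x. l * \<alpha> x + u) | l \<alpha> u. l \<noteq> 0 \<and> \<alpha> \<in> Gal K}"

definition AGamma2L1 :: "('a::field \<Rightarrow> 'a) set" where
  "AGamma2L1 = {(\<lambda>x. l * \<alpha> x + u) | l \<alpha> u. quad_char l = 1 \<and> \<alpha> \<in> field_auts}"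

definition AGamma2L1_over :: "'a::field set \<Rightarrow> ('a \<Rightarrow> 'a) set" where
  "AGamma2L1_over K = AGamma2L1 \<inter> AGammaL1_over K"

text \<open>
  The twist is meaningful only if \<open>K\<close> has a subfield \<open>L\<close> with
  \<open>[K : L] = 2\<close>; for finite \<open>K\<close> there is at most one such \<open>L\<close>.
\<close>

definition AGammaL1_tw :: "'a::field set \<Rightarrow> ('a \<Rightarrow> 'a) set" where
  "AGammaL1_tw K = AGamma2L1_over K \<union>
     {(\<lambda>x. l * \<alpha> (x ^ card L) + u) | l \<alpha> u L.
        quad_char l = - 1 \<and> \<alpha> \<in> Gal K \<and>
        subfield L F_ring \<and> L \<subseteq> K \<and> ext_degree K L = 2}"

definition linear_over :: "'a::field set \<Rightarrow> ('a \<Rightarrow> 'a) \<Rightarrow> bool" where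
  "linear_over K s \<longleftrightarrow>
     (\<forall>x y. s (x + y) = s x + s y) \<and> (\<forall>c\<in>K. \<forall>x. s (c * x) = c * s x)"

definition vecs_over :: "nat \<Rightarrow> 'a set \<Rightarrow> 'a vec set" where
  "vecs_over n K = {v \<in> carrier_vec n. set\<^sub>v v \<subseteq> K}"

definition mats_over :: "nat \<Rightarrow> 'a set \<Rightarrow> 'a mat set" where
  "mats_over n K = {A \<in> carrier_mat n n. elements_mat A \<subseteq> K}"

definition AGL :: "nat \<Rightarrow> 'a::field set \<Rightarrow> ('a vec \<Rightarrow> 'a vec) monoid" where
  "AGL n K = BijGroup (vecs_over n K)
     \<lparr>carrier := {(\<lambda>x\<in>vecs_over n K. A *\<^sub>v x + v) | A v.
        A \<in> mats_over n K \<and> det A \<noteq> 0 \<and> v \<in> vecs_over n K}\<rparr>"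

definition SL :: "nat \<Rightarrow> 'a::field set \<Rightarrow> 'a mat monoid" where
  "SL n K = \<lparr>carrier = {A \<in> mats_over n K. det A = 1}, monoid.mult = (*), one = 1\<^sub>m n\<rparr>"

definition group_center :: "('a, 'b) monoid_scheme \<Rightarrow> 'a set" where
  "group_center G =
     {z \<in> carrier G. \<forall>g\<in>carrier G. z \<otimes>\<^bsub>G\<^esub> g = g \<otimes>\<^bsub>G\<^esub> z}"

definition PSL :: "nat \<Rightarrow> 'a::field set \<Rightarrow> 'a mat set monoid" where
  "PSL n K = SL n K Mod group_center (SL n K)"

end

theory Submission
  imports Defs "HOL-Number_Theory.Cong" "HOL-Algebra.Sylow"
begin

text \<open>
  The affine maps \<open>x \<mapsto> l * x + u\<close> with \<open>l\<close> a square are automorphisms. If no automorphism moves a pair with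
  square difference to a pair with nonsquare difference, then all automorphisms preserve \<open>quad_char (x - y)\<close>,
  and by Carlitz's theorem they are semilinear. Otherwise the automorphism group is two-transitive, and it
  suffices that automorphisms fixing \<open>0\<close> are additive: for \<open>a \<noteq> b\<close> an additive automorphism multiplies
  \<open>quad_char\<close> by a constant sign, so Carlitz's theorem applies again.

  Let \<open>B\<close> be the subquasigroup generated by \<open>0\<close> and \<open>1\<close>. If \<open>B\<close> is everything, the group is sharply two-transitive
  and its translations are normal. Otherwise counting arcs shows that either \<open>B\<close> is a proper subfield, whose lines
  are then preserved, or \<open>card B = 3\<close> and the quasigroup is a Netto triple system. In a Netto system without
  Pasch configurations every group of automorphisms of two-power order fixes more than three points, which contradicts
  two-transitivity by Sylow's theorem. In the remaining Netto systems the Pasch configurations determine the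
  midpoints, or, in characteristic \<open>7\<close>, the lines over the prime field, so that automorphisms are again additive.
  Only the Fano plane escapes.
\<close>

section \<open>Finite fields and their subfields\<close>

text \<open>Carlitz's theorem is the only bridge from combinatorics to algebra: an automorphism that
  multiplies the quadratic character of differences by a constant sign has the form
  \<open>l * x ^ (p ^ k) + u\<close>, and computing f (0 \<star> z) in two ways shows that this
  Frobenius power fixes a and b if l is a square and exchanges them otherwise. An exchange restricts
  to an automorphism of K of order two, so card K is a square \<gamma>^2 and b = a^\<gamma>; this is
  the origin of the twist. What resists is the two-transitive case, where nothing but the
  subquasigroups is at hand to show that the sign is constant. A block of three points carries no
  coordinates: there a and b are the two roots of X^2 - X + 1, the operation returns the third point
  of a triple, and the additive structure has to be recovered from configurations of several
  triples. Over seven elements this is impossible, since the Fano plane has more collineations than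
  there are semilinear maps. For a = b the operation is K-linear, and linear algebra alone gives the
  group.\<close>

lemma prime_char: "normalization_semidom_class.prime (CHAR('a::{field,finite}))"
  by (simp add: finite_imp_CHAR_pos prime_CHAR_semidom)

lemma power_card_minus_1:
  fixes x :: "'a::{field,finite}"
  assumes "x \<noteq> 0"
  shows "x ^ (CARD('a) - 1) = 1"
proof -
  have "(\<Prod>y\<in>UNIV-{0}. x * y) = x ^ (CARD('a) - 1) * \<Prod>(UNIV-{0})"
    by (simp add: prod.distrib)
  moreover have "(\<Prod>y\<in>UNIV-{0}. x * y) = (\<Prod>y\<in>UNIV-{0}. y)"
    by (rule prod.reindex_bij_witness[of _ "\<lambda>y. y / x" "\<lambda>y. x * y"]) (use assms in auto)
  ultimately show ?thesis
    by simp
qed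

lemma power_card:
  fixes x :: "'a::{field,finite}"
  shows "x ^ CARD('a) = x"
proof (cases "x = 0")
  case False
  have "x ^ CARD('a) = x * x ^ (CARD('a) - 1)"
    by (metis Suc_pred' finite_UNIV_card_ge_0 finite power_Suc)
  with power_card_minus_1[OF False] show ?thesis by simp
qed simp

lemma poly_eqI_card:
  fixes P Q :: "'a::{field,finite} Polynomial.poly"
  assumes "\<And>x. poly P x = poly Q x"
    and "Polynomial.degree P < CARD('a)" and "Polynomial.degree Q < CARD('a)"
  shows "P = Q"
proof (rule ccontr)
  assume "P \<noteq> Q"
  then have "card {x. poly (P - Q) x = 0} \<le> Polynomial.degree (P - Q)"
    by (intro card_poly_roots_bound) auto
  moreover have "{x. poly (P - Q) x = 0} = UNIV" using assms(1) by auto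
  moreover have "Polynomial.degree (P - Q) < CARD('a)"
    using assms(2,3) by (rule degree_diff_less)
  ultimately show False by simp
qed

text \<open>If some nonzero z0 has \<open>z0 ^ k \<noteq> 1\<close>, substituting z0 * z for z
  multiplies the sum by \<open>z0 ^ k\<close>, so the sum vanishes. Such a z0 exists unless q - 1
  divides k, because X^r - 1 with r = k mod (q - 1) has at most r < q - 1 roots. For k = 0 the term
  at 0 counts as 1, and the sum is q = 0 in the field.\<close>

lemma sum_powers_field:
  "(\<Sum>z\<in>UNIV. z ^ k :: 'a::{field,finite}) = (if k > 0 \<and> (CARD('a) - 1) dvd k then - 1 else 0)"
proof -
  have card0: "of_nat (CARD('a)) = (0::'a)"
  proof -
    have "(\<Sum>z\<in>UNIV. z) = (\<Sum>z\<in>UNIV. z + 1 :: 'a)"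
      by (rule sum.reindex_bij_witness[of _ "\<lambda>y. y + 1" "\<lambda>y. y - 1"]) auto
    then show ?thesis by (simp add: sum.distrib)
  qed
  have card2: "CARD('a) \<ge> 2"
    using card_mono[of UNIV "{0::'a, 1}"] by simp
  consider "k = 0" | "k > 0" "(CARD('a) - 1) dvd k" | "\<not> (CARD('a) - 1) dvd k" by force
  then show ?thesis
  proof cases
    case 1
    then show ?thesis using card0 by simp
  next
    case 2
    then obtain t where t: "k = (CARD('a) - 1) * t" by auto
    have "(\<Sum>z\<in>UNIV. z ^ k :: 'a) = 0 ^ k + (\<Sum>z\<in>UNIV-{0}. z ^ k)"
      by (simp add: sum.remove)
    also have "(\<Sum>z\<in>UNIV-{0}. z ^ k :: 'a) = (\<Sum>z\<in>UNIV-{0::'a}. 1)"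
      by (rule sum.cong) (auto simp: t power_mult power_card_minus_1[simplified])
    also have "\<dots> = of_nat (CARD('a) - 1)" by simp
    also have "\<dots> = - 1" using card0 card2 by (simp add: of_nat_diff)
    finally show ?thesis using 2 by (simp add: power_0_left)
  next
    case 3
    define r where "r = k mod (CARD('a) - 1)"
    have r: "0 < r" "r < CARD('a) - 1" using 3 card2 by (auto simp: r_def dvd_eq_mod_eq_0)
    have "\<exists>z::'a. z \<noteq> 0 \<and> z ^ k \<noteq> 1"
    proof (rule ccontr)
      assume "\<not> ?thesis"
      then have all: "z ^ k = 1" if "z \<noteq> 0" for z :: 'a using that by blast
      have "z ^ r = 1" if "z \<noteq> 0" for z :: 'a
      proof -
        have "z ^ k = (z ^ (CARD('a) - 1)) ^ (k div (CARD('a) - 1)) * z ^ r"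
          unfolding r_def by (metis mult_div_mod_eq power_add power_mult)
        then show ?thesis using all[OF that] power_card_minus_1[OF that] by simp
      qed
      then have sub: "UNIV - {0::'a} \<subseteq> {x. poly (Polynomial.monom 1 r - 1) x = 0}"
        by (auto simp: poly_monom)
      have "Polynomial.coeff (Polynomial.monom (1::'a) r - 1) r \<noteq> 0" using r by auto
      then have nz: "Polynomial.monom (1::'a) r - 1 \<noteq> 0" by force
      have "Polynomial.degree (Polynomial.monom (1::'a) r - 1) \<le> r"
        by (rule degree_diff_le) (auto simp: degree_monom_le)
      with card_poly_roots_bound[OF nz] card_mono[OF _ sub] r show False by simp
    qed
    then obtain z0 :: 'a where z0: "z0 \<noteq> 0" "z0 ^ k \<noteq> 1" by blast
    have "(\<Sum>z\<in>UNIV. z ^ k :: 'a) = (\<Sum>z\<in>UNIV. (z0 * z) ^ k)"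
      by (rule sum.reindex_bij_witness[of _ "\<lambda>y. z0 * y" "\<lambda>y. y / z0"]) (use z0 in auto)
    also have "\<dots> = z0 ^ k * (\<Sum>z\<in>UNIV. z ^ k)"
      by (simp add: power_mult_distrib sum_distrib_left)
    finally have "(1 - z0 ^ k) * (\<Sum>z\<in>UNIV. z ^ k :: 'a) = 0" by (simp add: algebra_simps)
    with z0 3 show ?thesis by auto
  qed
qed

text \<open>The digits of an exponent \<open>j\<close> in base \<open>p\<close> are \<open>d 0, d 1, \<dots>\<close>; the exponent
  \<open>(p ^ n - 1) div 2\<close> has all its digits equal to \<open>(p - 1) div 2\<close>.\<close>

lemma binomial_half_nonzero:
  fixes h :: nat
  assumes h: "CHAR('a::{field,finite}) = 2 * h + 1"
    and d: "\<And>l. d l \<le> h"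
  shows "of_nat (((CHAR('a) ^ n - 1) div 2) choose (\<Sum>l<n. d l * CHAR('a) ^ l)) \<noteq> (0::'a)"
proof -
  let ?p = "CHAR('a)"
  let ?L = "[:1, 1:] :: 'a Polynomial.poly"
  have coeffL: "Polynomial.coeff (?L ^ N) k = of_nat (N choose k)" for N k
    using coeff_linear_poly_power[of k N 1 1]
    by (cases "k \<le> N") (auto simp: coeff_eq_0 degree_linear_power binomial_eq_0)
  \<comment> \<open>By the freshman's dream P^p is a polynomial in X^p, so its coefficients at
    exponents with a nonzero remainder modulo p vanish.\<close>
  have ppow: "Polynomial.coeff (P ^ ?p) (?p * J + e) =
      (if e = 0 then Polynomial.coeff P J ^ ?p else 0)" if "e < ?p" for P :: "'a Polynomial.poly" and J e
  proof -
    have pr: "normalization_semidom_class.prime CHAR('a Polynomial.poly)"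
      by (simp add: prime_char)
    have "P ^ ?p = (\<Sum>i\<le>Polynomial.degree P. Polynomial.monom (Polynomial.coeff P i) i) ^ ?p"
      by (simp add: poly_as_sum_of_monoms)
    also have "\<dots> = (\<Sum>i\<le>Polynomial.degree P. Polynomial.monom (Polynomial.coeff P i) i ^ ?p)"
      by (rule freshmans_dream_sum[OF pr]) simp
    also have "\<dots> = (\<Sum>i\<le>Polynomial.degree P. Polynomial.monom (Polynomial.coeff P i ^ ?p) (?p * i))"
      by (simp add: monom_power mult.commute)
    finally have "Polynomial.coeff (P ^ ?p) (?p * J + e) =
        (\<Sum>i\<le>Polynomial.degree P. if ?p * i = ?p * J + e then Polynomial.coeff P i ^ ?p else 0)"
      by (simp add: coeff_sum)
    also have "\<dots> = (\<Sum>i\<le>Polynomial.degree P. if i = J then (if e = 0 then Polynomial.coeff P J ^ ?p else 0) else 0)"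
    proof (rule sum.cong[OF refl])
      fix i
      have "?p * i = ?p * J + e \<longleftrightarrow> i = J \<and> e = 0"
      proof
        assume eq: "?p * i = ?p * J + e"
        have "e = 0" using arg_cong[OF eq, of "\<lambda>x. x mod ?p"] that by simp
        then show "i = J \<and> e = 0" using eq that by simp
      qed simp
      then show "(if ?p * i = ?p * J + e then Polynomial.coeff P i ^ ?p else 0) =
         (if i = J then (if e = 0 then Polynomial.coeff P J ^ ?p else 0) else 0)" by auto
    qed
    also have "\<dots> = (if e = 0 then Polynomial.coeff P J ^ ?p else 0)"
      using h by (auto simp: coeff_eq_0 not_le power_0_left)
    finally show ?thesis .
  qed
  \<comment> \<open>As h < p, only one term of the convolution meets an exponent divisible by p.
    This is Lucas' congruence for the lowest digit.\<close>
  have step: "Polynomial.coeff (P ^ ?p * ?L ^ h) (?p * J + e) = Polynomial.coeff P J ^ ?p * of_nat (h choose e)"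
    if "e \<le> h" for P :: "'a Polynomial.poly" and J e
  proof -
    have "Polynomial.coeff (P ^ ?p * ?L ^ h) (?p * J + e) =
      (\<Sum>i\<le>?p * J + e. Polynomial.coeff (?L ^ h) i * Polynomial.coeff (P ^ ?p) (?p * J + e - i))"
      by (subst mult.commute) (simp add: coeff_mult)
    also have "\<dots> = (\<Sum>i\<le>?p * J + e. if i = e then of_nat (h choose e) * Polynomial.coeff P J ^ ?p else 0)"
    proof (rule sum.cong[OF refl])
      fix i assume i: "i \<in> {..?p * J + e}"
      show "Polynomial.coeff (?L ^ h) i * Polynomial.coeff (P ^ ?p) (?p * J + e - i) =
        (if i = e then of_nat (h choose e) * Polynomial.coeff P J ^ ?p else 0)"
      proof (cases "i \<le> h")
        case False
        then show ?thesis using that by (auto simp: coeffL binomial_eq_0)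
      next
        case ih: True
        show ?thesis
        proof (cases "i \<le> e")
          case True
          then have "?p * J + e - i = ?p * J + (e - i)" by simp
          moreover have "e - i < ?p" using that h by simp
          ultimately show ?thesis using ppow[of "e - i" P J] True by (auto simp: coeffL)
        next
          case False
          then obtain J' where J': "J = Suc J'" using i by (cases J) auto
          have "?p * J + e - i = ?p * J' + (?p + e - i)" using False ih h by (simp add: J' algebra_simps)
          moreover have "?p + e - i < ?p" "?p + e - i > 0" using False ih h by auto
          ultimately show ?thesis using ppow[of "?p + e - i" P J'] False by auto
        qed
      qed
    qed
    also have "\<dots> = of_nat (h choose e) * Polynomial.coeff P J ^ ?p" by simp
    finally show ?thesis by (simp add: mult.commute)
  qed
  have hch: "of_nat (h choose e) \<noteq> (0::'a)" if "e \<le> h" for e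
  proof
    assume "of_nat (h choose e) = (0::'a)"
    then have "?p dvd (h choose e)" by (simp add: of_nat_eq_0_iff_char_dvd)
    then have "?p dvd fact h"
      using binomial_fact_lemma[OF that] by (metis dvd_mult)
    then have "?p \<le> h" using prime_dvd_fact_iff[OF prime_char[where 'a='a]] by simp
    then show False using h by simp
  qed
  have half: "(?p ^ Suc n - 1) div 2 = ?p * ((?p ^ n - 1) div 2) + h" for n
  proof -
    have "odd (?p ^ n)" using h by simp
    then obtain k where k: "?p ^ n = 2 * k + 1" using oddE by blast
    show ?thesis by (simp add: k) (simp add: h)
  qed
  show ?thesis using d
  proof (induction n arbitrary: d)
    case 0
    then show ?case by simp
  next
    case (Suc n)
    have s: "(\<Sum>l<Suc n. d l * ?p ^ l) = ?p * (\<Sum>l<n. d (Suc l) * ?p ^ l) + d 0"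
      by (subst sum.lessThan_Suc_shift) (simp add: sum_distrib_left mult_ac)
    have IH: "of_nat (((?p ^ n - 1) div 2) choose (\<Sum>l<n. d (Suc l) * ?p ^ l)) \<noteq> (0::'a)"
      using Suc.IH[of "\<lambda>l. d (Suc l)"] Suc.prems by blast
    have "of_nat (((?p ^ Suc n - 1) div 2) choose (\<Sum>l<Suc n. d l * ?p ^ l)) =
      Polynomial.coeff ((?L ^ ((?p ^ n - 1) div 2)) ^ ?p * ?L ^ h) (?p * (\<Sum>l<n. d (Suc l) * ?p ^ l) + d 0)"
      by (simp only: s half power_add mult.commute[of ?p "(?p ^ n - 1) div 2"] power_mult flip: coeffL)
    also have "\<dots> = of_nat (((?p ^ n - 1) div 2) choose (\<Sum>l<n. d (Suc l) * ?p ^ l)) ^ ?p * of_nat (h choose d 0)"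
      using step[of "d 0"] Suc.prems by (simp add: coeffL)
    finally show ?case using IH hch[of "d 0"] Suc.prems by simp
  qed
qed

section \<open>Subfields as plain sets, and their orders\<close>

definition is_subfield :: "'a::field set \<Rightarrow> bool" where
  "is_subfield E \<longleftrightarrow> 1 \<in> E \<and> (\<forall>x\<in>E. \<forall>y\<in>E. x - y \<in> E \<and> x * y \<in> E)"

lemma is_subfieldD:
  assumes "is_subfield E"
  shows "1 \<in> E" and "0 \<in> E" and "x \<in> E \<Longrightarrow> - x \<in> E"
    and "x \<in> E \<Longrightarrow> y \<in> E \<Longrightarrow> x - y \<in> E" and "x \<in> E \<Longrightarrow> y \<in> E \<Longrightarrow> x * y \<in> E"
    and "x \<in> E \<Longrightarrow> y \<in> E \<Longrightarrow> x + y \<in> E"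
proof -
  show 1: "1 \<in> E" and d: "x \<in> E \<Longrightarrow> y \<in> E \<Longrightarrow> x - y \<in> E"
    and "x \<in> E \<Longrightarrow> y \<in> E \<Longrightarrow> x * y \<in> E" for x y using assms by (auto simp: is_subfield_def)
  show 0: "0 \<in> E" using d[OF 1 1] by simp
  show n: "x \<in> E \<Longrightarrow> - x \<in> E" for x using d[OF 0, of x] by simp
  show "x \<in> E \<Longrightarrow> y \<in> E \<Longrightarrow> x + y \<in> E" using d[of x "- y"] n by simp
qed

lemma power_card_subfield:
  fixes x :: "'a::{field,finite}"
  assumes E: "is_subfield E" and x: "x \<in> E"
  shows "x ^ card E = x"
proof (cases "x = 0")
  case True
  have "card E > 0" using is_subfieldD(1)[OF E] by (auto simp: card_gt_0_iff)
  then show ?thesis using True by (metis zero_power)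
next
  case False
  have im: "(\<lambda>y. x * y) ` (E - {0}) = E - {0}"
    by (rule endo_inj_surj) (use False x is_subfieldD(5)[OF E] in \<open>auto simp: inj_on_def\<close>)
  have "(\<Prod>y\<in>E-{0}. y) = (\<Prod>y\<in>(\<lambda>y. x * y) ` (E-{0}). y)" using im by simp
  also have "\<dots> = (\<Prod>y\<in>E-{0}. x * y)"
    by (subst prod.reindex) (use False in \<open>auto simp: inj_on_def\<close>)
  also have "\<dots> = x ^ (card E - 1) * (\<Prod>y\<in>E-{0}. y)"
    using is_subfieldD(2)[OF E] by (simp add: prod.distrib)
  finally have "x ^ (card E - 1) = 1" by simp
  moreover have "x ^ card E = x * x ^ (card E - 1)"
    using is_subfieldD(2)[OF E] by (metis Suc_pred' card_gt_0_iff empty_iff finite power_Suc)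
  ultimately show ?thesis by simp
qed

text \<open>The inverse of a nonzero element is one of its powers, with exponent card E - 2, so that
  closure under inverses follows from closure under products.\<close>

lemma is_subfield_inverse:
  fixes x :: "'a::{field,finite}"
  assumes E: "is_subfield E" and x: "x \<in> E"
  shows "inverse x \<in> E"
proof (cases "x = 0")
  case False
  have p: "x ^ n \<in> E" for n by (induction n) (use x is_subfieldD[OF E] in auto)
  have "{0, 1} \<subseteq> E" using is_subfieldD[OF E] by simp
  then have c: "card E \<ge> 2" using card_mono[of E "{0::'a, 1}"] by simp
  then have "x ^ card E = x * x * x ^ (card E - 2)"
    by (metis add_2_eq_Suc le_add_diff_inverse mult.assoc power_Suc)
  then have "x * x ^ (card E - 2) = 1" using power_card_subfield[OF E x] False by simp
  then show ?thesis using p by (metis inverse_unique)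
qed (use is_subfieldD[OF E] in simp)

text \<open>Applied with c = 1 to sets of fixed points of a power map, and with c = - 1 to the image
  of x^\<gamma> - x on K.\<close>

lemma card_subfield_roots:
  fixes A :: "'a::{field,finite} set"
  assumes "\<And>x. x \<in> A \<Longrightarrow> x ^ n = c * x" and n: "n > 1"
  shows "card A \<le> n"
proof -
  let ?P = "Polynomial.monom 1 n - [:0, c:] :: 'a Polynomial.poly"
  have "Polynomial.coeff ?P n = 1" using n by (auto simp: coeff_pCons split: nat.split)
  then have nz: "?P \<noteq> 0" by force
  have "Polynomial.degree ?P \<le> n"
    by (rule degree_diff_le) (use n in \<open>auto simp: degree_monom_le\<close>)
  moreover have "A \<subseteq> {x. poly ?P x = 0}" using assms(1) by (auto simp: poly_monom mult.commute)
  then have "card A \<le> card {x. poly ?P x = 0}" by (rule card_mono[rotated]) simp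
  ultimately show ?thesis using card_poly_roots_bound[OF nz] by simp
qed

text \<open>Both sets consist of roots of X^n - X, where n is their common order; there are at most
  n of them, so the union is no larger than E.\<close>

lemma is_subfield_eqI_card:
  fixes E E' :: "'a::{field,finite} set"
  assumes "is_subfield E" "is_subfield E'" "card E = card E'"
  shows "E = E'"
proof -
  have "{0, 1} \<subseteq> E" using is_subfieldD[OF assms(1)] by simp
  then have c: "card E \<ge> 2" using card_mono[of E "{0::'a, 1}"] by simp
  have "card (E \<union> E') \<le> card E"
    by (rule card_subfield_roots[where c=1])
      (use power_card_subfield[OF assms(1)] power_card_subfield[OF assms(2)] assms(3) c in auto)
  then have "E \<union> E' = E" by (metis Un_upper1 card_seteq finite)
  then show ?thesis using assms(3) by (metis Un_upper2 card_subset_eq finite)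
qed

lemma F_ring_simps [simp]:
  "carrier F_ring = UNIV" "x \<otimes>\<^bsub>F_ring\<^esub> y = x * y" "x \<oplus>\<^bsub>F_ring\<^esub> y = x + y"
  "\<one>\<^bsub>F_ring\<^esub> = 1" "\<zero>\<^bsub>F_ring\<^esub> = 0"
  by (simp_all add: ring_of_type_algebra_def)

lemma F_ring_a_inv [simp]: "\<ominus>\<^bsub>F_ring\<^esub> x = - x"
proof -
  interpret field "F_ring :: 'a ring" by (rule field_from_type_algebra)
  show ?thesis by (rule minus_equality) auto
qed

lemma F_ring_m_inv [simp]: "x \<noteq> 0 \<Longrightarrow> inv\<^bsub>F_ring\<^esub> x = inverse x"
proof -
  interpret field "F_ring :: 'a ring" by (rule field_from_type_algebra)
  show "x \<noteq> 0 \<Longrightarrow> inv\<^bsub>F_ring\<^esub> x = inverse x"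
    by (rule comm_inv_char) auto
qed

lemma subfield_F_ring_iff:
  fixes E :: "'a::{field,finite} set"
  shows "subfield E F_ring \<longleftrightarrow> is_subfield E"
proof
  interpret field "F_ring :: 'a ring" by (rule field_from_type_algebra)
  show "is_subfield E" if "subfield E F_ring"
  proof -
    note s = subringE[OF subfieldE(1)[OF that], simplified]
    show ?thesis unfolding is_subfield_def
      using s(3,5,6,7) by (metis diff_conv_add_uminus)
  qed
  show "subfield E F_ring" if E: "is_subfield E"
    by (rule subfieldI', rule subringI) (use is_subfieldD[OF E] is_subfield_inverse[OF E] in auto)
qed

lemma least_subfield_minimal:
  fixes E :: "'a::{field,finite} set"
  assumes "is_subfield E" "S \<subseteq> E"
  shows "least_subfield S \<subseteq> E"
proof -
  interpret field "F_ring :: 'a ring" by (rule field_from_type_algebra)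
  show ?thesis unfolding least_subfield_def
    by (rule generate_field_min_subfield1) (use assms in \<open>auto simp: subfield_F_ring_iff\<close>)
qed

lemma least_subfield_is_subfield:
  fixes S :: "'a::{field,finite} set"
  shows "is_subfield (least_subfield S)" and "S \<subseteq> least_subfield S"
proof -
  interpret field "F_ring :: 'a ring" by (rule field_from_type_algebra)
  show "is_subfield (least_subfield S)" unfolding least_subfield_def
    using generate_field_is_subfield[of S] by (simp add: subfield_F_ring_iff)
  show "S \<subseteq> least_subfield S" unfolding least_subfield_def
    by (auto intro: generate_field.incl)
qed

text \<open>Turns the abstract dimension of HOL-Algebra into explicit coordinates. They serve to
  count the elements of a subfield and, later, to identify the whole field with column vectors over
  K.\<close>

lemma subfield_basis:
  fixes L E :: "'a::{field,finite} set"
  assumes L: "is_subfield L" and E: "0 \<in> E" "\<And>x y. x \<in> E \<Longrightarrow> y \<in> E \<Longrightarrow> x + y \<in> E"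
    "\<And>c x. c \<in> L \<Longrightarrow> x \<in> E \<Longrightarrow> c * x \<in> E"
  obtains Us where "length Us = ext_degree E L"
    "bij_betw (\<lambda>Ks. \<Sum>i<length Us. Ks ! i * Us ! i) {Ks. set Ks \<subseteq> L \<and> length Ks = length Us} E"
proof -
  interpret field "F_ring :: 'a ring" by (rule field_from_type_algebra)
  have comb: "combine Ks Us = (\<Sum>i<length Us. Ks ! i * Us ! i)" if "length Ks = length Us" for Ks Us
    using that by (induction Ks Us rule: list_induct2) (simp_all add: sum.lessThan_Suc_shift del: sum.lessThan_Suc)
  have sL: "subfield L F_ring" using L by (simp add: subfield_F_ring_iff)
  have neg: "- x \<in> E" if "x \<in> E" for x
    using E(3)[of "-1" x] that is_subfieldD(1,3)[OF L] by simp
  have "subgroup E (add_monoid F_ring)"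
    by (rule add.subgroupI) (use E neg in auto)
  then have sub: "subalgebra L E F_ring"
    unfolding subalgebra_def subalgebra_axioms_def using E by simp
  obtain Es where Es: "set Es = E" using finite_list[of E] by auto
  have "Span L Es = E"
    using subalgebra_Span_incl[OF sL sub, of Es] Span_base_incl[OF sL, of Es] Es by auto
  then have fd: "finite_dimension L E" using Span_finite_dimension[OF sL, of Es] by simp
  have "dimension (ext_degree E L) L E"
    using finite_dimensionE[OF sL fd] by (simp add: ext_degree_def over_def)
  from exists_base[OF sL this] obtain Us where
    Us: "independent L Us" "length Us = ext_degree E L" "Span L Us = E" by blast
  note un = unique_decomposition[OF sL Us(1), unfolded Us(3)]
  have mem: "combine Ks Us \<in> E" if "set Ks \<subseteq> L" for Ks
    using Span_eq_combine_set[OF sL, of Us] Us(3) that by auto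
  have "bij_betw (\<lambda>Ks. combine Ks Us) {Ks. set Ks \<subseteq> L \<and> length Ks = length Us} E"
    unfolding bij_betw_def
  proof
    show "inj_on (\<lambda>Ks. combine Ks Us) {Ks. set Ks \<subseteq> L \<and> length Ks = length Us}"
    proof (rule inj_onI)
      fix Ks Ks' assume "Ks \<in> {Ks. set Ks \<subseteq> L \<and> length Ks = length Us}"
        "Ks' \<in> {Ks. set Ks \<subseteq> L \<and> length Ks = length Us}" "combine Ks Us = combine Ks' Us"
      then show "Ks = Ks'" using un[OF mem[of Ks]] by auto
    qed
    show "(\<lambda>Ks. combine Ks Us) ` {Ks. set Ks \<subseteq> L \<and> length Ks = length Us} = E"
      using mem un by (auto simp: image_def) metis
  qed
  then have "bij_betw (\<lambda>Ks. \<Sum>i<length Us. Ks ! i * Us ! i) {Ks. set Ks \<subseteq> L \<and> length Ks = length Us} E"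
    by (subst bij_betw_cong[where g="\<lambda>Ks. combine Ks Us"]) (auto simp: comb)
  with Us(2) that show thesis by blast
qed

lemma card_subfield_power:
  fixes L E :: "'a::{field,finite} set"
  assumes "is_subfield L" "is_subfield E" "L \<subseteq> E"
  shows "card E = card L ^ ext_degree E L"
proof -
  obtain Us where "length Us = ext_degree E L"
    "bij_betw (\<lambda>Ks. \<Sum>i<length Us. Ks ! i * Us ! i) {Ks. set Ks \<subseteq> L \<and> length Ks = length Us} E"
    by (rule subfield_basis[OF assms(1), of E]) (use is_subfieldD[OF assms(2)] assms(3) in auto)
  then show ?thesis
    using bij_betw_same_card card_lists_length_eq[of L "length Us"] by fastforce
qed

text \<open>E is a vector space over the prime field, realised as the residues
  \<open>of_nat k\<close> with k < p; the dimension is positive because E contains 0 and 1.\<close>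

lemma card_prime_power:
  fixes E :: "'a::{field,finite} set"
  assumes E: "is_subfield E"
  shows "\<exists>n>0. card E = CHAR('a) ^ n"
proof -
  let ?p = "CHAR('a)"
  define L :: "'a set" where "L = of_nat ` {..<?p}"
  have p: "?p > 0" using prime_char[where 'a='a] by (simp add: prime_gt_0_nat)
  have Lmem: "of_nat k \<in> L" for k
  proof -
    have "of_nat k = (of_nat (k mod ?p) :: 'a)"
      by (metis add_0 mod_mult_div_eq mult_zero_left of_nat_CHAR of_nat_add of_nat_mult add.commute)
    then show ?thesis using p by (auto simp: L_def)
  qed
  have "inj_on (of_nat :: nat \<Rightarrow> 'a) {..<?p}"
  proof (rule linorder_inj_onI)
    fix x y assume "x < y" "x \<in> {..<?p}" "y \<in> {..<?p}"
    show "of_nat x \<noteq> (of_nat y :: 'a)"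
    proof
      assume "of_nat x = (of_nat y :: 'a)"
      then have "of_nat (y - x) = (0::'a)" using \<open>x < y\<close> by (simp add: of_nat_diff)
      then have "?p dvd y - x" by (simp add: of_nat_eq_0_iff_char_dvd)
      then show False using \<open>x < y\<close> \<open>y \<in> _\<close> by (auto dest: dvd_imp_le)
    qed
  qed auto
  then have cL: "card L = ?p" by (simp add: L_def card_image)
  have L: "is_subfield L"
    unfolding is_subfield_def
  proof (intro conjI ballI)
    show "1 \<in> L" using Lmem[of 1] by simp
    fix x y assume "x \<in> L" "y \<in> L"
    then obtain i j where ij: "x = of_nat i" "y = of_nat j" "j < ?p" by (auto simp: L_def)
    have "x - y = of_nat (i + (?p - j))" using ij by (simp add: of_nat_diff)
    then show "x - y \<in> L" by (simp add: Lmem del: of_nat_add)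
    show "x * y \<in> L" using Lmem[of "i * j"] ij by simp
  qed
  have "of_nat k \<in> E" for k by (induction k) (use is_subfieldD[OF E] in auto)
  then have "L \<subseteq> E" by (auto simp: L_def)
  from card_subfield_power[OF L E this] have ce: "card E = ?p ^ ext_degree E L" by (simp add: cL)
  have "{0, 1} \<subseteq> E" using is_subfieldD[OF E] by simp
  then have c: "card E \<ge> 2" using card_mono[of E "{0::'a, 1}"] by simp
  then have "ext_degree E L > 0" using ce by (cases "ext_degree E L") auto
  then show ?thesis using ce by blast
qed

section \<open>Carlitz's theorem\<close>

text \<open>Multiplication by p modulo p^n - 1 rotates the n base-p digits, so some rotation has a
  nonzero top digit. The least i for which e * p^i reaches p^(n-1) is suitable: the product is still
  below p^n - 1, hence unreduced, as for i > 0 it is divisible by p and p^n - 1 is not.\<close>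

lemma exponent_shift_large:
  fixes p n e N :: nat
  assumes p: "p > 1" and e: "0 < e" "e < p ^ n - 1" and N: "e * p ^ N \<ge> p ^ (n - 1)" and n: "n > 0"
  shows "\<exists>i\<le>N. e * p ^ i mod (p ^ n - 1) \<ge> p ^ (n - 1)"
proof -
  define i where "i = (LEAST i. e * p ^ i \<ge> p ^ (n - 1))"
  have i: "e * p ^ i \<ge> p ^ (n - 1)" "i \<le> N"
    unfolding i_def by (rule LeastI[of _ N], fact N) (rule Least_le, fact N)
  have "e * p ^ i < p ^ n - 1"
  proof (cases i)
    case 0
    then show ?thesis using e by simp
  next
    case (Suc k)
    then have "\<not> e * p ^ k \<ge> p ^ (n - 1)" using not_less_Least[of k "\<lambda>i. p ^ (n - 1) \<le> e * p ^ i"] by (simp add: i_def)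
    then have "e * p ^ i < p * p ^ (n - 1)" using Suc p by simp
    also have "\<dots> = p ^ n" using n by (cases n) auto
    finally have "e * p ^ i \<le> p ^ n - 1" by simp
    moreover have "e * p ^ i \<noteq> p ^ n - 1"
    proof
      assume eq: "e * p ^ i = p ^ n - 1"
      have "p dvd e * p ^ i" using Suc by simp
      moreover have "p dvd p ^ n" using n by simp
      moreover have "p ^ n > 0" using p by simp
      then have "p ^ n = e * p ^ i + 1" using eq by linarith
      ultimately have "p dvd 1" by (metis dvd_add_right_iff)
      then show False using p by simp
    qed
    ultimately show ?thesis by simp
  qed
  then show ?thesis using i by auto
qed

text \<open>The reduced exponent has to stay positive for the sake of x = 0, where the exponent 0
  would give 1.\<close>

lemma power_mod_card:
  fixes x :: "'a::{field,finite}"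
  assumes "k mod (CARD('a) - 1) > 0"
  shows "x ^ (k mod (CARD('a) - 1)) = x ^ k"
proof (cases "x = 0")
  case True
  then show ?thesis using assms by (metis gr_zeroI mod_0 power_eq_0_iff)
next
  case False
  have "x ^ k = (x ^ (CARD('a) - 1)) ^ (k div (CARD('a) - 1)) * x ^ (k mod (CARD('a) - 1))"
    by (metis mult_div_mod_eq power_add power_mult)
  then show ?thesis using power_card_minus_1[OF False] by simp
qed

text \<open>Multiplying \<open>(g x - g y) ^ m = (x - y) ^ m\<close> by a power of \<open>g y\<close> and summing over \<open>y\<close>
  isolates a single power of \<open>g x\<close> on the left, and leaves a polynomial of degree at most \<open>m\<close> on the right.\<close>

lemma power_low_degree:
  fixes g :: "'a::{field,finite} \<Rightarrow> 'a"
  assumes m: "CARD('a) = 2 * m + 1"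
    and g: "\<And>x y. (g x - g y) ^ m = (x - y) ^ m"
    and j: "j \<le> m" "of_nat (m choose j) \<noteq> (0::'a)"
  shows "\<exists>R. Polynomial.degree R \<le> m \<and> (\<forall>x. poly R x = g x ^ j)"
proof -
  have m0: "m > 0" using m card_mono[of UNIV "{0::'a, 1}"] by (cases m) auto
  have "inj g"
  proof (rule injI)
    fix x y assume "g x = g y"
    then have "(x - y) ^ m = 0" using g[of x y] m0 by (metis cancel_comm_monoid_add_class.diff_cancel zero_power)
    then show "x = y" by simp
  qed
  then have bij: "bij g" by (simp add: finite_UNIV_inj_surj bij_def)
  define j0 where "j0 = m - j"
  define k where "k = (of_nat (m choose j) * (- 1) ^ j0 :: 'a)"
  have k: "k \<noteq> 0" using j by (simp add: k_def)
  \<comment> \<open>Expanding \<open>(g x - g y) ^ m\<close> pairs \<open>g x ^ i\<close> with a sum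
    of powers of g y of exponent 2 m + j - i. As g is a bijection, this is a power sum over the
    whole field; the exponent lies strictly between 0 and 4 m, so the sum is nonzero only if the
    exponent is 2 m = q - 1, that is, if i = j.\<close>
  have s: "(\<Sum>y\<in>UNIV. g y ^ (2 * m - j0) * (x - y) ^ m) = - k * g x ^ j" for x
  proof -
    have "(\<Sum>y\<in>UNIV. g y ^ (2 * m - j0) * (x - y) ^ m) =
      (\<Sum>y\<in>UNIV. g y ^ (2 * m - j0) * (g x + (- g y)) ^ m)" using g by simp
    also have "\<dots> = (\<Sum>y\<in>UNIV. \<Sum>i\<le>m. of_nat (m choose i) * g x ^ i * (- 1) ^ (m - i) * g y ^ (2 * m - j0 + (m - i)))"
      by (simp only: binomial_ring sum_distrib_left power_minus[of "g _"] power_add mult_ac)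
    also have "\<dots> = (\<Sum>i\<le>m. \<Sum>y\<in>UNIV. of_nat (m choose i) * g x ^ i * (- 1) ^ (m - i) * g y ^ (2 * m - j0 + (m - i)))"
      by (rule sum.swap)
    also have "\<dots> = (\<Sum>i\<le>m. of_nat (m choose i) * g x ^ i * (- 1) ^ (m - i) * (\<Sum>y\<in>UNIV. g y ^ (2 * m - j0 + (m - i))))"
      by (simp add: sum_distrib_left)
    also have "\<dots> = (\<Sum>i\<le>m. if i = j then - k * g x ^ j else 0)"
    proof (rule sum.cong[OF refl])
      fix i assume i: "i \<in> {..m}"
      have "(\<Sum>y\<in>UNIV. g y ^ (2 * m - j0 + (m - i))) = (\<Sum>z\<in>UNIV. z ^ (2 * m - j0 + (m - i)))"
        using sum.reindex_bij_betw[OF bij, of "\<lambda>z. z ^ (2 * m - j0 + (m - i))"] by simp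
      also have "\<dots> = (if i = j then - 1 else 0)"
      proof -
        have pos: "2 * m - j0 + (m - i) > 0" using m0 j by (simp add: j0_def)
        have "2 * m dvd 2 * m - j0 + (m - i) \<longleftrightarrow> i = j"
        proof
          assume "2 * m dvd 2 * m - j0 + (m - i)"
          then obtain t where t: "2 * m - j0 + (m - i) = 2 * m * t" by blast
          have "2 * m - j0 + (m - i) < 2 * m * 2" using m0 by simp
          then have "2 * m * t < 2 * m * 2" using t by simp
          then have "t < 2" by (rule mult_less_cancel1[THEN iffD1, THEN conjunct2])
          moreover have "t \<noteq> 0" using t pos by (metis mult_0_right neq0_conv)
          ultimately have "t = 1" by simp
          then have "2 * m - j0 + (m - i) = 2 * m" using t by simp
          then show "i = j" using j i by (simp add: j0_def)
        next
          assume "i = j"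
          then have "2 * m - j0 + (m - i) = 2 * m" using j by (simp add: j0_def)
          then show "2 * m dvd 2 * m - j0 + (m - i)" by simp
        qed
        then show ?thesis unfolding sum_powers_field m using pos by simp
      qed
      finally show "of_nat (m choose i) * g x ^ i * (- 1) ^ (m - i) * (\<Sum>y\<in>UNIV. g y ^ (2 * m - j0 + (m - i)))
        = (if i = j then - k * g x ^ j else 0)" by (simp add: k_def j0_def)
    qed
    also have "\<dots> = - k * g x ^ j" using j by simp
    finally show ?thesis .
  qed
  define R where "R = Polynomial.smult (- 1 / k) (\<Sum>y\<in>UNIV. Polynomial.smult (g y ^ (2 * m - j0)) ([:- y, 1:] ^ m))"
  have "Polynomial.degree R \<le> m"
    unfolding R_def
    by (intro order.trans[OF degree_smult_le] degree_sum_le) (auto simp: degree_linear_power intro: order.trans[OF degree_smult_le])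
  moreover have "poly R x = g x ^ j" for x
    using s[of x] k by (simp add: R_def poly_sum poly_power)
  ultimately show ?thesis by blast
qed

text \<open>With p = 2 h + 1, a power of g whose exponent has all base-p digits at most h is a
  polynomial of degree at most m. The maps \<open>g ^ (p ^ i)\<close> are given by polynomials
  \<open>Q i\<close>, whose exponents are those of g with their digits rotated. Degree bounds on
  products of h-th powers of the \<open>Q i\<close> allow only one of them to reach degree p^(n-1),
  that is, to have an exponent with nonzero top digit. So the exponents of g have a single nonzero
  digit, in a common place, and a degree bound makes this digit 1.\<close>

theorem carlitz:
  fixes g :: "'a::{field,finite} \<Rightarrow> 'a"
  assumes m: "CARD('a) = 2 * m + 1"
    and g: "\<And>x y. (g x - g y) ^ m = (x - y) ^ m" and g0: "g 0 = 0" and g1: "g 1 = 1"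
  shows "\<exists>l. \<forall>x. g x = x ^ (CHAR('a) ^ l)"
proof -
  let ?p = "CHAR('a)"
  let ?q = "CARD('a)"
  obtain n where n: "n > 0" "?q = ?p ^ n"
    using card_prime_power[of "UNIV::'a set"] by (auto simp: is_subfield_def)
  have pr: "normalization_semidom_class.prime ?p" by (rule prime_char)
  have "odd ?p" using n m by (metis even_power odd_two_times_div_two_succ dvd_triv_left even_add odd_one)
  then obtain h where h: "?p = 2 * h + 1" by (rule oddE)
  have p3: "?p \<ge> 3" using h prime_gt_1_nat[OF pr] by presburger
  have h1: "h \<ge> 1" using p3 h by simp
  have m0: "m > 0" using m card_mono[of UNIV "{0::'a, 1}"] by (cases m) auto
  have mn: "m = (?p ^ n - 1) div 2" using m n by simp
  have mh: "(?p - 1) * N \<le> ?q - 1" if "h * N \<le> m" for N using that h m by simp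
  have q: "?q = ?p * ?p ^ (n - 1)" using n by (cases n) auto
  have qm: "?q - 1 = 2 * m" using m by simp
  have low: "\<exists>R. Polynomial.degree R \<le> m \<and> (\<forall>x. poly R x = g x ^ (\<Sum>l<n. d l * ?p ^ l))"
    if d: "\<And>l. d l \<le> h" for d
  proof (rule power_low_degree[OF m g])
    show nz: "of_nat (m choose (\<Sum>l<n. d l * ?p ^ l)) \<noteq> (0::'a)"
      unfolding mn using h d by (rule binomial_half_nonzero)
    show "(\<Sum>l<n. d l * ?p ^ l) \<le> m"
    proof (rule ccontr)
      assume "\<not> ?thesis"
      then have "m choose (\<Sum>l<n. d l * ?p ^ l) = 0" by (simp add: binomial_eq_0)
      with nz show False by simp
    qed
  qed
  have low1: "\<exists>R. Polynomial.degree R \<le> m \<and> (\<forall>x. poly R x = g x ^ (j * ?p ^ i))" if "i < n" "j \<le> h" for i j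
  proof -
    have "(\<Sum>l<n. (if l = i then j else 0) * ?p ^ l) = (\<Sum>l<n. if l = i then j * ?p ^ i else 0)"
      by (rule sum.cong) auto
    also have "\<dots> = j * ?p ^ i" using that by simp
    finally show ?thesis using low[of "\<lambda>l. if l = i then j else 0"] that by simp
  qed
  have low2: "\<exists>R. Polynomial.degree R \<le> m \<and> (\<forall>x. poly R x = g x ^ (h * ?p ^ i + h * ?p ^ i'))"
    if "i < n" "i' < n" "i \<noteq> i'" for i i'
  proof -
    have "(\<Sum>l<n. (if l = i \<or> l = i' then h else 0) * ?p ^ l) =
      (\<Sum>l<n. (if l = i then h * ?p ^ i else 0) + (if l = i' then h * ?p ^ i' else 0))"
      by (rule sum.cong) (use that in auto)
    also have "\<dots> = h * ?p ^ i + h * ?p ^ i'" using that by (simp add: sum.distrib)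
    finally show ?thesis using low[of "\<lambda>l. if l = i \<or> l = i' then h else 0"] by simp
  qed
  obtain P where P: "Polynomial.degree P \<le> m" "\<And>x. poly P x = g x"
    using low1[of 0 1] n h1 by auto
  define c where "c = Polynomial.coeff P"
  have "c 0 = 0" using P(2)[of 0] g0 by (simp add: c_def poly_0_coeff_0)
  have gx: "g x = (\<Sum>e\<in>{1..m}. c e * x ^ e)" for x
  proof -
    have "poly P x = (\<Sum>e\<le>m. c e * x ^ e)"
      by (subst poly_as_sum_of_monoms'[OF P(1), symmetric]) (simp add: c_def poly_sum poly_monom)
    then have "g x = (\<Sum>e\<le>m. c e * x ^ e)" using P(2) by simp
    also have "\<dots> = (\<Sum>e\<in>{1..m}. c e * x ^ e)"
      by (rule sum.mono_neutral_right) (use \<open>c 0 = 0\<close> in \<open>auto simp: not_le\<close>)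
    finally show ?thesis .
  qed
  \<comment> \<open>The exponent into which the p^i-th power turns e, reduced modulo q - 1. It is
    injective in e since p is invertible modulo q - 1.\<close>
  define r where "r i e = e * ?p ^ i mod (?q - 1)" for i e
  have cop: "coprime (?p ^ i) (?q - 1)" for i
  proof -
    have "coprime (?q - 1) ?q" using coprime_diff_one_left_nat[of ?q] by simp
    then have "coprime (?q - 1) ?p" using q by (metis coprime_mult_right_iff)
    then show ?thesis by (simp add: coprime_commute)
  qed
  have r_inj: "inj_on (r i) {..<?q - 1}" for i
  proof (rule inj_onI)
    fix x y assume xy: "x \<in> {..<?q - 1}" "y \<in> {..<?q - 1}" "r i x = r i y"
    then have "[x * ?p ^ i = y * ?p ^ i] (mod (?q - 1))" by (simp add: r_def cong_def)
    then have "[x = y] (mod (?q - 1))" using cong_mult_rcancel_nat[OF cop] by blast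
    then show "x = y" using xy by (simp add: cong_def)
  qed
  have r_pos: "r i e > 0" if "e \<in> {1..m}" for i e
  proof -
    have "r i e \<noteq> r i 0" using inj_onD[OF r_inj, of i e 0] that m m0 by auto
    then show ?thesis by (simp add: r_def)
  qed
  have r_less: "r i e < ?q - 1" for i e using qm m0 by (simp add: r_def)
  define Q where "Q i = (\<Sum>e\<in>{1..m}. Polynomial.monom (c e ^ (?p ^ i)) (r i e))" for i
  have Q: "poly (Q i) x = g x ^ (?p ^ i)" for i x
  proof -
    have "g x ^ (?p ^ i) = (\<Sum>e\<in>{1..m}. (c e * x ^ e) ^ (?p ^ i))"
      unfolding gx by (rule freshmans_dream_sum'[OF pr refl])
    also have "\<dots> = (\<Sum>e\<in>{1..m}. c e ^ (?p ^ i) * x ^ r i e)"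
    proof (rule sum.cong[OF refl])
      fix e assume e: "e \<in> {1..m}"
      show "(c e * x ^ e) ^ (?p ^ i) = c e ^ (?p ^ i) * x ^ r i e"
        using power_mod_card[of "e * ?p ^ i" x] r_pos[OF e, of i]
        by (simp add: r_def power_mult_distrib power_mult)
    qed
    finally show ?thesis by (simp add: Q_def poly_sum poly_monom)
  qed
  have degQ: "Polynomial.degree (Q i) < ?q - 1" for i
  proof -
    have "Polynomial.degree (Q i) \<le> ?q - 2" unfolding Q_def
    proof (rule degree_sum_le)
      fix e
      have "r i e \<le> ?q - 2" using r_less[of i e] by linarith
      then show "Polynomial.degree (Polynomial.monom (c e ^ ?p ^ i) (r i e)) \<le> ?q - 2"
        by (rule order.trans[OF degree_monom_le])
    qed simp
    then show ?thesis using qm m0 by simp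
  qed
  have coeffQ: "Polynomial.coeff (Q i) (r i e) = c e ^ (?p ^ i)" if "e \<in> {1..m}" for i e
  proof -
    have "Polynomial.coeff (Q i) (r i e) = (\<Sum>e'\<in>{1..m}. if e' = e then c e ^ (?p ^ i) else 0)"
      unfolding Q_def coeff_sum
    proof (rule sum.cong[OF refl])
      fix e' assume e': "e' \<in> {1..m}"
      have "r i e' = r i e \<longleftrightarrow> e' = e" using inj_on_eq_iff[OF r_inj, of e' e i] that e' qm m0 by auto
      then show "Polynomial.coeff (Polynomial.monom (c e' ^ (?p ^ i)) (r i e')) (r i e) = (if e' = e then c e ^ (?p ^ i) else 0)"
        by auto
    qed
    then show ?thesis using that by simp
  qed
  define E where "E = {e\<in>{1..m}. c e \<noteq> 0}"
  have E_deg: "r i e \<le> Polynomial.degree (Q i)" if "e \<in> E" for i e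
    by (rule le_degree) (use coeffQ[of e i] that in \<open>auto simp: E_def\<close>)
  \<comment> \<open>The induction keeps the degree of \<open>Q i ^ Suc j\<close> at most 2 m < q, so
    that agreement of all values with R is equality of polynomials, and the bound m for R
    applies.\<close>
  have degB: "h * Polynomial.degree (Q i) \<le> m" if i: "i < n" for i
  proof -
    have "j \<le> h \<Longrightarrow> j * Polynomial.degree (Q i) \<le> m" for j
    proof (induction j)
      case (Suc j)
      obtain R where R: "Polynomial.degree R \<le> m" "\<And>x. poly R x = g x ^ (Suc j * ?p ^ i)"
        using low1[OF i Suc.prems] by blast
      obtain R1 where R1: "Polynomial.degree R1 \<le> m" "\<And>x. poly R1 x = g x ^ (1 * ?p ^ i)"
        using low1[OF i h1] by blast
      have "R1 = Q i"
        by (rule poly_eqI_card) (use R1 Q degQ[of i] qm m in auto)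
      then have "Polynomial.degree (Q i) \<le> m" using R1 by simp
      then have "Suc j * Polynomial.degree (Q i) \<le> 2 * m" using Suc by simp
      moreover have dp: "Polynomial.degree (Q i ^ Suc j) = Suc j * Polynomial.degree (Q i)"
        by (rule degree_power_eq) (metis Q poly_0 power_one zero_neq_one g1)
      ultimately have "Q i ^ Suc j = R"
        using R m by (intro poly_eqI_card) (auto simp: Q power_mult[symmetric] power_add mult.commute)
      then show ?case using R dp by simp
    qed simp
    then show ?thesis by simp
  qed
  \<comment> \<open>Two large degrees would give a product of h-th powers of degree at least 2 h
    p^(n-1) = q - p^(n-1), which exceeds m.\<close>
  have degA: "\<not> (Polynomial.degree (Q i) \<ge> ?p ^ (n - 1) \<and> Polynomial.degree (Q i') \<ge> ?p ^ (n - 1))"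
    if i: "i < n" "i' < n" "i \<noteq> i'" for i i'
  proof
    assume big: "Polynomial.degree (Q i) \<ge> ?p ^ (n - 1) \<and> Polynomial.degree (Q i') \<ge> ?p ^ (n - 1)"
    obtain R where R: "Polynomial.degree R \<le> m" "\<And>x. poly R x = g x ^ (h * ?p ^ i + h * ?p ^ i')"
      using low2[OF i] by blast
    have nz: "Q i \<noteq> 0" for i by (metis Q poly_0 power_one zero_neq_one g1)
    have dp: "Polynomial.degree (Q i ^ h * Q i' ^ h) = h * Polynomial.degree (Q i) + h * Polynomial.degree (Q i')"
      using nz by (simp add: degree_mult_eq degree_power_eq)
    then have "Polynomial.degree (Q i ^ h * Q i' ^ h) \<le> 2 * m" using degB[OF i(1)] degB[OF i(2)] by simp
    then have "Q i ^ h * Q i' ^ h = R"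
      using R m by (intro poly_eqI_card) (auto simp: Q power_mult[symmetric] power_add mult.commute)
    then have "h * Polynomial.degree (Q i) + h * Polynomial.degree (Q i') \<le> m" using dp R by simp
    moreover have "h * ?p ^ (n - 1) \<le> h * Polynomial.degree (Q i)" "h * ?p ^ (n - 1) \<le> h * Polynomial.degree (Q i')"
      using big by auto
    ultimately have "2 * h * ?p ^ (n - 1) \<le> m" unfolding mult.assoc by linarith
    moreover have "2 * m + 1 = (2 * h + 1) * ?p ^ (n - 1)" using q m h by simp
    then have "2 * m + 1 = 2 * h * ?p ^ (n - 1) + ?p ^ (n - 1)" by (simp add: algebra_simps)
    moreover have "2 * 1 * ?p ^ (n - 1) \<le> 2 * h * ?p ^ (n - 1)" using h1 by (intro mult_right_mono) auto
    moreover have "?p ^ (n - 1) > 0" using p3 by simp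
    ultimately show False by linarith
  qed
  have "E \<noteq> {}"
  proof
    assume "E = {}"
    then have "g 1 = 0" unfolding gx by (auto simp: E_def intro!: sum.neutral)
    then show False using g1 by simp
  qed
  then obtain e0 where e0: "e0 \<in> E" by blast
  have Elt: "0 < e" "e < ?p ^ n - 1" if "e \<in> E" for e using that qm m0 n by (auto simp: E_def)
  have ex: "\<exists>i<n. r i e \<ge> ?p ^ (n - 1)" if "e \<in> E" for e
  proof -
    have "\<exists>i\<le>n-1. e * ?p ^ i mod (?p ^ n - 1) \<ge> ?p ^ (n - 1)"
      by (rule exponent_shift_large) (use p3 Elt[OF that] n in auto)
    then obtain i where "i \<le> n - 1" "r i e \<ge> ?p ^ (n - 1)" by (auto simp: r_def n(2))
    then show ?thesis using n(1) by (intro exI[of _ i]) simp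
  qed
  obtain k where k: "k < n" "r k e0 \<ge> ?p ^ (n - 1)" using ex[OF e0] by blast
  have uniq: "i = k" if "e \<in> E" "i < n" "r i e \<ge> ?p ^ (n - 1)" for i e
    using degA[of i k] that k E_deg[OF that(1), of i] E_deg[OF e0, of k] by fastforce
  \<comment> \<open>The degree bound makes the top digit 1. If the rotated exponent were p^(n-1) + s
    with s > 0, one more rotation would carry this 1 to the last place and give e' = p s + 1; at
    most n - 2 further rotations put a digit of s on top, at an index other than k.\<close>
  have exact: "r k e = ?p ^ (n - 1)" if e: "e \<in> E" for e
  proof (rule ccontr)
    assume ne: "r k e \<noteq> ?p ^ (n - 1)"
    obtain i where "i < n" "r i e \<ge> ?p ^ (n - 1)" using ex[OF e] by blast
    then have "r k e \<ge> ?p ^ (n - 1)" using uniq[OF e] by blast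
    then obtain s where s: "r k e = ?p ^ (n - 1) + s" "s > 0" using ne by (metis le_eq_less_or_eq less_imp_add_positive)
    have bnd: "(?p - 1) * r k e \<le> ?q - 1"
      using order.trans[OF mult_le_mono2[OF E_deg[OF e, of k]] mh[OF degB[OF k(1)]]] .
    have n2: "n \<ge> 2"
    proof (rule ccontr)
      assume "\<not> n \<ge> 2"
      then have "n = 1" using n by simp
      then have "(?p - 1) * r k e \<le> (?p - 1) * 1" using bnd n by simp
      then have "r k e \<le> 1" using p3 by (subst (asm) mult_le_cancel1) simp
      then show False using s \<open>n = 1\<close> by simp
    qed
    have "s < ?p ^ (n - 1)"
    proof (rule ccontr)
      assume "\<not> ?thesis"
      then have "2 * ?p ^ (n - 1) \<le> r k e" using s by simp
      then have "(?p - 1) * (2 * ?p ^ (n - 1)) \<le> ?q - 1" using bnd mult_le_mono2 order.trans by blast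
      moreover have "?p * ?p ^ (n - 1) \<le> (?p - 1) * 2 * ?p ^ (n - 1)" by (rule mult_right_mono) (use p3 in auto)
      ultimately show False using q m unfolding mult.assoc by linarith
    qed
    then have "s + 1 \<le> ?p ^ (n - 1)" by simp
    then have "?p * (s + 1) \<le> ?p * ?p ^ (n - 1)" by (rule mult_le_mono2)
    then have ub: "?p * s + 1 < ?q - 1" using q p3 by simp
    define e' where "e' = ?p * s + 1"
    have re: "r (k + 1 + j) e = r j e'" for j
    proof -
      have "[e * ?p ^ k = ?p ^ (n - 1) + s] (mod (?q - 1))" using s(1) by (simp add: r_def cong_def) (metis mod_mod_trivial)
      then have "[e * ?p ^ k * ?p = (?p ^ (n - 1) + s) * ?p] (mod (?q - 1))" by (rule cong_scalar_right)
      moreover have "(?p ^ (n - 1) + s) * ?p = (?q - 1) + e'" using q m by (simp add: e'_def algebra_simps)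
      ultimately have "[e * ?p ^ k * ?p = e'] (mod (?q - 1))" by (simp only: cong_def mod_add_self1)
      then have "[e * ?p ^ k * ?p * ?p ^ j = e' * ?p ^ j] (mod (?q - 1))" by (rule cong_scalar_right)
      then show ?thesis by (simp add: r_def cong_def power_add mult_ac)
    qed
    have "\<exists>j\<le>n-2. e' * ?p ^ j mod (?p ^ n - 1) \<ge> ?p ^ (n - 1)"
    proof (rule exponent_shift_large)
      have "?p ^ (n - 1) = ?p * ?p ^ (n - 2)" using n2 by (metis Suc_1 Suc_diff_Suc Suc_le_eq power_Suc)
      also have "\<dots> \<le> e' * ?p ^ (n - 2)"
      proof (rule mult_right_mono)
        have "?p * 1 \<le> ?p * s" using s(2) by (intro mult_left_mono) auto
        then show "?p \<le> e'" unfolding e'_def by linarith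
      qed simp
      finally show "?p ^ (n - 1) \<le> e' * ?p ^ (n - 2)" .
    qed (use p3 ub n in \<open>auto simp: e'_def\<close>)
    then obtain j where j: "j \<le> n - 2" "r j e' \<ge> ?p ^ (n - 1)" by (auto simp: r_def n(2))
    have "?p ^ n = 1 + (?q - 1)" using n m by simp
    then have pn: "[?p ^ n = 1] (mod (?q - 1))" by (simp only: cong_def mod_add_self2)
    have period: "r (i mod n) e = r i e" for i
    proof -
      have "[?p ^ i = ?p ^ (i mod n)] (mod (?q - 1))"
      proof -
        have "?p ^ i = (?p ^ n) ^ (i div n) * ?p ^ (i mod n)" by (metis mult_div_mod_eq power_add power_mult)
        moreover have "[(?p ^ n) ^ (i div n) * ?p ^ (i mod n) = 1 ^ (i div n) * ?p ^ (i mod n)] (mod (?q - 1))"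
          by (intro cong_mult cong_pow pn cong_refl)
        ultimately show ?thesis by simp
      qed
      then have "[e * ?p ^ i = e * ?p ^ (i mod n)] (mod (?q - 1))" by (rule cong_scalar_left)
      then show ?thesis by (simp add: r_def cong_def)
    qed
    have "r ((k + 1 + j) mod n) e \<ge> ?p ^ (n - 1)" using j re period by simp
    then have "(k + 1 + j) mod n = k" using uniq[OF e] n by simp
    moreover have "(k + 1 + j) mod n \<noteq> k"
    proof (cases "k + 1 + j < n")
      case False
      then have "(k + 1 + j) mod n = k + 1 + j - n" using k j n2 by (simp add: mod_if)
      then show ?thesis using j n2 k False by simp
    qed simp
    ultimately show False by blast
  qed
  have gk: "g x ^ (?p ^ k) = x ^ (?p ^ (n - 1))" for x
  proof -
    have "g x ^ (?p ^ k) = (\<Sum>e\<in>{1..m}. c e ^ (?p ^ k) * x ^ (?p ^ (n - 1)))" for x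
    proof -
      have "g x ^ (?p ^ k) = (\<Sum>e\<in>{1..m}. c e ^ (?p ^ k) * x ^ r k e)"
        unfolding Q[symmetric] by (simp add: Q_def poly_sum poly_monom)
      also have "\<dots> = (\<Sum>e\<in>{1..m}. c e ^ (?p ^ k) * x ^ (?p ^ (n - 1)))"
      proof (rule sum.cong[OF refl])
        fix e assume e: "e \<in> {1..m}"
        show "c e ^ (?p ^ k) * x ^ r k e = c e ^ (?p ^ k) * x ^ (?p ^ (n - 1))"
          using exact[of e] e p3 by (cases "c e = 0") (auto simp: E_def)
      qed
      finally show ?thesis .
    qed
    then have a: "g x ^ (?p ^ k) = (\<Sum>e\<in>{1..m}. c e ^ (?p ^ k)) * x ^ (?p ^ (n - 1))" for x
      by (simp add: sum_distrib_right)
    from a[of 1] g1 have "(\<Sum>e\<in>{1..m}. c e ^ (?p ^ k)) = 1" by simp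
    with a[of x] show ?thesis by simp
  qed
  \<comment> \<open>Raising to the power p^(n-k) completes the p^k-th power of g x to its q-th
    power, which is g x itself.\<close>
  have "g x = x ^ (?p ^ (n - 1 + (n - k)))" for x
  proof -
    have "g x = g x ^ (?p ^ k * ?p ^ (n - k))" using power_card[of "g x"] n k by (simp flip: power_add)
    then show ?thesis using gk[of x] by (simp add: power_mult power_add)
  qed
  then show ?thesis by blast
qed

section \<open>Quadratic quasigroups\<close>

locale odd_field =
  fixes F :: "'a::{field,finite} itself"
  assumes odd_card: "odd CARD('a)"
begin

definition half :: nat where "half = (CARD('a) - 1) div 2"

lemma card_half: "CARD('a) = 2 * half + 1"
  using odd_card by (simp add: half_def)

lemma half_pos: "half > 0"
  using card_half card_mono[of UNIV "{0::'a, 1}"] by (cases half) auto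

lemma two_nonzero: "(2::'a) \<noteq> 0"
proof
  assume "(2::'a) = 0"
  then have "(of_nat 2 :: 'a) = 0" by simp
  then have "CHAR('a) dvd 2" by (simp only: of_nat_eq_0_iff_char_dvd)
  then have "CHAR('a) = 2"
    using prime_char[where 'a='a] by (metis primes_dvd_imp_eq two_is_prime_nat)
  moreover obtain n where "n > 0" "CARD('a) = CHAR('a) ^ n"
    using card_prime_power[of "UNIV::'a set"] by (auto simp: is_subfield_def)
  ultimately show False using odd_card by simp
qed

lemma one_neq_minus_one: "(1::'a) \<noteq> - 1" "(- 1::'a) \<noteq> 1"
  using two_nonzero by (metis add.right_inverse one_add_one)+

lemma quad_char_0 [simp]: "quad_char (0::'a) = 0"
  by (simp add: quad_char_def)

lemma quad_char_eq_0 [simp]: "quad_char x = 0 \<longleftrightarrow> x = (0::'a)"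
  by (auto simp: quad_char_def)

lemma quad_char_values: "x = (0::'a) \<or> quad_char x = 1 \<or> quad_char x = - 1"
  by (auto simp: quad_char_def)

lemma quad_char_1_iff: "quad_char x = 1 \<longleftrightarrow> x \<noteq> (0::'a) \<and> (\<exists>y. x = y\<^sup>2)"
  by (auto simp: quad_char_def)

text \<open>Both claims come from one squeeze: nonzero squares are roots of X^half - 1, of which
  there are at most half, while squaring is at most two-to-one on the 2 * half nonzero
  elements.\<close>

lemma euler_criterion: "quad_char x = 1 \<longleftrightarrow> x ^ half = (1::'a)"
  and card_squares: "card {x::'a. quad_char x = 1} = half"
proof -
  let ?S = "{x::'a. quad_char x = 1}"
  let ?R = "{x::'a. x ^ half = 1}"
  have S: "?S \<subseteq> ?R"
  proof
    fix x :: 'a assume "x \<in> ?S"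
    then obtain y where y: "x = y\<^sup>2" "y \<noteq> 0" by (auto simp: quad_char_1_iff)
    then have "x ^ half = y ^ (CARD('a) - 1)" by (simp add: card_half power_mult)
    then show "x \<in> ?R" using power_card_minus_1[OF y(2)] by simp
  qed
  have R: "card ?R \<le> half"
  proof -
    let ?P = "Polynomial.monom 1 half - 1 :: 'a Polynomial.poly"
    have "Polynomial.coeff ?P half = 1" using half_pos by simp
    then have nz: "?P \<noteq> 0" by force
    have "Polynomial.degree ?P \<le> half" by (rule degree_diff_le) (auto simp: degree_monom_le)
    moreover have "?R = {x. poly ?P x = 0}" by (auto simp: poly_monom)
    ultimately show ?thesis using card_poly_roots_bound[OF nz] by simp
  qed
  have "2 * half \<le> 2 * card ?S"
  proof -
    have "UNIV - {0::'a} = (\<Union>s\<in>?S. {y. s = y\<^sup>2})" by (auto simp: quad_char_1_iff)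
    then have "card (UNIV - {0::'a}) = card (\<Union>s\<in>?S. {y. s = y\<^sup>2})" by simp
    also have "\<dots> \<le> (\<Sum>s\<in>?S. card {y. s = y\<^sup>2})" by (rule card_UN_le) simp
    also have "\<dots> \<le> (\<Sum>s\<in>?S. 2)"
    proof (rule sum_mono)
      fix s assume "s \<in> ?S"
      then obtain y where y: "s = y\<^sup>2" by (auto simp: quad_char_1_iff)
      have "{y. s = y\<^sup>2} \<subseteq> {y, - y}" by (auto simp: y power2_eq_iff)
      then have "card {y. s = y\<^sup>2} \<le> card {y, - y}" by (intro card_mono) auto
      also have "\<dots> \<le> 2" by (simp add: card_insert_if)
      finally show "card {y. s = y\<^sup>2} \<le> 2" .
    qed
    also have "\<dots> = 2 * card ?S" by simp
    finally show ?thesis by (simp add: card_half)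
  qed
  then have "card ?R \<le> card ?S" using R by simp
  with S have eq: "?S = ?R" by (intro card_seteq) auto
  then show "quad_char x = 1 \<longleftrightarrow> x ^ half = (1::'a)" by auto
  show "card ?S = half" using \<open>2 * half \<le> 2 * card ?S\<close> R card_mono[OF _ S] by simp
qed

lemma quad_char_power: "of_int (quad_char x) = x ^ half" for x :: 'a
proof (cases "x = 0")
  case True
  then show ?thesis using half_pos by (simp add: power_0_left)
next
  case False
  have "(x ^ half)\<^sup>2 = 1"
    using power_card_minus_1[OF False] by (simp add: card_half mult.commute flip: power_mult)
  then have "x ^ half = 1 \<or> x ^ half = - 1" by (simp add: power2_eq_1_iff)
  then show ?thesis using euler_criterion[of x] quad_char_values[of x] False one_neq_minus_one by auto
qed

text \<open>The characteristic is at least 3, so 0, 1 and -1 stay distinct in the field. Identities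
  for the integer-valued character may therefore be proved in the field, where it is a
  power.\<close>

lemma of_int_sign_inj:
  "k \<in> {0, 1, - 1} \<Longrightarrow> l \<in> {0, 1, - 1} \<Longrightarrow> of_int k = (of_int l :: 'a) \<Longrightarrow> k = l"
proof -
  assume kl: "k \<in> {0, 1, - 1}" "l \<in> {0, 1, - 1}" and eq: "of_int k = (of_int l :: 'a)"
  have "int CHAR('a) dvd k - l" using eq by (simp add: of_int_eq_iff_cong_CHAR cong_iff_dvd_diff)
  moreover have "CHAR('a) \<noteq> 2" using two_nonzero by (metis of_nat_CHAR of_nat_numeral)
  then have "CHAR('a) > 2" using prime_ge_2_nat[OF prime_char[where 'a='a]] by simp
  ultimately show "k = l" using kl zdvd_imp_le[of "int CHAR('a)" "k - l"] zdvd_imp_le[of "int CHAR('a)" "l - k"]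
    by (auto simp: dvd_diff_commute)
qed

lemma quad_char_mult: "quad_char (x * y) = quad_char x * quad_char y" for x y :: 'a
proof -
  have "of_int (quad_char (x * y)) = (of_int (quad_char x * quad_char y) :: 'a)"
    by (simp add: quad_char_power power_mult_distrib)
  moreover have "quad_char x * quad_char y \<in> {0, 1, - 1}"
    using quad_char_values[of x] quad_char_values[of y] by auto
  moreover have "quad_char (x * y) \<in> {0, 1, - 1}"
    using quad_char_values[of "x * y"] by auto
  ultimately show ?thesis using of_int_sign_inj by blast
qed

lemma quad_char_one [simp]: "quad_char (1::'a) = 1"
  by (auto simp: quad_char_1_iff intro: exI[of _ 1])

lemma quad_char_inverse: "quad_char (inverse x) = quad_char x" for x :: 'a
proof (cases "x = 0")
  case False
  have "quad_char (inverse x) * quad_char x = 1" using False by (simp flip: quad_char_mult)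
  then show ?thesis using quad_char_values[of x] quad_char_values[of "inverse x"] by auto
qed simp

lemma quad_char_divide: "quad_char (x / y) = quad_char x * quad_char y" for x y :: 'a
  by (simp add: divide_inverse quad_char_mult quad_char_inverse)

lemma quad_char_minus: "quad_char (- x) = quad_char (- 1 :: 'a) * quad_char x" for x :: 'a
  using quad_char_mult[of "- 1" x] by simp

lemma quad_char_minus_one: "quad_char (- 1 :: 'a) = 1 \<or> quad_char (- 1 :: 'a) = - 1"
  using quad_char_values[of "- 1"] by simp

lemma card_nonsquares: "card {x::'a. quad_char x = - 1} = half"
proof -
  have "UNIV = {0::'a} \<union> {x. quad_char x = 1} \<union> {x. quad_char x = - 1}" using quad_char_values by auto
  then have "CARD('a) = card ({0::'a} \<union> {x. quad_char x = 1} \<union> {x. quad_char x = - 1})" by simp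
  also have "\<dots> = 1 + half + card {x::'a. quad_char x = - 1}"
    by (subst card_Un_disjoint; (subst card_Un_disjoint)?) (auto simp: card_squares)
  finally show ?thesis by (simp add: card_half)
qed

lemma nonsquare_exists: obtains z :: 'a where "quad_char z = - 1"
  using card_nonsquares half_pos by (metis (mono_tags, lifting) Collect_empty_eq card.empty less_irrefl)

end

section \<open>Quadratic quasigroups and their affine automorphisms\<close>

locale quad_quasigroup = odd_field F for F :: "'a::{field,finite} itself" +
  fixes a b :: 'a
  assumes params: "quad_params a b"
begin

abbreviation op :: "'a \<Rightarrow> 'a \<Rightarrow> 'a" (infixl "\<star>" 70) where
  "x \<star> y \<equiv> quad_mult a b x y"

definition lam :: "'a \<Rightarrow> 'a" where "lam d = (if quad_char d \<ge> 0 then a else b)"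

lemma op_lam: "x \<star> y = x + lam (y - x) * (y - x)"
  by (simp add: quad_mult_def lam_def)

lemma lam_square: "quad_char d = 1 \<Longrightarrow> lam d = a"
  and lam_nonsquare: "quad_char d = - 1 \<Longrightarrow> lam d = b"
  by (simp_all add: lam_def)

lemma lam_cong: "quad_char d = quad_char e \<Longrightarrow> lam d = lam e"
  by (simp add: lam_def)

lemma ab_nonzero: "a \<noteq> 0" "b \<noteq> 0" "a \<noteq> 1" "b \<noteq> 1"
  using params unfolding quad_params_def by (metis quad_char_0 diff_self)+

lemma quad_char_lam: "quad_char (lam d) = quad_char a" "quad_char (1 - lam d) = quad_char (1 - a)"
  using params by (auto simp: quad_params_def lam_def)

lemma op_idem [simp]: "x \<star> x = x"
  by (simp add: op_lam)

lemma zero_op: "0 \<star> y = lam y * y"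
  by (simp add: op_lam)

text \<open>The character of \<open>lam d\<close> does not depend on d, so the character of the
  product determines that of d, and with it \<open>lam d\<close>. This is the use of \<chi>(a) =
  \<chi>(b); in the same way \<chi>(1 - a) = \<chi>(1 - b) gives cancellation on the right.\<close>

lemma lam_mult_inj: "lam d * d = lam e * e \<Longrightarrow> d = e"
proof -
  assume eq: "lam d * d = lam e * e"
  have na: "quad_char a \<noteq> 0" using params unfolding quad_params_def by blast
  have "quad_char a * quad_char d = quad_char a * quad_char e"
    using arg_cong[OF eq, of quad_char] by (simp add: quad_char_mult quad_char_lam)
  then have "lam d = lam e" using na by (intro lam_cong) simp
  then show "d = e" using eq ab_nonzero by (auto simp: lam_def split: if_splits)
qed

lemma op_cancel_left: "x \<star> y = x \<star> z \<longleftrightarrow> y = z"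
  by (metis add_left_cancel diff_add_cancel lam_mult_inj op_lam)

lemma op_cancel_right: "y \<star> x = z \<star> x \<longleftrightarrow> y = z"
proof
  assume eq: "y \<star> x = z \<star> x"
  have e: "(1 - lam (x - w)) * (x - w) = x - w \<star> x" for w by (simp add: op_lam algebra_simps)
  have n1: "quad_char (1 - a) \<noteq> 0" using params unfolding quad_params_def by blast
  have eq': "(1 - lam (x - y)) * (x - y) = (1 - lam (x - z)) * (x - z)" using e eq by simp
  have "quad_char (1 - a) * quad_char (x - y) = quad_char (1 - a) * quad_char (x - z)"
    using arg_cong[OF eq', of quad_char] by (simp add: quad_char_mult quad_char_lam)
  then have "lam (x - y) = lam (x - z)" using n1 by (intro lam_cong) simp
  then have "x - y = x - z" using eq' ab_nonzero by (auto simp: lam_def split: if_splits)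
  then show "y = z" by simp
qed simp

lemma op_eq_left: "x \<star> y = x \<longleftrightarrow> y = x"
  using op_cancel_left[of x y x] by simp

lemma op_eq_right: "x \<star> y = y \<longleftrightarrow> y = x"
  using op_cancel_right[of x y y] by auto

definition G :: "('a \<Rightarrow> 'a) set" where "G = magma_auts (\<star>)"

lemma G_bij: "f \<in> G \<Longrightarrow> bij f" and G_op: "f \<in> G \<Longrightarrow> f (x \<star> y) = f x \<star> f y"
  by (auto simp: G_def magma_auts_def)

lemma GI: "bij f \<Longrightarrow> (\<And>x y. f (x \<star> y) = f x \<star> f y) \<Longrightarrow> f \<in> G"
  by (auto simp: G_def magma_auts_def)

lemma G_inj: "f \<in> G \<Longrightarrow> f x = f y \<longleftrightarrow> x = y"
  using G_bij by (metis bij_is_inj injD)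

lemma G_comp: "f \<in> G \<Longrightarrow> g \<in> G \<Longrightarrow> (\<lambda>x. f (g x)) \<in> G"
  using bij_comp[of g f] by (auto simp: G_def magma_auts_def comp_def)

lemma G_id: "(\<lambda>x. x) \<in> G"
  by (rule GI) (auto simp: bij_def inj_def)

lemma G_inv: "f \<in> G \<Longrightarrow> inv_into UNIV f \<in> G"
  by (rule GI) (auto simp: G_bij bij_imp_bij_inv, metis G_bij G_op bij_inv_eq_iff)

lemma affine_in_G: "quad_char l = 1 \<Longrightarrow> (\<lambda>x. l * x + u) \<in> G"
proof (rule GI)
  assume l: "quad_char l = 1"
  then have "l \<noteq> 0" by auto
  then show "bij (\<lambda>x. l * x + u)"
    by (intro bij_betw_byWitness[where f'="\<lambda>x. (x - u) / l"]) auto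
  fix x y
  have "lam (l * y + u - (l * x + u)) = lam (y - x)"
    using l by (intro lam_cong) (simp add: quad_char_mult flip: right_diff_distrib)
  then show "l * (x \<star> y) + u = (l * x + u) \<star> (l * y + u)"
    by (simp add: op_lam algebra_simps)
qed

lemma shift_in_G: "f \<in> G \<Longrightarrow> (\<lambda>x. f x + u) \<in> G"
  using G_comp[OF affine_in_G[of 1 u], of f] by simp

text \<open>Both classes have \<open>half\<close> elements, so the squares are mapped onto the class
  e, and nothing but the opposite class is left for the nonsquares.\<close>

lemma preserves_or_flips:
  fixes f :: "'a \<Rightarrow> 'a"
  assumes sq: "\<And>x. quad_char x = 1 \<Longrightarrow> quad_char (f x) = e" and e: "e = 1 \<or> e = - 1"
    and f: "bij f" "f 0 = (0::'a)"
  shows "quad_char (f x) = e * quad_char x"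
proof -
  have "f ` {x. quad_char x = 1} \<subseteq> {x. quad_char x = e}" using sq by auto
  moreover have "card (f ` {x. quad_char x = 1}) = half"
    by (subst card_image) (use f in \<open>auto simp: card_squares bij_def inj_on_def\<close>)
  moreover have "card {x::'a. quad_char x = e} = half" using e card_squares card_nonsquares by auto
  ultimately have im: "f ` {x. quad_char x = 1} = {x. quad_char x = e}"
    by (metis (no_types, lifting) card_subset_eq finite)
  have nz: "quad_char (f x) \<noteq> 0" if "x \<noteq> 0" using f that by (metis bij_is_inj injD quad_char_eq_0)
  show ?thesis
  proof (cases "quad_char x = - 1")
    case True
    have "quad_char (f x) \<noteq> e"
    proof
      assume "quad_char (f x) = e"
      then have "f x \<in> f ` {x. quad_char x = 1}" using im by simp
      then obtain y where y: "quad_char y = 1" "f x = f y" by auto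
      then have "x = y" using f(1) by (metis bij_is_inj injD)
      then show False using True y by simp
    qed
    moreover have "x \<noteq> 0" using True by auto
    ultimately show ?thesis using quad_char_values[of "f x"] nz e True by auto
  next
    case False
    then show ?thesis using quad_char_values[of x] sq f by auto
  qed
qed

text \<open>For a square x, a * x is the product 0 \<star> x, which f sends to
  \<open>lam (f x) * f x\<close>. A constant factor \<beta> means that \<open>lam (f x)\<close> is
  constant on squares, and since a \<noteq> b this fixes the class of f x.\<close>

lemma scaling_preserves_or_flips:
  assumes f: "f \<in> G" "f 0 = 0" and ab: "a \<noteq> b"
    and beta: "\<And>x. quad_char x = 1 \<Longrightarrow> f (a * x) = \<beta> * f x"
  shows "\<exists>e. (e = 1 \<or> e = - 1) \<and> (\<forall>x. quad_char (f x) = e * quad_char x)"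
proof -
  have lam: "lam (f x) = \<beta>" "f x \<noteq> 0" if "quad_char x = 1" for x
  proof -
    have "x \<noteq> 0" using that by auto
    then show nz: "f x \<noteq> 0" using G_inj[OF f(1), of x 0] f(2) by simp
    have "f (a * x) = lam (f x) * f x"
      using G_op[OF f(1), of 0 x] that by (simp add: zero_op f(2) lam_square)
    then show "lam (f x) = \<beta>" using beta[OF that] nz by simp
  qed
  define e :: int where "e = (if \<beta> = a then 1 else - 1)"
  have "quad_char (f x) = e" if "quad_char x = 1" for x
    using lam[OF that] quad_char_values[of "f x"] ab by (auto simp: lam_def e_def split: if_splits)
  then show ?thesis
    using preserves_or_flips[of f e, OF _ _ G_bij[OF f(1)] f(2)] by (auto simp: e_def)
qed

text \<open>The affine automorphisms are transitive on the pairs with square difference, so whether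
  some automorphism breaks the character of differences can be tested on the pair (0, 1).\<close>

definition swapping :: bool where
  "swapping \<longleftrightarrow> (\<exists>f\<in>G. f 0 = 0 \<and> quad_char (f 1) = - 1)"

lemma not_swapping_preserves:
  assumes "\<not> swapping" and f: "f \<in> G"
  shows "quad_char (f x - f y) = quad_char (x - y)"
proof -
  have sq: "quad_char (g y - g x) = 1" if g: "g \<in> G" and xy: "quad_char (y - x) = 1" for g x y
  proof -
    define h where "h z = g ((y - x) * z + x) + (- g x)" for z
    have "h \<in> G" unfolding h_def by (intro shift_in_G G_comp[OF g] affine_in_G xy)
    moreover have "h 0 = 0" "h 1 = g y - g x" by (auto simp: h_def)
    moreover have "g y \<noteq> g x" using G_inj[OF g, of x y] xy by auto
    ultimately show ?thesis using assms(1) quad_char_values[of "g y - g x"] by (auto simp: swapping_def)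
  qed
  have iff: "quad_char (f x - f y) = 1 \<longleftrightarrow> quad_char (x - y) = 1"
    using sq[OF f, where x=y and y=x] sq[OF G_inv[OF f], where x="f y" and y="f x"] G_bij[OF f]
    by (auto simp: bij_is_inj)
  show ?thesis using iff quad_char_values[of "f x - f y"] quad_char_values[of "x - y"] G_inj[OF f, of x y]
    by auto
qed

text \<open>Affine automorphisms carry (0, 1) to every pair with square difference. For a nonsquare
  difference a class-changing automorphism g is applied before them; the remaining factor (y - x) /
  g 1 is then a square.\<close>

lemma swapping_two_transitive:
  assumes swapping "x \<noteq> y"
  obtains f where "f \<in> G" "f 0 = x" "f 1 = y"
proof (cases "quad_char (y - x) = 1")
  case True
  then show ?thesis using that[of "\<lambda>z. (y - x) * z + x"] affine_in_G by simp
next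
  case False
  then have n: "quad_char (y - x) = - 1" using quad_char_values[of "y - x"] assms(2) by auto
  obtain g where g: "g \<in> G" "g 0 = 0" "quad_char (g 1) = - 1" using assms(1) by (auto simp: swapping_def)
  then have g1: "g 1 \<noteq> 0" by auto
  have "quad_char ((y - x) / g 1) = 1" using g n by (simp add: quad_char_divide)
  then have mem: "(\<lambda>z. (y - x) / g 1 * g z + x) \<in> G" by (intro G_comp[OF affine_in_G g(1)])
  show ?thesis by (rule that[OF mem]) (use g g1 in simp_all)
qed

lemma flips_differences:
  assumes "\<And>f. f \<in> G \<Longrightarrow> f 0 = 0 \<Longrightarrow> (\<forall>x y. f (x + y) = f x + f y) \<and>
      (\<exists>e. (e = 1 \<or> e = - 1) \<and> (\<forall>x. quad_char (f x) = e * quad_char x))"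
    and f: "f \<in> G"
  shows "\<exists>e. (e = 1 \<or> e = - 1) \<and> (\<forall>x y. quad_char (f x - f y) = e * quad_char (x - y))"
proof -
  define g where "g x = f x + (- f 0)" for x
  have "g \<in> G" unfolding g_def by (rule shift_in_G[OF f])
  have "g 0 = 0" by (simp add: g_def)
  from assms(1)[OF \<open>g \<in> G\<close> this] obtain e where add: "\<And>x y. g (x + y) = g x + g y"
    and e: "e = 1 \<or> e = - 1" "\<And>x. quad_char (g x) = e * quad_char x" by auto
  have "g x - g y = g (x - y)" for x y using add[of "x - y" y] by simp
  then have "f x - f y = g (x - y)" for x y by (simp add: g_def)
  then show ?thesis using e by (intro exI[of _ e]) simp
qed

end

section \<open>Maps preserving lines\<close>

context odd_field
begin

text \<open>A form of the fundamental theorem of affine geometry for lines over E. By finiteness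
  each line is mapped onto a line. Two vectors independent over E are treated by line intersections;
  for dependent ones the sum is split with the help of some w outside E, which is why E must be
  proper.\<close>

lemma lines_into_lines_additive:
  fixes f :: "'a \<Rightarrow> 'a"
  assumes E: "is_subfield E" "E \<noteq> UNIV" and f: "inj f" "f 0 = 0"
    and lines: "\<And>x y c. c \<in> E \<Longrightarrow> \<exists>d\<in>E. f (x + c * (y - x)) = f x + d * (f y - f x)"
  shows "f (x + y) = f x + f y" and "c \<in> E \<Longrightarrow> \<exists>\<beta>. \<forall>x. f (c * x) = \<beta> * f x"
proof -
  note Ed = is_subfieldD[OF E(1)] is_subfield_inverse[OF E(1)]
  have Ediv: "u / v \<in> E" if "u \<in> E" "v \<in> E" for u v
    unfolding divide_inverse by (intro Ed that)
  have fi: "f u = f v \<longleftrightarrow> u = v" for u v using f(1) by (auto simp: inj_def)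
  have onto: "\<exists>c\<in>E. f (x + c * (y - x)) = f x + d * (f y - f x)" if "x \<noteq> y" "d \<in> E" for x y d
  proof -
    define \<phi> where "\<phi> c = (SOME d. d \<in> E \<and> f (x + c * (y - x)) = f x + d * (f y - f x))" for c
    have \<phi>: "\<phi> c \<in> E" "f (x + c * (y - x)) = f x + \<phi> c * (f y - f x)" if "c \<in> E" for c
    proof -
      have "\<exists>d. d \<in> E \<and> f (x + c * (y - x)) = f x + d * (f y - f x)" using lines[OF that, of x y] by blast
      from someI_ex[OF this] show "\<phi> c \<in> E" "f (x + c * (y - x)) = f x + \<phi> c * (f y - f x)"
        unfolding \<phi>_def by auto
    qed
    have "\<phi> ` E = E"
    proof (rule endo_inj_surj)
      show "inj_on \<phi> E"
      proof (rule inj_onI)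
        fix c c' assume c: "c \<in> E" "c' \<in> E" "\<phi> c = \<phi> c'"
        then have "f (x + c * (y - x)) = f (x + c' * (y - x))" using \<phi>(2)[of c] \<phi>(2)[of c'] by simp
        then show "c = c'" using that(1) by (simp add: fi)
      qed
    qed (use \<phi>(1) in auto)
    then have "d \<in> \<phi> ` E" using that(2) by simp
    then obtain c where "c \<in> E" "\<phi> c = d" by blast
    then show ?thesis using \<phi>(2)[of c] by auto
  qed
  have ray: "\<exists>d\<in>E. f (c * y) = d * f y" if "c \<in> E" for c y
    using lines[OF that, of 0 y] by (simp add: f(2))
  have ray_onto: "\<exists>c\<in>E. d * f y = f (c * y)" if "d \<in> E" for d y
  proof (cases "y = 0")
    case True
    then show ?thesis using that f(2) by auto
  next
    case False
    then have "\<exists>c\<in>E. f (c * y) = d * f y" using onto[of 0 y d] that by (simp add: f(2))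
    then show ?thesis by metis
  qed
  have indep: "f y \<noteq> d * f x" if "d \<in> E" "\<And>c. c \<in> E \<Longrightarrow> y \<noteq> c * x" for x y d
    using ray_onto[OF that(1), of x] that(2) by (metis fi)
  have sym: "x \<noteq> c * y" if "x \<noteq> 0" "\<And>c. c \<in> E \<Longrightarrow> y \<noteq> c * x" "c \<in> E" for x y c
  proof
    assume "x = c * y"
    then have "y = inverse c * x" using that(1) by auto
    then show False using that(2)[of "inverse c"] Ed(7)[OF that(3)] by blast
  qed
  \<comment> \<open>The point x + y lies on the line joining - x and y / 2, with parameter 2. This
    puts f (x + y) into the E-span of f x and f y although nothing is known yet about images of
    planes.\<close>
  have half_step: "\<exists>t\<in>E. f (x + y) = f x + t * f y" if x: "x \<noteq> 0" and y: "\<And>c. c \<in> E \<Longrightarrow> y \<noteq> c * x" for x y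
  proof -
    have two: "2 \<in> E" using Ed(6)[OF Ed(1) Ed(1)] by simp
    obtain d where d: "d \<in> E" "f (- x + 2 * (y / 2 - (- x))) = f (- x) + d * (f (y / 2) - f (- x))"
      using lines[OF two, of "- x" "y / 2"] by blast
    have eq: "- x + 2 * (y / 2 - (- x)) = x + y" using two_nonzero by (simp add: field_simps)
    obtain u where u: "u \<in> E" "f (- x) = u * f x" using ray[OF Ed(3)[OF Ed(1)], of x] by (auto simp only: mult_minus1)
    obtain v where v: "v \<in> E" "f (y / 2) = v * f y"
      using ray[OF Ed(7)[OF two], of y] by (auto simp only: divide_inverse mult.commute)
    define s where "s = (1 - d) * u"
    define t where "t = d * v"
    have st: "s \<in> E" "t \<in> E" unfolding s_def t_def by (intro Ed d u v)+
    have fxy: "f (x + y) = s * f x + t * f y"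
      using d(2) unfolding eq u(2) v(2) by (simp add: s_def t_def algebra_simps)
    have "s = 1"
    proof (rule ccontr)
      assume s1: "s \<noteq> 1"
      \<comment> \<open>For this e the coefficient of f x in f x + e (f (x + y) - f x) vanishes. A
        point of x + E y would then share its image with a point of E y, against
        injectivity.\<close>
      define e where "e = - 1 / (s - 1)"
      have eE: "e \<in> E" unfolding e_def by (intro Ediv Ed st)
      have "x \<noteq> x + y" using y[OF Ed(2)] by auto
      then obtain c where c: "c \<in> E" "f (x + c * (x + y - x)) = f x + e * (f (x + y) - f x)"
        using onto[of x "x + y", OF _ eE] by blast
      have "f x + e * (f (x + y) - f x) = (1 + e * (s - 1)) * f x + (e * t) * f y"
        unfolding fxy by (simp add: algebra_simps)
      also have "\<dots> = (e * t) * f y" using s1 by (simp add: e_def)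
      finally have "f (x + c * y) = (e * t) * f y" using c(2) by simp
      moreover obtain c' where "c' \<in> E" "(e * t) * f y = f (c' * y)" using ray_onto[OF Ed(5)[OF eE st(2)], of y] by blast
      ultimately have "x + c * y = c' * y" by (simp add: fi)
      then have "x = (c' - c) * y" by (simp add: algebra_simps)
      moreover have "c' - c \<in> E" by (intro Ed \<open>c' \<in> E\<close> c)
      ultimately show False using sym[OF x y] by blast
    qed
    then show ?thesis using fxy st by auto
  qed
  have indep_add: "f (x + y) = f x + f y" if x: "x \<noteq> 0" and y: "\<And>c. c \<in> E \<Longrightarrow> y \<noteq> c * x" for x y
  proof -
    obtain t where t: "t \<in> E" "f (x + y) = f x + t * f y" using half_step[OF x y] by blast
    have "y \<noteq> 0" using y[OF Ed(2)] by simp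
    then obtain t' where t': "t' \<in> E" "f (y + x) = f y + t' * f x"
      using half_step[of y x] sym[OF x y] by blast
    have eq: "(1 - t) * f y = (1 - t') * f x" using t t' by (simp add: algebra_simps)
    have "t = 1"
    proof (rule ccontr)
      assume "t \<noteq> 1"
      then have "f y = ((1 - t') / (1 - t)) * f x" using eq by (simp add: field_simps)
      moreover have "(1 - t') / (1 - t) \<in> E" by (intro Ediv Ed t t')
      ultimately show False using indep[of _ y x] y by blast
    qed
    then show ?thesis using t by simp
  qed
  obtain w where w: "w \<notin> E" using E(2) by blast
  have wx: "w * x \<noteq> c * x" if "c \<in> E" "x \<noteq> 0" for x c using w that by auto
  \<comment> \<open>Two independent splittings are used: of w x into - x and x + w x, and of x + w x
    into x and w x.\<close>
  have neg: "f (- x) = - f x" if "x \<noteq> 0" for x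
  proof -
    have "f (- x + (x + w * x)) = f (- x) + f (x + w * x)"
    proof (rule indep_add)
      fix c assume c: "c \<in> E"
      show "x + w * x \<noteq> c * - x"
      proof
        assume "x + w * x = c * - x"
        then have "(w + (1 + c)) * x = 0" by (simp add: algebra_simps eq_neg_iff_add_eq_0)
        then have "w = - (1 + c)" using that by (metis eq_neg_iff_add_eq_0 mult_eq_0_iff)
        then show False using w by (metis Ed(1,3,6) c)
      qed
    qed (use that in simp)
    also have "f (x + w * x) = f x + f (w * x)" by (rule indep_add) (use that wx in auto)
    finally show ?thesis by (simp add: eq_neg_iff_add_eq_0)
  qed
  have add: "f (x + y) = f x + f y" for x y
  proof (cases "x = 0 \<or> y = 0")
    case True
    then show ?thesis using f(2) by auto
  next
    case False
    then have nz: "x \<noteq> 0" "y \<noteq> 0" by auto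
    show ?thesis
    proof (cases "\<exists>c\<in>E. y = c * x")
      case False
      then show ?thesis using indep_add nz by blast
    next
      case True
      then obtain c where c: "c \<in> E" "y = c * x" by blast
      show ?thesis
      proof (cases "c = - 1")
        case True
        then show ?thesis using neg nz c f(2) by simp
      next
        case c1: False
        have c0: "c \<noteq> 0" using c nz by auto
        \<comment> \<open>The sum x + c x is rewritten as (x + w x) + (c x - w x). These two vectors
          are independent over E unless c = - 1, which was the preceding case.\<close>
        let ?z = "w * x"
        have z0: "?z \<noteq> 0" using w Ed(2) nz by auto
        have "f ((x + ?z) + (c * x - ?z)) = f (x + ?z) + f (c * x - ?z)"
        proof (rule indep_add)
          show "x + ?z \<noteq> 0"
          proof
            assume "x + ?z = 0"
            then have "(w + 1) * x = 0" by (simp add: algebra_simps)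
            then have "w = - 1" using nz by (metis eq_neg_iff_add_eq_0 mult_eq_0_iff)
            then show False using w by (metis Ed(1,3))
          qed
          fix e assume e: "e \<in> E"
          show "c * x - ?z \<noteq> e * (x + ?z)"
          proof
            assume "c * x - ?z = e * (x + ?z)"
            then have "((c - e) - w * (1 + e)) * x = 0" by (simp add: algebra_simps)
            then have eq: "c - e = w * (1 + e)" using nz by simp
            show False
            proof (cases "1 + e = 0")
              case True
              then have "e = - 1" by (simp add: eq_neg_iff_add_eq_0 add.commute)
              then have "c = - 1" using eq True by (simp add: eq_neg_iff_add_eq_0)
              then show False using c1 by simp
            next
              case False
              then have "w = (c - e) / (1 + e)" using eq by (simp add: field_simps)
              moreover have "(c - e) / (1 + e) \<in> E" by (intro Ediv Ed c e)
              ultimately show False using w by simp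
            qed
          qed
        qed
        also have "f (x + ?z) = f x + f ?z" by (rule indep_add) (use nz wx in auto)
        also have "f (c * x - ?z) = f (c * x) + f (- ?z)"
        proof -
          have "f (c * x + - ?z) = f (c * x) + f (- ?z)"
          proof (rule indep_add)
            fix e assume e: "e \<in> E"
            show "- ?z \<noteq> e * (c * x)"
            proof
              assume "- ?z = e * (c * x)"
              then have "(w + e * c) * x = 0" by (simp add: algebra_simps neg_eq_iff_add_eq_0)
              then have "w = - (e * c)" using nz by (metis eq_neg_iff_add_eq_0 mult_eq_0_iff)
              then show False using w by (metis Ed(3,5) c(1) e)
            qed
          qed (use nz c0 in simp)
          then show ?thesis by simp
        qed
        also have "f (- ?z) = - f ?z" by (rule neg[OF z0])
        finally show ?thesis using c by simp
      qed
    qed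
  qed
  show "f (x + y) = f x + f y" by (rule add)
  assume c: "c \<in> E"
  \<comment> \<open>Line preservation provides a factor in E for each x separately. Additivity makes
    the factors of independent vectors equal, and w links the vectors inside E to each
    other.\<close>
  define \<beta> where "\<beta> x = f (c * x) / f x" for x
  have b: "f (c * x) = \<beta> x * f x" "\<beta> x \<in> E" if "x \<noteq> 0" for x
  proof -
    have "f x \<noteq> 0" using that fi[of x 0] f(2) by simp
    then show "f (c * x) = \<beta> x * f x" by (simp add: \<beta>_def)
    obtain d where "d \<in> E" "f (c * x) = d * f x" using ray[OF c, of x] by blast
    then show "\<beta> x \<in> E" using \<open>f x \<noteq> 0\<close> by (simp add: \<beta>_def)
  qed
  have bb: "\<beta> x = \<beta> y" if x: "x \<noteq> 0" and y: "\<And>c. c \<in> E \<Longrightarrow> y \<noteq> c * x" for x y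
  proof -
    have y0: "y \<noteq> 0" using y[OF Ed(2)] by simp
    have xy0: "x + y \<noteq> 0" using y[OF Ed(3)[OF Ed(1)]] by (auto simp: eq_neg_iff_add_eq_0 add.commute)
    have "\<beta> (x + y) * (f x + f y) = \<beta> x * f x + \<beta> y * f y"
      using b(1)[OF xy0] b(1)[OF x] b(1)[OF y0] by (simp add: add distrib_left)
    then have eq: "(\<beta> (x + y) - \<beta> y) * f y = (\<beta> x - \<beta> (x + y)) * f x" by (simp add: algebra_simps)
    have bE: "\<beta> x \<in> E" "\<beta> y \<in> E" "\<beta> (x + y) \<in> E" using b x y0 xy0 by auto
    have "\<beta> (x + y) = \<beta> y"
    proof (rule ccontr)
      assume ne: "\<beta> (x + y) \<noteq> \<beta> y"
      then have "f y = ((\<beta> x - \<beta> (x + y)) / (\<beta> (x + y) - \<beta> y)) * f x" using eq by (simp add: field_simps)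
      moreover have "(\<beta> x - \<beta> (x + y)) / (\<beta> (x + y) - \<beta> y) \<in> E" by (intro Ediv Ed bE)
      ultimately show False using indep[of _ y x] y by blast
    qed
    moreover have "f x \<noteq> 0" using x fi[of x 0] f(2) by simp
    ultimately show ?thesis using eq by simp
  qed
  have b1: "\<beta> x = \<beta> 1" if x: "x \<noteq> 0" for x
  proof (cases "x \<in> E")
    case False
    have "\<beta> 1 = \<beta> x" by (rule bb) (use False in auto)
    then show ?thesis by simp
  next
    case True
    have "\<beta> 1 = \<beta> w" by (rule bb) (use w in auto)
    moreover have "\<beta> x = \<beta> w"
      by (rule bb) (use x w True Ed(5) in auto)
    ultimately show ?thesis by simp
  qed
  have "f (c * x) = \<beta> 1 * f x" for x
  proof (cases "x = 0")
    case True
    then show ?thesis by (simp add: f(2))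
  next
    case False
    then show ?thesis using b(1)[of x] b1[of x] by metis
  qed
  then show "\<exists>\<beta>. \<forall>x. f (c * x) = \<beta> * f x" by blast
qed

end

section \<open>Generated subquasigroups\<close>

context odd_field
begin

text \<open>These are the pairs inside B to which maps z \<mapsto> l z + u with l a nonzero square
  carry (0, 1).\<close>

definition arcs :: "'a set \<Rightarrow> ('a \<times> 'a) set" where
  "arcs B = {(x, y). x \<in> B \<and> y \<in> B \<and> quad_char (y - x) = 1}"

text \<open>Since V is closed under differences, it is disjoint from its translate by x; both lie in
  B.\<close>

lemma coset_bound:
  fixes V B :: "'a set"
  assumes V: "V \<subseteq> B" "\<And>v w. v \<in> V \<Longrightarrow> w \<in> V \<Longrightarrow> v - w \<in> V" and x: "x \<in> B" "x \<notin> V"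
    and shift: "\<And>v. v \<in> V \<Longrightarrow> v + x \<in> B"
  shows "2 * card V \<le> card B"
proof -
  have disj: "V \<inter> (\<lambda>v. v + x) ` V = {}"
  proof (rule ccontr)
    assume "V \<inter> (\<lambda>v. v + x) ` V \<noteq> {}"
    then obtain v w where "v \<in> V" "w \<in> V" "v = w + x" by auto
    then have "x = v - w" by simp
    then show False using V(2)[OF \<open>v \<in> V\<close> \<open>w \<in> V\<close>] x(2) by simp
  qed
  have "card (V \<union> (\<lambda>v. v + x) ` V) = card V + card V"
    using disj by (simp add: card_Un_disjoint card_image)
  moreover have "V \<union> (\<lambda>v. v + x) ` V \<subseteq> B" using V(1) shift by auto
  then have "card (V \<union> (\<lambda>v. v + x) ` V) \<le> card B" by (intro card_mono) auto
  ultimately show ?thesis by simp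
qed

text \<open>A set that contains \<open>0\<close> and \<open>1\<close> and is mapped to itself by the affine map carrying \<open>(0, 1)\<close> to any of
  its arcs. If no translation preserves it, then all these affine maps commute, so they share a fixed point
  and every element starts at most one arc. Otherwise counting forces the set to be closed
  under addition, and then under multiplication.\<close>

lemma arc_closed_set:
  assumes B: "0 \<in> B" "1 \<in> B"
    and closed: "\<And>x y z. x \<in> B \<Longrightarrow> y \<in> B \<Longrightarrow> quad_char (y - x) = 1 \<Longrightarrow> z \<in> B \<Longrightarrow> x + (y - x) * z \<in> B"
    and k: "card B \<ge> 3" and many: "card B * (card B - 1) \<le> 2 * card (arcs B)"
  shows "is_subfield B \<or> card B = 3 \<and> card (arcs B) = 3"
proof -
  \<comment> \<open>The translational stabiliser of B. Two affine maps of B into itself with equal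
    factors differ by an element of V, as \<open>compare\<close> shows.\<close>
  define V where "V = {v. \<forall>z\<in>B. z + v \<in> B}"
  have surj: "\<exists>z'\<in>B. z = u * z' + v" if u: "u \<noteq> 0" and uv: "\<And>z. z \<in> B \<Longrightarrow> u * z + v \<in> B" and z: "z \<in> B" for u v z
  proof -
    have "(\<lambda>z. u * z + v) ` B = B" by (rule endo_inj_surj) (use u uv in \<open>auto simp: inj_on_def\<close>)
    then have "z \<in> (\<lambda>z. u * z + v) ` B" using z by simp
    then show ?thesis by blast
  qed
  have Vsub: "V \<subseteq> B" using B(1) by (auto simp: V_def)
  have Vdiff: "v - w \<in> V" if v: "v \<in> V" and w: "w \<in> V" for v w
    unfolding V_def
  proof (rule CollectI, rule ballI)
    fix z assume "z \<in> B"
    then obtain z' where "z' \<in> B" "z = 1 * z' + w" using surj[of 1 w z] w by (auto simp: V_def)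
    then have "z' + v \<in> B" using v by (auto simp: V_def)
    then show "z + (v - w) \<in> B" using \<open>z = 1 * z' + w\<close> by simp
  qed
  have V0: "0 \<in> V" by (simp add: V_def)
  have compare: "v - v' \<in> V" if u: "u \<noteq> 0" and uv: "\<And>z. z \<in> B \<Longrightarrow> u * z + v \<in> B" "\<And>z. z \<in> B \<Longrightarrow> u * z + v' \<in> B" for u v v'
    unfolding V_def
  proof (rule CollectI, rule ballI)
    fix z assume "z \<in> B"
    then obtain z' where "z' \<in> B" "z = u * z' + v'" using surj[OF u uv(2)] by blast
    then show "z + (v - v') \<in> B" using uv(1)[of z'] by simp
  qed
  have arcD: "y - x \<noteq> 0" "\<And>z. z \<in> B \<Longrightarrow> (y - x) * z + x \<in> B" "quad_char (y - x) = 1" "x \<in> B" "y \<in> B"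
    if "(x, y) \<in> arcs B" for x y
    using that closed[of x y] by (auto simp: arcs_def add.commute)
  have fin: "finite (arcs B)" by simp
  show ?thesis
  proof (cases "V = {0}")
    case True
    \<comment> \<open>The two composites of the maps of two arcs have the same factor, hence agree
      because V is trivial; the identity compares their constant terms.\<close>
    have comm: "(u - 1) * v' = (u' - 1) * v"
      if "(v, u + v) \<in> arcs B" "(v', u' + v') \<in> arcs B" for u v u' v'
    proof -
      note A = arcD[OF that(1), simplified]
      note A' = arcD[OF that(2), simplified]
      have "(u * v' + v) - (u' * v + v') \<in> V"
      proof (rule compare[where u="u * u'"])
        show "u * u' \<noteq> 0" using A(1) A'(1) by simp
        fix z assume z: "z \<in> B"
        show "u * u' * z + (u * v' + v) \<in> B" using A(2)[OF A'(2)[OF z]] by (simp add: algebra_simps)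
        show "u * u' * z + (u' * v + v') \<in> B" using A'(2)[OF A(2)[OF z]] by (simp add: algebra_simps)
      qed
      then show ?thesis using True by (simp add: algebra_simps)
    qed
    have "\<exists>x y. (x, y) \<in> arcs B \<and> y - x \<noteq> 1"
    proof (rule ccontr)
      assume "\<not> ?thesis"
      then have all: "y - x = 1" if "(x, y) \<in> arcs B" for x y using that by blast
      have "(x, y) = (0, 1)" if "(x, y) \<in> arcs B" for x y
      proof -
        have "x \<in> V" using arcD(2)[OF that] all[OF that] by (simp add: V_def)
        then have "x = 0" using True by simp
        then show ?thesis using all[OF that] by simp
      qed
      then have "arcs B \<subseteq> {(0, 1)}" by auto
      then have "card (arcs B) \<le> 1" using card_mono[of "{(0::'a, 1::'a)}" "arcs B"] by simp
      moreover have "3 * 2 \<le> card B * (card B - 1)" using k by (intro mult_le_mono) auto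
      ultimately show False using many by simp
    qed
    then obtain x0 y0 where xy0: "(x0, y0) \<in> arcs B" "y0 - x0 \<noteq> 1" by blast
    \<comment> \<open>The common fixed point of the maps of all arcs. Through it the endpoint of an
      arc becomes a function of its starting point.\<close>
    define w where "w = x0 / (1 - (y0 - x0))"
    have w: "x = (1 - (y - x)) * w" if "(x, y) \<in> arcs B" for x y
    proof -
      have "(y0 - x0 - 1) * x = (y - x - 1) * x0"
        using comm[of x0 "y0 - x0" x "y - x"] xy0(1) that by simp
      then have "(1 - (y0 - x0)) * x = (1 - (y - x)) * x0" by (simp add: algebra_simps)
      then show ?thesis using xy0(2) by (simp add: w_def field_simps)
    qed
    have w0: "w \<noteq> 0"
    proof
      assume "w = 0"
      then have "arcs B \<subseteq> Pair 0 ` (B - {0})" using w arcD(1,5) by fastforce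
      then have "card (arcs B) \<le> card (Pair (0::'a) ` (B - {0}))" by (intro card_mono) auto
      also have "\<dots> = card B - 1" using B by (simp add: card_image inj_on_def)
      finally have "card B * (card B - 1) \<le> 2 * (card B - 1)" using many by linarith
      then show False using k by simp
    qed
    have "arcs B \<subseteq> (\<lambda>x. (x, x + 1 - x / w)) ` B"
    proof
      fix p assume p: "p \<in> arcs B"
      obtain x y where xy: "p = (x, y)" by (cases p)
      then have "x / w = 1 - (y - x)" using w[of x y] p w0 by (simp add: field_simps)
      then have "p = (x, x + 1 - x / w)" using xy by simp
      then show "p \<in> (\<lambda>x. (x, x + 1 - x / w)) ` B" using arcD(4)[of x y] p xy by blast
    qed
    then have le: "card (arcs B) \<le> card B"
      by (meson card_image_le card_mono finite finite_imageI le_trans)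
    then have "card B * (card B - 1) \<le> card B * 2" using many by linarith
    then have "card B - 1 \<le> 2" using k by (subst (asm) mult_le_cancel1) auto
    then have "card B = 3" using k by simp
    then show ?thesis using le many by simp
  next
    case False
    then obtain v0 where v0: "v0 \<in> V" "v0 \<noteq> 0" using V0 by blast
    \<comment> \<open>Factors of affine maps preserving B. An arc is determined by its factor and by
      the translation separating its map from a chosen one with that factor, so there are at most
      card U * card V arcs. Moreover U acts freely on the nonzero elements of V.\<close>
    define U where "U = {u. quad_char u = 1 \<and> (\<exists>v. \<forall>z\<in>B. u * z + v \<in> B)}"
    define vv where "vv u = (SOME v. \<forall>z\<in>B. u * z + v \<in> B)" for u
    have vv: "u * z + vv u \<in> B" if "u \<in> U" "z \<in> B" for u z
    proof -
      have "\<exists>v. \<forall>z\<in>B. u * z + v \<in> B" using that(1) by (simp add: U_def)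
      from someI_ex[OF this] show ?thesis using that(2) by (simp add: vv_def)
    qed
    have U0: "u \<noteq> 0" if "u \<in> U" for u using that by (auto simp: U_def)
    have arcs_le: "card (arcs B) \<le> card U * card V"
    proof -
      have inj: "inj_on (\<lambda>(x, y). (y - x, x - vv (y - x))) (arcs B)" by (auto simp: inj_on_def)
      have im: "(\<lambda>(x, y). (y - x, x - vv (y - x))) ` arcs B \<subseteq> U \<times> V"
      proof safe
        fix x y assume xy: "(x, y) \<in> arcs B"
        note A = arcD[OF xy]
        show U: "y - x \<in> U" using A by (auto simp: U_def)
        show "x - vv (y - x) \<in> V" by (rule compare[OF A(1,2) vv[OF U]])
      qed
      from card_inj_on_le[OF inj im] show ?thesis by (simp add: card_cartesian_product)
    qed
    have Uv: "u * v \<in> V" if u: "u \<in> U" and v: "v \<in> V" for u v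
      unfolding V_def
    proof (rule CollectI, rule ballI)
      fix z assume "z \<in> B"
      then obtain z' where z': "z' \<in> B" "z = u * z' + vv u" using surj[OF U0[OF u] vv[OF u]] by blast
      have "u * (z' + v) + vv u \<in> B" using vv[OF u] v z'(1) by (simp add: V_def)
      then show "z + u * v \<in> B" using z' by (simp add: algebra_simps)
    qed
    have "card U \<le> card (V - {0})"
      by (rule card_inj_on_le[of "\<lambda>u. u * v0"]) (use v0 Uv U0 in \<open>auto simp: inj_on_def\<close>)
    then have U_le: "card U \<le> card V - 1" using V0 by simp
    \<comment> \<open>Otherwise card V is at most k / 2, where k = card B, and the number of arcs
      would give k (k - 1) \<le> 2 card V (card V - 1) < k (k - 1).\<close>
    have "V = B"
    proof (rule ccontr)
      assume "V \<noteq> B"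
      then obtain x where x: "x \<in> B" "x \<notin> V" using Vsub by blast
      have "2 * card V \<le> card B"
        by (rule coset_bound[OF Vsub Vdiff x]) (use x in \<open>auto simp: V_def add.commute\<close>)
      moreover have "card V > 0" using V0 by (auto simp: card_gt_0_iff)
      ultimately have "card V - 1 < card B - 1" by simp
      have "card B * (card B - 1) \<le> 2 * ((card V - 1) * card V)"
        using many arcs_le mult_le_mono1[OF U_le, of "card V"] by linarith
      also have "\<dots> = (2 * card V) * (card V - 1)" by simp
      also have "\<dots> \<le> card B * (card V - 1)" using \<open>2 * card V \<le> card B\<close> by (rule mult_le_mono1)
      also have "\<dots> < card B * (card B - 1)" using \<open>card V - 1 < card B - 1\<close> k by simp
      finally show False by simp
    qed
    then have Bdiff: "x - y \<in> B" if "x \<in> B" "y \<in> B" for x y using Vdiff that by simp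
    have Badd: "x + y \<in> B" if "x \<in> B" "y \<in> B" for x y using \<open>V = B\<close> that by (auto simp: V_def)
    define SB where "SB = {s\<in>B. quad_char s = 1}"
    have "card (arcs B) = card (B \<times> SB)"
      by (rule bij_betw_same_card[of "\<lambda>(x, y). (x, y - x)"], rule bij_betw_byWitness[where f'="\<lambda>(x, s). (x, x + s)"])
        (auto simp: arcs_def SB_def Bdiff Badd)
    then have "card B * (card B - 1) \<le> card B * (2 * card SB)" using many by (simp add: card_cartesian_product)
    then have SB: "card B - 1 \<le> 2 * card SB" using k by (subst (asm) mult_le_cancel1) auto
    \<comment> \<open>The multipliers of B form an additive group that contains 0 and all squares of
      B. This is more than half of B, hence everything.\<close>
    define E where "E = {c. \<forall>z\<in>B. c * z \<in> B}"
    have Esub: "E \<subseteq> B" using B(2) by (auto simp: E_def)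
    have Ediff: "c - d \<in> E" if "c \<in> E" "d \<in> E" for c d using that Bdiff by (auto simp: E_def left_diff_distrib)
    have "SB \<union> {0} \<subseteq> E" using closed[OF B(1)] B(1) by (auto simp: SB_def E_def)
    moreover have "card (SB \<union> {0}) = card SB + 1" by (subst card_Un_disjoint) (auto simp: SB_def)
    ultimately have "card SB + 1 \<le> card E" using card_mono[of E "SB \<union> {0}"] by simp
    then have E2: "card B < 2 * card E" using SB k by simp
    have "E = B"
    proof (rule ccontr)
      assume "E \<noteq> B"
      then obtain x where x: "x \<in> B" "x \<notin> E" using Esub by blast
      have "2 * card E \<le> card B"
        by (rule coset_bound[OF Esub Ediff x]) (use x Esub Badd in auto)
      then show False using E2 by simp
    qed
    then have "x * y \<in> B" if "x \<in> B" "y \<in> B" for x y using that by (auto simp: E_def)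
    then show ?thesis using B Bdiff by (auto simp: is_subfield_def)
  qed
qed

end

section \<open>Blocks under a two-transitive automorphism group\<close>

context quad_quasigroup
begin

text \<open>Only closure under the product is asked for: on a finite set the translations, being
  injective, are then onto, and the divisions come along.\<close>

definition blk :: "'a \<Rightarrow> 'a \<Rightarrow> 'a set" where
  "blk x y = \<Inter> {B. x \<in> B \<and> y \<in> B \<and> (\<forall>u\<in>B. \<forall>v\<in>B. u \<star> v \<in> B)}"

lemma blk_mem: "x \<in> blk x y" "y \<in> blk x y"
  by (auto simp: blk_def)

lemma blk_op: "u \<in> blk x y \<Longrightarrow> v \<in> blk x y \<Longrightarrow> u \<star> v \<in> blk x y"
  by (auto simp: blk_def)

lemma blk_least:
  assumes "x \<in> B" "y \<in> B" and "\<And>u v. u \<in> B \<Longrightarrow> v \<in> B \<Longrightarrow> u \<star> v \<in> B"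
  shows "blk x y \<subseteq> B"
  using assms by (auto simp: blk_def)

lemma blk_image: "f \<in> G \<Longrightarrow> f ` blk x y = blk (f x) (f y)"
proof
  assume f: "f \<in> G"
  have "blk x y \<subseteq> {z. f z \<in> blk (f x) (f y)}"
    by (rule blk_least) (auto simp: G_op[OF f] blk_mem blk_op)
  then show "f ` blk x y \<subseteq> blk (f x) (f y)" by auto
  show "blk (f x) (f y) \<subseteq> f ` blk x y"
  proof (rule blk_least)
    fix u v assume "u \<in> f ` blk x y" "v \<in> f ` blk x y"
    then obtain u' v' where "u' \<in> blk x y" "u = f u'" "v' \<in> blk x y" "v = f v'" by auto
    then have "u \<star> v = f (u' \<star> v')" "u' \<star> v' \<in> blk x y" by (auto simp: G_op[OF f] blk_op)
    then show "u \<star> v \<in> f ` blk x y" by blast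
  qed (auto simp: blk_mem)
qed

lemma blk_translate: "blk (x + u) (y + u) = (\<lambda>z. z + u) ` blk x y"
  using blk_image[OF affine_in_G[of 1 u], of x y] by simp

lemma blk_scale: "quad_char l = 1 \<Longrightarrow> blk (l * x) (l * y) = (\<lambda>z. l * z) ` blk x y"
  using blk_image[OF affine_in_G[of l 0], of x y] by simp

context
  assumes swap: swapping
begin

lemma card_blk: "x \<noteq> y \<Longrightarrow> card (blk x y) = card (blk 0 1)"
proof -
  assume "x \<noteq> y"
  then obtain f where f: "f \<in> G" "f 0 = x" "f 1 = y" using swapping_two_transitive[OF swap] by blast
  have "card (f ` blk 0 1) = card (blk 0 1)"
    by (rule card_image) (use G_inj[OF f(1)] in \<open>auto simp: inj_on_def\<close>)
  then show ?thesis using blk_image[OF f(1), of 0 1] f by simp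
qed

text \<open>Two-transitivity gives all blocks the same number of points, so a block cannot contain a
  smaller one. Thus two distinct points lie in exactly one block, as with lines.\<close>

lemma blk_eq:
  assumes "x \<noteq> y" "u \<noteq> v" and uv: "u \<in> blk x y" "v \<in> blk x y"
  shows "blk u v = blk x y"
proof (rule card_subset_eq)
  show "blk u v \<subseteq> blk x y" by (rule blk_least[OF uv blk_op])
  show "card (blk u v) = card (blk x y)" using card_blk assms(1,2) by metis
qed simp

lemma full_block_rigid:
  assumes full: "blk 0 1 = UNIV" and f: "f \<in> G" and xy: "x \<noteq> y" "f x = x" "f y = y"
  shows "f z = z"
proof -
  have "card (blk x y) = CARD('a)" using card_blk[OF xy(1)] full by simp
  then have "blk x y = UNIV" by (metis card_subset_eq finite subset_UNIV)
  moreover have "blk x y \<subseteq> {z. f z = z}"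
    by (rule blk_least) (use xy in \<open>auto simp: G_op[OF f]\<close>)
  ultimately show ?thesis by auto
qed

text \<open>In a sharply two-transitive group the translations are the only elements without
  fixed points, hence they are permuted under conjugation.\<close>

lemma full_block_additive:
  assumes full: "blk 0 1 = UNIV" and f: "f \<in> G" "f 0 = 0"
  shows "f (y + c) = f y + f c"
proof (cases "c = 0")
  case True
  then show ?thesis using f by simp
next
  case c0: False
  \<comment> \<open>If h moves some point, then x \<mapsto> h x - x is injective: a coincidence
    would give a translate of h with two fixed points, which is the identity by rigidity. By
    finiteness the map is onto, so every translate of h has a fixed point.\<close>
  have rigid: "\<exists>x. h x - x = d" if h: "h \<in> G" "h 0 = 0" and nid: "h z \<noteq> z" for h d z
  proof -
    have "inj (\<lambda>x. h x - x)"
    proof (rule injI, rule ccontr)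
      fix x y assume eq: "h x - x = h y - y" and ne: "x \<noteq> y"
      have k: "(\<lambda>z. h z + (x - h x)) \<in> G" by (rule shift_in_G[OF h(1)])
      have fix_y: "h y + (x - h x) = y" using eq by (simp add: algebra_simps)
      have fixed: "h w + (x - h x) = w" for w
        using full_block_rigid[OF full k ne _ fix_y] by simp
      from fixed[of 0] h(2) have "x - h x = 0" by simp
      with fixed[of z] nid show False by simp
    qed
    then have "surj (\<lambda>x. h x - x)" by (simp add: finite_UNIV_inj_surj)
    then obtain x where "d = h x - x" by (rule surjE)
    then show ?thesis by auto
  qed
  \<comment> \<open>The conjugate under f of the translation by c; it inherits the absence of fixed
    points.\<close>
  define t where "t x = f (inv_into UNIV f x + c)" for x
  have "(\<lambda>x. inv_into UNIV f x + c) \<in> G" by (rule shift_in_G[OF G_inv[OF f(1)]])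
  then have tG: "t \<in> G" unfolding t_def by (rule G_comp[OF f(1)])
  have tf: "t (f y) = f (y + c)" for y using G_bij[OF f(1)] by (simp add: t_def bij_is_inj)
  have nofix: "t x \<noteq> x" for x
  proof -
    obtain y where "x = f y" using G_bij[OF f(1)] by (metis bij_pointE)
    then show ?thesis using c0 G_inj[OF f(1), of "y + c" y] by (simp add: tf)
  qed
  define h where "h x = t x + (- t 0)" for x
  have "h \<in> G" unfolding h_def by (rule shift_in_G[OF tG])
  moreover have "h 0 = 0" by (simp add: h_def)
  ultimately have h: "h \<in> G" "h 0 = 0" by auto
  have hid: "h z = z" for z
  proof (rule ccontr)
    assume "h z \<noteq> z"
    then obtain x where "h x - x = - t 0" using rigid[OF h] by blast
    then have "t x = x" by (simp add: h_def)
    then show False using nofix by blast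
  qed
  have "t x = x + t 0" for x using hid[of x] by (simp add: h_def algebra_simps)
  moreover have "t 0 = f c" using tf[of 0] f(2) by simp
  ultimately show ?thesis using tf[of y] by simp
qed

text \<open>If f sends one square s to a square, then rescaling by the square s / f s gives an
  automorphism fixing 0 and s, hence the identity, and f is multiplication by f s / s. Otherwise f
  sends all squares to nonsquares.\<close>

lemma full_block_flips:
  assumes full: "blk 0 1 = UNIV" and f: "f \<in> G" "f 0 = 0"
  shows "\<exists>e. (e = 1 \<or> e = - 1) \<and> (\<forall>x. quad_char (f x) = e * quad_char x)"
proof -
  have nz: "f x \<noteq> 0" if "x \<noteq> 0" for x using that G_inj[OF f(1), of x 0] f(2) by simp
  have mult: "f z = (f s / s) * z" if s: "quad_char s = 1" "quad_char (f s) = 1" for s z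
  proof -
    have s0: "s \<noteq> 0" "f s \<noteq> 0" using s by auto
    have "quad_char (s / f s) = 1" using s by (simp add: quad_char_divide)
    from G_comp[OF affine_in_G[OF this, of 0] f(1)] have g: "(\<lambda>z. (s / f s) * f z) \<in> G" by simp
    have "(s / f s) * f z = z"
      by (rule full_block_rigid[OF full g, of 0 s]) (use s0 f(2) in auto)
    then show ?thesis using s0 by (simp add: field_simps)
  qed
  show ?thesis
  proof (cases "quad_char (f 1) = 1")
    case True
    then have "quad_char (f x) = quad_char x" for x
      using mult[of 1 x] by (simp add: quad_char_mult)
    then show ?thesis by (intro exI[of _ 1]) simp
  next
    case False
    have "quad_char (f s) = - 1" if s: "quad_char s = 1" for s
    proof (rule ccontr)
      assume n: "quad_char (f s) \<noteq> - 1"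
      have "f s \<noteq> 0" by (rule nz) (use s in auto)
      then have fs: "quad_char (f s) = 1" using n quad_char_values[of "f s"] by auto
      then have "quad_char (f 1) = 1" using mult[OF s fs, of 1] s by (simp add: quad_char_divide)
      then show False using False by simp
    qed
    then show ?thesis using preserves_or_flips[of f "- 1", OF _ _ G_bij[OF f(1)] f(2)] by (intro exI[of _ "- 1"]) simp
  qed
qed

text \<open>The blocks partition the ordered pairs of distinct points, exactly half of which are
  arcs. A block with at least one arc is an affine image of \<open>blk 0 1\<close> and has as many
  arcs as it. Fewer than half in \<open>blk 0 1\<close> would mean fewer than half in every
  block.\<close>

lemma many_arcs: "card (blk 0 1) * (card (blk 0 1) - 1) \<le> 2 * card (arcs (blk 0 1))"
proof (rule ccontr)
  let ?B = "blk 0 1"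
  let ?k = "card ?B"
  assume few: "\<not> ?thesis"
  define BB where "BB = {blk x y |x y. x \<noteq> y}"
  have arcs_few: "2 * card (arcs \<beta>) < ?k * (?k - 1)" if \<beta>: "\<beta> \<in> BB" for \<beta>
  proof (cases "arcs \<beta> = {}")
    case True
    then show ?thesis using few by (simp only: card.empty)
  next
    case False
    then obtain x y where xy: "x \<in> \<beta>" "y \<in> \<beta>" "quad_char (y - x) = 1" by (auto simp: arcs_def)
    then have ne: "x \<noteq> y" by auto
    obtain u v where "u \<noteq> v" "\<beta> = blk u v" using \<beta> by (auto simp: BB_def)
    then have \<beta>eq: "\<beta> = blk x y" using blk_eq[of u v x y] ne xy by simp
    let ?g = "\<lambda>z. (y - x) * z + x"
    have im: "?g ` ?B = \<beta>" using blk_image[OF affine_in_G[OF xy(3), of x], of 0 1] \<beta>eq by simp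
    have "bij_betw (\<lambda>(z, w). (?g z, ?g w)) (arcs ?B) (arcs \<beta>)"
      unfolding bij_betw_def
    proof
      show "inj_on (\<lambda>(z, w). (?g z, ?g w)) (arcs ?B)" using ne by (auto simp: inj_on_def)
      have qc: "quad_char (?g w - ?g z) = quad_char (w - z)" for z w
      proof -
        have "?g w - ?g z = (y - x) * (w - z)" by (simp add: algebra_simps)
        then show ?thesis using xy(3) by (simp add: quad_char_mult)
      qed
      show "(\<lambda>(z, w). (?g z, ?g w)) ` arcs ?B = arcs \<beta>"
      proof
        show "(\<lambda>(z, w). (?g z, ?g w)) ` arcs ?B \<subseteq> arcs \<beta>"
        proof
          fix p assume "p \<in> (\<lambda>(z, w). (?g z, ?g w)) ` arcs ?B"
          then obtain z w where "(z, w) \<in> arcs ?B" "p = (?g z, ?g w)" by auto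
          then show "p \<in> arcs \<beta>" using im qc[of w z] by (auto simp: arcs_def)
        qed
        show "arcs \<beta> \<subseteq> (\<lambda>(z, w). (?g z, ?g w)) ` arcs ?B"
        proof
          fix p assume p: "p \<in> arcs \<beta>"
          then obtain s t where st: "p = (s, t)" "s \<in> \<beta>" "t \<in> \<beta>" "quad_char (t - s) = 1" by (auto simp: arcs_def)
          have "s \<in> ?g ` ?B" "t \<in> ?g ` ?B" using st im by auto
          then obtain z w where z: "z \<in> ?B" "s = ?g z" and w: "w \<in> ?B" "t = ?g w" by blast
          have "(z, w) \<in> arcs ?B" using z w st(4) qc[of w z] by (simp add: arcs_def)
          then show "p \<in> (\<lambda>(z, w). (?g z, ?g w)) ` arcs ?B" using st z w by (intro image_eqI[of _ _ "(z, w)"]) auto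
        qed
      qed
    qed
    then have "card (arcs ?B) = card (arcs \<beta>)" by (rule bij_betw_same_card)
    then show ?thesis using few by linarith
  qed
  define pairs :: "'a set \<Rightarrow> ('a \<times> 'a) set" where "pairs \<beta> = \<beta> \<times> \<beta> - Id" for \<beta>
  have card_pairs: "card (pairs \<beta>) = ?k * (?k - 1)" if \<beta>: "\<beta> \<in> BB" for \<beta>
  proof -
    obtain x y where "x \<noteq> y" "\<beta> = blk x y" using \<beta> by (auto simp: BB_def)
    then have kb: "card \<beta> = ?k" using card_blk[of x y] by simp
    have "pairs \<beta> = \<beta> \<times> \<beta> - (\<lambda>x. (x, x)) ` \<beta>" by (auto simp: pairs_def)
    moreover have "card ((\<lambda>x. (x, x)) ` \<beta>) = card \<beta>" by (rule card_image) (auto simp: inj_on_def)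
    moreover have "(\<lambda>x. (x, x)) ` \<beta> \<subseteq> \<beta> \<times> \<beta>" by auto
    ultimately have "card (pairs \<beta>) = card \<beta> * card \<beta> - card \<beta>"
      by (simp add: card_Diff_subset card_cartesian_product)
    then show ?thesis using kb by (simp add: diff_mult_distrib2)
  qed
  have disj: "pairs \<beta> \<inter> pairs \<beta>' = {}" if "\<beta> \<in> BB" "\<beta>' \<in> BB" "\<beta> \<noteq> \<beta>'" for \<beta> \<beta>'
  proof (rule ccontr)
    assume "pairs \<beta> \<inter> pairs \<beta>' \<noteq> {}"
    then obtain x y where xy: "x \<noteq> y" "x \<in> \<beta>" "y \<in> \<beta>" "x \<in> \<beta>'" "y \<in> \<beta>'" by (auto simp: pairs_def)
    have "\<beta> = blk x y" "\<beta>' = blk x y" using that(1,2) blk_eq[OF _ xy(1)] xy by (auto simp: BB_def)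
    then show False using that(3) by simp
  qed
  have "blk 0 1 \<in> BB" unfolding BB_def using zero_neq_one[where 'a='a] by blast
  then have ne: "BB \<noteq> {}" by blast
  have Q: "card {(x, y). quad_char (y - x :: 'a) = 1} = CARD('a) * half"
  proof -
    have "card {(x, y). quad_char (y - x :: 'a) = 1} = card ((UNIV :: 'a set) \<times> {s. quad_char (s::'a) = 1})"
      by (rule bij_betw_same_card[of "\<lambda>(x, y). (x, y - x)"], rule bij_betw_byWitness[where f'="\<lambda>(x, s). (x, x + s)"]) auto
    then show ?thesis by (simp add: card_cartesian_product card_squares)
  qed
  have "{(x, y). quad_char (y - x :: 'a) = 1} \<subseteq> (\<Union>\<beta>\<in>BB. arcs \<beta>)"
  proof safe
    fix x y :: 'a assume xy: "quad_char (y - x) = 1"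
    then have "x \<noteq> y" by auto
    then have "blk x y \<in> BB" by (auto simp: BB_def)
    moreover have "(x, y) \<in> arcs (blk x y)" using xy by (simp add: arcs_def blk_mem)
    ultimately show "(x, y) \<in> (\<Union>\<beta>\<in>BB. arcs \<beta>)" by blast
  qed
  then have "card {(x, y). quad_char (y - x :: 'a) = 1} \<le> card (\<Union>\<beta>\<in>BB. arcs \<beta>)" by (intro card_mono) auto
  also have "\<dots> \<le> (\<Sum>\<beta>\<in>BB. card (arcs \<beta>))" by (rule card_UN_le) simp
  finally have "2 * (CARD('a) * half) \<le> (\<Sum>\<beta>\<in>BB. 2 * card (arcs \<beta>))" by (simp add: Q sum_distrib_left[symmetric])
  also have "\<dots> < (\<Sum>\<beta>\<in>BB. ?k * (?k - 1))" by (rule sum_strict_mono) (use ne arcs_few in auto)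
  also have "\<dots> = (\<Sum>\<beta>\<in>BB. card (pairs \<beta>))" by (rule sum.cong) (auto simp: card_pairs)
  also have "\<dots> = card (\<Union>\<beta>\<in>BB. pairs \<beta>)" by (rule card_UN_disjoint[symmetric]) (use disj in auto)
  also have "\<dots> \<le> card ((UNIV :: ('a \<times> 'a) set) - (\<lambda>x. (x, x)) ` UNIV)" by (rule card_mono) (auto simp: pairs_def)
  also have "\<dots> = CARD('a) * CARD('a) - CARD('a)"
  proof -
    have "card ((\<lambda>x::'a. (x, x)) ` UNIV) = CARD('a)" by (rule card_image) (auto simp: inj_on_def)
    then show ?thesis by (simp add: card_Diff_subset card_prod)
  qed
  also have "\<dots> = 2 * (CARD('a) * half)" by (simp add: card_half algebra_simps)
  finally show False by simp
qed

end

end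

section \<open>Proper subfield or Netto triple system\<close>

context quad_quasigroup
begin

text \<open>The two parameters are the roots of X^2 - X + 1, with sum and product 1; for a \<noteq>
  b they are the primitive sixth roots of unity. That -1 is a nonsquare means q = 3 modulo
  4.\<close>

definition netto :: bool where
  "netto \<longleftrightarrow> quad_char (- 1 :: 'a) = - 1 \<and> quad_char a = - 1 \<and> a * a = a - 1 \<and> b = 1 - a"

text \<open>The two properties of automorphisms fixing 0 from which \<open>flips_differences\<close>
  obtains a constant sign on differences.\<close>

definition rigid :: bool where
  "rigid \<longleftrightarrow> (\<forall>f\<in>G. f 0 = 0 \<longrightarrow> (\<forall>x y. f (x + y) = f x + f y) \<and>
      (\<exists>e. (e = 1 \<or> e = - 1) \<and> (\<forall>x. quad_char (f x) = e * quad_char x)))"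

lemma lines_rigid:
  assumes ab: "a \<noteq> b" and E: "is_subfield E" "E \<noteq> UNIV" "a \<in> E"
    and lines: "\<And>f x y c. f \<in> G \<Longrightarrow> f 0 = 0 \<Longrightarrow> c \<in> E \<Longrightarrow> \<exists>d\<in>E. f (x + c * (y - x)) = f x + d * (f y - f x)"
  shows rigid
  unfolding rigid_def
proof (intro ballI impI)
  fix f assume f: "f \<in> G" "f 0 = 0"
  have inj: "inj f" using G_bij[OF f(1)] by (rule bij_is_inj)
  have ln: "\<exists>d\<in>E. f (x + c * (y - x)) = f x + d * (f y - f x)" if "c \<in> E" for x y c
    using lines[OF f that] .
  have add: "f (x + y) = f x + f y" for x y
    by (rule lines_into_lines_additive(1)[OF E(1,2) inj f(2)]) (rule ln)
  have "\<exists>\<beta>. \<forall>x. f (a * x) = \<beta> * f x"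
    by (rule lines_into_lines_additive(2)[OF E(1,2) inj f(2) _ E(3)]) (rule ln)
  then obtain \<beta> where "f (a * x) = \<beta> * f x" for x by blast
  then have "\<exists>e. (e = 1 \<or> e = - 1) \<and> (\<forall>x. quad_char (f x) = e * quad_char x)"
    by (intro scaling_preserves_or_flips[OF f ab])
  then show "(\<forall>x y. f (x + y) = f x + f y) \<and>
      (\<exists>e. (e = 1 \<or> e = - 1) \<and> (\<forall>x. quad_char (f x) = e * quad_char x))" using add by blast
qed

text \<open>The map of each arc permutes {0, 1, a}. An odd number of arcs makes -1 a nonsquare. An
  arc from 0 to a would then force a = - 1, and one from a to 1 would force a = 2, both absurd. So
  the triangle is oriented cyclically, and the products 1 \<star> a = 0 and 1 \<star> 0 = a
  determine a * a and b.\<close>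

lemma three_element_block:
  assumes swap: swapping and three: "card (blk 0 1) = 3" "card (arcs (blk 0 1)) = 3"
  shows netto
proof -
  have "0 \<star> 1 \<in> blk 0 1" by (rule blk_op) (auto simp: blk_mem)
  then have aB: "a \<in> blk 0 1" by (simp add: zero_op lam_square)
  have "{0, 1, a} \<subseteq> blk 0 1" using blk_mem aB by auto
  moreover have "card {0, 1, a} = 3" using ab_nonzero by auto
  ultimately have B: "blk 0 1 = {0, 1, a}" using three(1) by (metis card_subset_eq finite)
  have closed: "x + (y - x) * z \<in> {0, 1, a}"
    if "x \<in> {0, 1, a}" "y \<in> {0, 1, a}" "quad_char (y - x) = 1" "z \<in> {0, 1, a}" for x y z
  proof -
    have ne: "x \<noteq> y" using that(3) by auto
    have "blk x y = blk 0 1" by (rule blk_eq[OF swap _ ne]) (use that B in auto)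
    moreover have "(\<lambda>z. (y - x) * z + x) ` blk 0 1 = blk x y"
      using blk_image[OF affine_in_G[OF that(3), of x], of 0 1] by simp
    ultimately have "(\<lambda>z. (y - x) * z + x) ` {0, 1, a} = {0, 1, a}" using B by simp
    then have "(y - x) * z + x \<in> {0, 1, a}" using that(4) by blast
    then show ?thesis by (simp only: add.commute)
  qed
  have m1: "quad_char (- 1 :: 'a) = - 1"
  proof (rule ccontr)
    assume "quad_char (- 1 :: 'a) \<noteq> - 1"
    then have "quad_char (- 1 :: 'a) = 1" using quad_char_minus_one by blast
    then have sym: "quad_char (x - y) = quad_char (y - x)" for x y :: 'a
      using quad_char_minus[of "y - x"] by (simp only: minus_diff_eq mult_1)
    have sw: "(y, x) \<in> arcs C" if "(x, y) \<in> arcs C" for x y C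
      using that by (simp add: arcs_def sym[of x y])
    define A where "A = arcs (blk 0 1) \<inter> {(0, 1), (0, a), (1, a)}"
    define A' where "A' = arcs (blk 0 1) \<inter> {(1, 0), (a, 0), (a, 1)}"
    have "arcs (blk 0 1) = A \<union> A'" unfolding A_def A'_def B by (auto simp: arcs_def)
    moreover have "{(0::'a, 1::'a), (0, a), (1, a)} \<inter> {(1, 0), (a, 0), (a, 1)} = {}"
      using ab_nonzero by simp
    then have "A \<inter> A' = {}" unfolding A_def A'_def by blast
    ultimately have "card (arcs (blk 0 1)) = card A + card A'" by (simp add: card_Un_disjoint)
    moreover have "card A' = card A"
      by (rule bij_betw_same_card[of prod.swap], rule bij_betw_byWitness[where f'=prod.swap])
        (auto simp: A_def A'_def intro: sw)
    ultimately show False using three(2) by presburger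
  qed
  have neg: "quad_char (x - y) = - quad_char (y - x)" for x y :: 'a
    using quad_char_minus[of "y - x"] unfolding minus_diff_eq m1 by (simp only: mult_minus1)
  have qa: "quad_char a = - 1"
  proof (rule ccontr)
    assume "quad_char a \<noteq> - 1"
    then have q: "quad_char a = 1" using quad_char_values[of a] ab_nonzero by auto
    then have "a * a \<in> {0, 1, a}" using closed[of 0 a a] by simp
    then have "a * a = 1" using ab_nonzero by auto
    then have "a = - 1" using ab_nonzero by (simp add: square_eq_1_iff)
    then show False using q m1 by simp
  qed
  have qa1: "quad_char (a - 1) = 1"
  proof (rule ccontr)
    assume "quad_char (a - 1) \<noteq> 1"
    then have q: "quad_char (1 - a) = 1" using quad_char_values[of "a - 1"] ab_nonzero neg[of 1 a] by auto
    then have m: "a + (1 - a) * a \<in> {0, 1, a}" using closed[of a 1 a] by simp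
    have "a + (1 - a) * a \<noteq> a" using ab_nonzero by simp
    moreover have "a + (1 - a) * a \<noteq> 1"
    proof
      assume "a + (1 - a) * a = 1"
      then have "(1 - a) * (1 - a) = 0" by (simp add: algebra_simps)
      then show False using ab_nonzero by simp
    qed
    ultimately have "a + (1 - a) * a = 0" using m by blast
    then have "a * (2 - a) = 0" by (simp add: algebra_simps)
    then have "a = 2" using ab_nonzero by simp
    then show False using q m1 by simp
  qed
  have "1 \<star> a \<in> {0, 1, a}" "1 \<star> 0 \<in> {0, 1, a}" using blk_op[of _ 0 1] B by auto
  moreover have "1 \<star> a \<noteq> 1" "1 \<star> a \<noteq> a" "1 \<star> 0 \<noteq> 1" "1 \<star> 0 \<noteq> 0"
    using op_eq_left op_eq_right ab_nonzero zero_neq_one by metis+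
  ultimately have "1 \<star> a = 0" "1 \<star> 0 = a" by auto
  moreover have "1 \<star> a = 1 + a * (a - 1)" using qa1 by (simp add: op_lam lam_square)
  moreover have "1 \<star> 0 = 1 - b" using m1 by (simp add: op_lam lam_nonsquare)
  ultimately have "a * a = a - 1" "b = 1 - a" by (simp_all add: algebra_simps)
  then show ?thesis unfolding netto_def using m1 qa by blast
qed

text \<open>If E = \<open>blk 0 1\<close> is a proper subfield, every block must be shown to be a
  line x + (y - x) E. Only pairs with nonsquare difference are in doubt, as no affine automorphism
  carries (0, 1) to them. If E contains a nonsquare, the block is rescaled from E by a
  square.\<close>

theorem two_transitive_cases:
  assumes swap: swapping and ab: "a \<noteq> b"
  shows "rigid \<or> netto"
proof (cases "blk 0 1 = UNIV")
  case True
  then show ?thesis unfolding rigid_def using full_block_additive[OF swap] full_block_flips[OF swap] by blast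
next
  case False
  let ?B = "blk 0 1"
  have ne01: "(0::'a) \<noteq> 1" by simp
  have "0 \<star> 1 \<in> ?B" by (rule blk_op) (auto simp: blk_mem)
  then have aB: "a \<in> ?B" by (simp add: zero_op lam_square)
  have "{0, 1, a} \<subseteq> ?B" using blk_mem aB by auto
  moreover have "card {0, 1, a} = 3" using ab_nonzero by auto
  ultimately have k3: "card ?B \<ge> 3" using card_mono[of ?B "{0, 1, a}"] by simp
  have blk01: "blk x y = ?B" if "x \<in> ?B" "y \<in> ?B" "x \<noteq> y" for x y
    by (rule blk_eq[OF swap ne01 that(3,1,2)])
  have sq_blk: "blk x y = (\<lambda>z. x + (y - x) * z) ` ?B" if "quad_char (y - x) = 1" for x y
    using blk_image[OF affine_in_G[OF that, of x], of 0 1] by (simp add: add.commute)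
  have "is_subfield ?B \<or> card ?B = 3 \<and> card (arcs ?B) = 3"
  proof (rule arc_closed_set)
    fix x y z assume xyz: "x \<in> ?B" "y \<in> ?B" "quad_char (y - x) = 1" "z \<in> ?B"
    then have "x \<noteq> y" by auto
    then have "blk x y = ?B" using blk01 xyz by blast
    then show "x + (y - x) * z \<in> ?B" using sq_blk[OF xyz(3)] xyz(4) by auto
  qed (use blk_mem k3 many_arcs[OF swap] in auto)
  then show ?thesis
  proof
    assume "card ?B = 3 \<and> card (arcs ?B) = 3"
    then show ?thesis using three_element_block[OF swap] by blast
  next
    assume E: "is_subfield ?B"
    note Ed = is_subfieldD[OF E] is_subfield_inverse[OF E]
    have zblk: "blk 0 z = (\<lambda>e. z * e) ` ?B" if z: "z \<noteq> 0" for z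
    proof (cases "quad_char z = 1")
      case True
      then show ?thesis using sq_blk[of z 0] by simp
    next
      case False
      then have zn: "quad_char z = - 1" using quad_char_values[of z] z by auto
      show ?thesis
      proof (cases "\<exists>x\<in>?B. quad_char x = - 1")
        case True
        then obtain x where x: "x \<in> ?B" "quad_char x = - 1" by blast
        then have x0: "x \<noteq> 0" by auto
        have "quad_char (z / x) = 1" using x zn by (simp add: quad_char_divide)
        from blk_scale[OF this, of 0 x] have "blk 0 z = (\<lambda>e. z / x * e) ` blk 0 x" using x0 by simp
        also have "blk 0 x = ?B" by (rule blk01) (use x x0 blk_mem in auto)
        also have "(\<lambda>e. z / x * e) ` ?B = (\<lambda>e. z * e) ` ?B"
        proof
          show "(\<lambda>e. z / x * e) ` ?B \<subseteq> (\<lambda>e. z * e) ` ?B"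
          proof
            fix w assume "w \<in> (\<lambda>e. z / x * e) ` ?B"
            then obtain e where e: "e \<in> ?B" "w = z / x * e" by blast
            then have "w = z * (inverse x * e)" by (simp add: divide_inverse)
            then show "w \<in> (\<lambda>e. z * e) ` ?B" using Ed(5)[OF Ed(7)[OF x(1)] e(1)] by blast
          qed
          show "(\<lambda>e. z * e) ` ?B \<subseteq> (\<lambda>e. z / x * e) ` ?B"
          proof
            fix w assume "w \<in> (\<lambda>e. z * e) ` ?B"
            then obtain e where e: "e \<in> ?B" "w = z * e" by blast
            then have "w = z / x * (x * e)" using x0 by simp
            then show "w \<in> (\<lambda>e. z / x * e) ` ?B" using Ed(5)[OF x(1) e(1)] by blast
          qed
        qed
        finally show ?thesis .
      next
        case nosq: False
        \<comment> \<open>The block on 0 and z divided by z. All its pairs turn out to be arcs, so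
          \<open>arc_closed_set\<close> makes it a subfield of the same order as E, and therefore E
          itself.\<close>
        define C where "C = {w. z * w \<in> blk 0 z}"
        have img: "(\<lambda>w. z * w) ` C = blk 0 z"
        proof
          show "blk 0 z \<subseteq> (\<lambda>w. z * w) ` C"
          proof
            fix w assume w: "w \<in> blk 0 z"
            then show "w \<in> (\<lambda>w. z * w) ` C" using z by (intro image_eqI[of _ _ "w / z"]) (auto simp: C_def)
          qed
        qed (auto simp: C_def)
        have "card C = card (blk 0 z)"
          unfolding img[symmetric] by (rule card_image[symmetric]) (use z in \<open>auto simp: inj_on_def\<close>)
        then have cardC: "card C = card ?B" using card_blk[OF swap, of 0 z] z by simp
        \<comment> \<open>If y - x were a nonsquare, z (y - x) would be a square and the block an
          affine image of E. Since the block contains 0 and z, this makes y - x the inverse of an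
          element of E, which has no nonsquares in this case.\<close>
        have arcC: "quad_char (y - x) = 1" if xy: "x \<in> C" "y \<in> C" "x \<noteq> y" for x y
        proof (rule ccontr)
          assume "quad_char (y - x) \<noteq> 1"
          then have n: "quad_char (y - x) = - 1" using quad_char_values[of "y - x"] xy(3) by auto
          then have sq: "quad_char (z * y - z * x) = 1" using zn by (simp add: quad_char_mult flip: right_diff_distrib)
          have "blk (z * x) (z * y) = blk 0 z"
            by (rule blk_eq[OF swap]) (use xy z in \<open>auto simp: C_def\<close>)
          then have b: "blk 0 z = (\<lambda>e. z * x + (z * y - z * x) * e) ` ?B" using sq_blk[OF sq] by simp
          have "0 \<in> blk 0 z" "z \<in> blk 0 z" by (auto simp: blk_mem)
          then obtain e0 e1 where e: "e0 \<in> ?B" "0 = z * x + (z * y - z * x) * e0"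
            "e1 \<in> ?B" "z = z * x + (z * y - z * x) * e1" unfolding b by blast
          have "z * ((y - x) * (e1 - e0)) = (z * x + (z * y - z * x) * e1) - (z * x + (z * y - z * x) * e0)"
            by (simp add: algebra_simps)
          also have "\<dots> = z" using e(2,4) by simp
          finally have "(y - x) * (e1 - e0) = 1" using z by simp
          then have "y - x = inverse (e1 - e0)" by (metis inverse_unique mult.commute)
          then have "y - x \<in> ?B" using Ed(7)[OF Ed(4)[OF e(3,1)]] by simp
          then show False using n nosq by blast
        qed
        have "is_subfield C \<or> card C = 3 \<and> card (arcs C) = 3"
        proof (rule arc_closed_set)
          show "0 \<in> C" "1 \<in> C" by (auto simp: C_def blk_mem)
          fix x y w assume xyw: "x \<in> C" "y \<in> C" "quad_char (y - x) = 1" "w \<in> C"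
          have "(\<lambda>v. (y - x) * v + z * x) ` blk 0 z = blk (z * x) ((y - x) * z + z * x)"
            using blk_image[OF affine_in_G[OF xyw(3), of "z * x"], of 0 z] by simp
          also have "(y - x) * z + z * x = z * y" by (simp add: algebra_simps)
          also have "blk (z * x) (z * y) = blk 0 z"
            by (rule blk_eq[OF swap]) (use xyw z in \<open>auto simp: C_def\<close>)
          finally have "(y - x) * (z * w) + z * x \<in> blk 0 z" using xyw(4) by (auto simp: C_def)
          moreover have "(y - x) * (z * w) + z * x = z * (x + (y - x) * w)" by (simp add: algebra_simps)
          ultimately show "x + (y - x) * w \<in> C" by (simp add: C_def)
        next
          have "arcs C = C \<times> C - (\<lambda>x. (x, x)) ` C" using arcC by (auto simp: arcs_def)
          moreover have "card ((\<lambda>x. (x, x)) ` C) = card C" by (rule card_image) (auto simp: inj_on_def)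
          moreover have "(\<lambda>x. (x, x)) ` C \<subseteq> C \<times> C" by auto
          ultimately have "card (arcs C) = card C * card C - card C"
            by (simp add: card_Diff_subset card_cartesian_product)
          then show "card C * (card C - 1) \<le> 2 * card (arcs C)" by (simp add: diff_mult_distrib2)
        qed (use cardC k3 in simp)
        moreover have "\<not> (card C = 3 \<and> card (arcs C) = 3)"
        proof
          assume A: "card C = 3 \<and> card (arcs C) = 3"
          have "arcs C = C \<times> C - (\<lambda>x. (x, x)) ` C" using arcC by (auto simp: arcs_def)
          moreover have "card ((\<lambda>x. (x, x)) ` C) = card C" by (rule card_image) (auto simp: inj_on_def)
          moreover have "(\<lambda>x. (x, x)) ` C \<subseteq> C \<times> C" by auto
          ultimately have "card (arcs C) = card C * card C - card C"
            by (simp add: card_Diff_subset card_cartesian_product)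
          then show False using A by simp
        qed
        ultimately have "is_subfield C" by blast
        then have "C = ?B" using is_subfield_eqI_card[OF _ E cardC] by blast
        then show ?thesis using img by simp
      qed
    qed
    have line: "blk x y = (\<lambda>e. x + (y - x) * e) ` ?B" if "x \<noteq> y" for x y
    proof -
      have "blk x y = (\<lambda>z. z + x) ` blk 0 (y - x)" using blk_translate[of 0 x "y - x"] by simp
      also have "\<dots> = (\<lambda>z. z + x) ` (\<lambda>e. (y - x) * e) ` ?B" using zblk[of "y - x"] that by simp
      finally show ?thesis by (simp add: image_image add.commute)
    qed
    have rigid
    proof (rule lines_rigid[OF ab E False aB])
      fix f x y c assume f: "f \<in> G" "f 0 = 0" and c: "c \<in> ?B"
      show "\<exists>d\<in>?B. f (x + c * (y - x)) = f x + d * (f y - f x)"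
      proof (cases "x = y")
        case True
        then show ?thesis using Ed(2) by auto
      next
        case ne: False
        then have fne: "f x \<noteq> f y" using G_inj[OF f(1)] by simp
        have "x + c * (y - x) \<in> blk x y" using line[OF ne] c by (auto simp: mult.commute)
        then have "f (x + c * (y - x)) \<in> blk (f x) (f y)" using blk_image[OF f(1), of x y] by blast
        then obtain d where "d \<in> ?B" "f (x + c * (y - x)) = f x + (f y - f x) * d" unfolding line[OF fne] by blast
        then show ?thesis by (auto simp: mult.commute)
      qed
    qed
    then show ?thesis by blast
  qed
qed

end

section \<open>Netto triple systems\<close>

locale netto_quasigroup = quad_quasigroup F a b for F :: "'a::{field,finite} itself" and a b :: 'a +
  assumes netto: netto and ab: "a \<noteq> b"
begin

lemma minus_one: "quad_char (- 1 :: 'a) = - 1"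
  using netto unfolding netto_def by blast

lemma b_eq: "b = 1 - a" and a_sq: "a * a = a - 1"
  using netto unfolding netto_def by blast+

lemma one_minus: "1 - a = b" "1 - b = a"
  using netto unfolding netto_def by auto

lemma b_sq: "b * b = b - 1"
proof -
  have "b * b = 1 - 2 * a + a * a" unfolding b_eq by (simp add: algebra_simps)
  also have "\<dots> = b - 1" unfolding a_sq b_eq by (simp add: algebra_simps)
  finally show ?thesis .
qed

lemma lam_sq: "lam d * lam d = lam d - 1"
  using a_sq b_sq by (simp add: lam_def)

text \<open>The conjugate root 1 - \<open>lam d\<close> is also the inverse of
  \<open>lam d\<close>.\<close>

lemma lam_lam: "lam d * (1 - lam d) = 1"
  using lam_sq[of d] by (simp add: algebra_simps)

lemma lam_bar_sq: "(1 - lam d) * (1 - lam d) = - lam d"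
  using lam_sq[of d] by (simp add: algebra_simps)

lemma lam_nz: "lam d \<noteq> 0" "1 - lam d \<noteq> 0" "lam d \<noteq> 1"
  using lam_lam[of d] by auto

lemma lam_flip: "d \<noteq> 0 \<Longrightarrow> quad_char e = - quad_char d \<Longrightarrow> lam e = 1 - lam d"
  using quad_char_values[of d] by (auto simp: lam_def one_minus)

lemma chi_lam: "quad_char (lam d) = - 1" "quad_char (1 - lam d) = - 1"
proof -
  have a: "quad_char a = - 1" using netto unfolding netto_def by blast
  moreover have "quad_char b = - 1" using params a unfolding quad_params_def by metis
  ultimately show "quad_char (lam d) = - 1" "quad_char (1 - lam d) = - 1"
    by (auto simp: lam_def one_minus)
qed

lemma lam_neg: "d \<noteq> 0 \<Longrightarrow> lam (- d) = 1 - lam d"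
  by (rule lam_flip) (auto simp: quad_char_minus[of d] minus_one)

lemma lam_times: "quad_char l = 1 \<Longrightarrow> lam (l * d) = lam d"
  and lam_times_flip: "d \<noteq> 0 \<Longrightarrow> quad_char l = - 1 \<Longrightarrow> lam (l * d) = 1 - lam d"
  by (auto intro: lam_cong lam_flip simp: quad_char_mult)

lemma two_lam: "1 - 2 * lam d \<noteq> 0"
proof
  assume "1 - 2 * lam d = 0"
  then have "lam d = 1 - lam d" by (simp add: algebra_simps)
  then show False using ab one_minus by (metis lam_def)
qed

text \<open>The discriminant of X^2 - X + 1 is - 3, so in characteristic 3 the two roots a and b
  would coincide.\<close>

lemma three_nz: "(3::'a) \<noteq> 0"
proof
  assume 3: "(3::'a) = 0"
  have "(1 - 2 * a) * (1 - 2 * a) = 1 - 4 * a + 4 * (a * a)" by (simp add: algebra_simps)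
  also have "\<dots> = - 3" unfolding a_sq by (simp add: algebra_simps)
  finally have "1 - 2 * a = 0" using 3 by simp
  then show False using two_lam[of 1] by (simp add: lam_def)
qed

text \<open>Reversing a difference changes its class, since -1 is a nonsquare, and replaces the
  coefficient by its conjugate. Together with \<open>op_idem\<close> and \<open>op_invol\<close>
  this gives a Steiner quasigroup: x \<star> y is the third point of the triple on x and y.\<close>

lemma op_comm: "x \<star> y = y \<star> x"
proof (cases "x = y")
  case False
  have e: "lam (x - y) = 1 - lam (y - x)" using lam_neg[of "y - x"] False by simp
  show ?thesis unfolding op_lam e by (simp add: algebra_simps)
qed simp

lemma op_invol: "x \<star> (x \<star> y) = y"
proof (cases "x = y")
  case False
  let ?l = "lam (y - x)"
  have "x \<star> (x \<star> y) = x + lam (?l * (y - x)) * (?l * (y - x))" by (simp add: op_lam)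
  also have "lam (?l * (y - x)) = 1 - ?l" by (rule lam_times_flip) (use False chi_lam in auto)
  also have "x + (1 - ?l) * (?l * (y - x)) = x + (?l * (1 - ?l)) * (y - x)" by (simp add: algebra_simps)
  finally show ?thesis unfolding lam_lam by simp
qed simp

lemma zero_op_same: "quad_char y = quad_char x \<Longrightarrow> 0 \<star> y = lam x * y"
  unfolding zero_op using lam_cong[of y x] by simp

lemma zero_op_flip: "x \<noteq> 0 \<Longrightarrow> quad_char y = - quad_char x \<Longrightarrow> 0 \<star> y = (1 - lam x) * y"
  unfolding zero_op using lam_flip[of x y] by simp

text \<open>A nonsquare factor changes the class of a difference, so multiplication by
  \<open>lam d\<close> carries the operation to the one with conjugate coefficient.\<close>

lemma op_scaled: "x \<noteq> y \<Longrightarrow> (lam d * x) \<star> (lam d * y) = lam d * (x + (1 - lam (y - x)) * (y - x))"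
proof -
  assume "x \<noteq> y"
  then have e: "lam (lam d * (y - x)) = 1 - lam (y - x)" using chi_lam by (intro lam_times_flip) auto
  show ?thesis unfolding op_lam right_diff_distrib[symmetric] e by (simp add: algebra_simps)
qed

lemma lam_cases: obtains "lam e = lam d" | "lam e = 1 - lam d"
  using one_minus by (metis lam_def)

text \<open>Equality would say that z \<mapsto> 0 \<star> z carries the triple of x and y to a
  triple, a mitre with centre 0. On x and y this map is multiplication by one and the same
  nonsquare, so both sides are explicit; each combination of classes leads to 1 - 2 \<lambda> = 0 or
  to x = 0 or y = 0.\<close>

lemma no_mitre_0:
  assumes "x \<noteq> 0" "y \<noteq> 0" "x \<noteq> y" "quad_char x = quad_char y"
  shows "(0 \<star> x) \<star> (0 \<star> y) \<noteq> 0 \<star> (x \<star> y)"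
proof
  let ?l = "lam x" and ?m = "lam (y - x)"
  assume eq: "(0 \<star> x) \<star> (0 \<star> y) = 0 \<star> (x \<star> y)"
  have z0: "x \<star> y \<noteq> 0"
  proof
    assume "x \<star> y = 0"
    then have "(0 \<star> x) \<star> (0 \<star> y) = 0" using eq by simp
    moreover have "0 \<star> x = y" using op_invol[of x y] op_comm[of x 0] \<open>x \<star> y = 0\<close> by simp
    moreover have "quad_char (0 \<star> x) = - quad_char x" by (simp add: zero_op quad_char_mult chi_lam)
    ultimately show False using assms quad_char_values[of x] by auto
  qed
  have lhs: "(0 \<star> x) \<star> (0 \<star> y) = ?l * (x + (1 - ?m) * (y - x))"
    using op_scaled[OF assms(3), of x] zero_op_same[of x x] zero_op_same[of y x] assms by simp
  have z: "x \<star> y = x + ?m * (y - x)" by (simp add: op_lam)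
  consider "quad_char (x \<star> y) = quad_char x" | "quad_char (x \<star> y) = - quad_char x"
    using quad_char_values[of x] quad_char_values[of "x \<star> y"] z0 assms by auto
  then show False
  proof cases
    case 1
    then have "?l * (x + (1 - ?m) * (y - x)) = ?l * (x + ?m * (y - x))"
      using eq lhs z zero_op_same[OF 1] by simp
    then have "(1 - ?m) * (y - x) = ?m * (y - x)" using lam_nz by simp
    then have "1 - ?m = ?m" using assms by simp
    then have "1 - 2 * ?m = 0" by (simp add: algebra_simps)
    then show False using two_lam by blast
  next
    case 2
    then have e: "?l * (x + (1 - ?m) * (y - x)) = (1 - ?l) * (x + ?m * (y - x))"
      using eq lhs z zero_op_flip[OF assms(1) 2] by simp
    show False
    proof (cases rule: lam_cases[of "y - x" x])
      case 1
      then have "(1 - 2 * ?l) * x = 0" using e by (simp add: algebra_simps)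
      then show False using two_lam assms by simp
    next
      case 2
      have "(1 - 2 * ?l) * x = (?l * ?l - (1 - ?l) * (1 - ?l)) * (y - x)"
        using e unfolding 2 by (simp add: algebra_simps)
      also have "\<dots> = - (1 - 2 * ?l) * (y - x)" unfolding lam_sq lam_bar_sq by (simp add: algebra_simps)
      finally have "(1 - 2 * ?l) * y = 0" by (simp add: algebra_simps)
      then show False using two_lam assms by simp
    qed
  qed
qed

text \<open>After a translation the centre is 0. Of the three points of the triple two have the same
  character, and a mitre is symmetric in them, so \<open>no_mitre_0\<close> applies to these
  two.\<close>

lemma no_mitre:
  assumes "c \<noteq> x" "c \<noteq> y" "x \<noteq> y" "y \<noteq> c \<star> x"
  shows "(c \<star> x) \<star> (c \<star> y) \<noteq> c \<star> (x \<star> y)"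
proof -
  have tr: "(u + c) \<star> (v + c) = u \<star> v + c" for u v by (simp add: op_lam)
  define x' y' where "x' = x - c" and "y' = y - c"
  have xy: "x = x' + c" "y = y' + c" "c = 0 + c" by (simp_all add: x'_def y'_def)
  have as: "x' \<noteq> 0" "y' \<noteq> 0" "x' \<noteq> y'" using assms by (auto simp: x'_def y'_def)
  have y'n: "y' \<noteq> 0 \<star> x'" using assms(4) xy tr[of 0 x'] by auto
  have "(0 \<star> x') \<star> (0 \<star> y') \<noteq> 0 \<star> (x' \<star> y')"
  proof
    assume eq: "(0 \<star> x') \<star> (0 \<star> y') = 0 \<star> (x' \<star> y')"
    define z where "z = x' \<star> y'"
    have z0: "z \<noteq> 0"
    proof
      assume "z = 0"
      then have "y' = x' \<star> 0" using op_invol[of x' y'] by (simp add: z_def)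
      then show False using y'n op_comm by simp
    qed
    have zx: "z \<noteq> x'" "z \<noteq> y'" using as op_eq_left op_eq_right unfolding z_def by auto
    have xz: "x' \<star> z = y'" unfolding z_def by (rule op_invol)
    have yz: "y' \<star> z = x'" unfolding z_def using op_invol[of y' x'] op_comm[of x' y'] by simp
    consider "quad_char x' = quad_char y'" | "quad_char x' = quad_char z" | "quad_char y' = quad_char z"
      using quad_char_values[of x'] quad_char_values[of y'] quad_char_values[of z] as z0 by auto
    then show False
    proof cases
      case 1 then show False using no_mitre_0 as eq by blast
    next
      case 2
      have "(0 \<star> x') \<star> (0 \<star> z) = 0 \<star> (x' \<star> z)"
        using op_invol[of "0 \<star> x'" "0 \<star> y'"] eq xz by (simp add: z_def)
      then show False using no_mitre_0[OF as(1) z0 _ 2] zx by auto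
    next
      case 3
      have "(0 \<star> y') \<star> (0 \<star> z) = 0 \<star> (y' \<star> z)"
        using op_invol[of "0 \<star> y'" "0 \<star> x'"] eq yz op_comm[of "0 \<star> x'" "0 \<star> y'"] by (simp add: z_def)
      then show False using no_mitre_0[OF as(2) z0 _ 3] zx by auto
    qed
  qed
  then show ?thesis using tr[of 0 x'] tr[of 0 y'] tr[of "0 \<star> x'" "0 \<star> y'"] tr[of x' y'] tr[of 0 "x' \<star> y'"] xy by auto
qed

text \<open>Equality says that the triples {0, x, 0 \<star> x} and {0, y, 0 \<star> y} belong to a
  Pasch configuration. In the ratio r = y / x the equation is linear once the classes of the
  differences involved are fixed, so each combination of classes leaves at most one ratio. Whether
  that ratio really has the assumed classes depends on \<chi>(2).\<close>

lemma pasch_0: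
  assumes x: "x \<noteq> 0" and y: "y \<noteq> 0" "y \<noteq> x" "y \<noteq> 0 \<star> x"
  shows "x \<star> y = (0 \<star> x) \<star> (0 \<star> y) \<longleftrightarrow>
    quad_char (2::'a) = 1 \<and> y \<in> {2 * x, x / 2, - x, (1 - lam x) * x}"
proof -
  let ?l = "lam x"
  define r where "r = y / x"
  have yr: "y = r * x" using x by (simp add: r_def)
  have r: "r \<noteq> 0" "r \<noteq> 1" "r \<noteq> ?l" using y x by (auto simp: yr zero_op)
  have nl: "2 * ?l \<noteq> 0" using two_nonzero lam_nz by simp
  have ymem: "y \<in> {2 * x, x / 2, - x, (1 - ?l) * x} \<longleftrightarrow> r \<in> {2, 1 / 2, - 1, 1 - ?l}"
  proof -
    have "r * x = k * x \<longleftrightarrow> r = k" for k using x by simp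
    moreover have "x / 2 = (1 / 2) * x" "- x = (- 1) * x" by simp_all
    ultimately show ?thesis unfolding yr insert_iff empty_iff by metis
  qed
  have yx: "y - x = (r - 1) * x" by (simp add: yr algebra_simps)
  define m where "m = lam (y - x)"
  have lhs: "x \<star> y = (1 + m * (r - 1)) * x" unfolding op_lam yx m_def by (simp add: algebra_simps)
  consider "quad_char r = 1" | "quad_char r = - 1" using quad_char_values[of r] r by auto
  then show ?thesis
  proof cases
    case 1
    have qy: "quad_char y = quad_char x" using 1 by (simp add: yr quad_char_mult)
    have "(0 \<star> x) \<star> (0 \<star> y) = ?l * (x + (1 - m) * (y - x))"
      using op_scaled[of x y x] zero_op_same[of x x] zero_op_same[OF qy] y unfolding m_def by simp
    also have "\<dots> = (?l + ?l * (1 - m) * (r - 1)) * x" unfolding yx by (simp add: algebra_simps)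
    finally have "x \<star> y = (0 \<star> x) \<star> (0 \<star> y) \<longleftrightarrow> 1 + m * (r - 1) = ?l + ?l * (1 - m) * (r - 1)"
      using lhs x by simp
    also have "\<dots> \<longleftrightarrow> 1 - ?l = (?l * (1 - m) - m) * (r - 1)" by (auto simp: algebra_simps)
    also have "\<dots> \<longleftrightarrow> quad_char (2::'a) = 1 \<and> r \<in> {2, 1 / 2, - 1, 1 - ?l}"
    proof -
      have no: "r \<noteq> - 1" "r \<noteq> 1 - ?l" using 1 minus_one chi_lam by auto
      have q2: "quad_char (1 / 2 :: 'a) = quad_char (2::'a)" by (simp add: quad_char_divide)
      show ?thesis
      proof (cases rule: lam_cases[of "y - x" x])
        case l: 1
        then have m: "m = ?l" by (simp add: m_def)
        have "?l * (1 - m) - m = 1 - ?l" unfolding m lam_lam by simp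
        then have "1 - ?l = (?l * (1 - m) - m) * (r - 1) \<longleftrightarrow> r = 2" using lam_nz(2)[of x] by auto
        moreover have "r \<noteq> 1 / 2 \<or> quad_char (2::'a) \<noteq> 1"
        proof (rule ccontr)
          assume "\<not> ?thesis"
          then have "y - x = (- 1 / 2) * x" "quad_char (2::'a) = 1" using yx two_nonzero by (auto simp: field_simps)
          moreover have "quad_char (- 1 / 2 :: 'a) = - quad_char (2::'a)" by (simp only: quad_char_divide minus_one)
          ultimately have "lam (y - x) = 1 - ?l" using lam_times_flip[OF x, of "- 1 / 2"] by presburger
          then show False using l two_lam[of x] by (simp add: algebra_simps)
        qed
        ultimately show ?thesis using 1 no by auto
      next
        case l: 2
        then have m: "m = 1 - ?l" by (simp add: m_def)
        have co: "?l * (1 - m) - m = - 2 * (1 - ?l)" unfolding m using lam_sq[of x] by (simp add: algebra_simps)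
        have "1 - ?l = (?l * (1 - m) - m) * (r - 1) \<longleftrightarrow> (1 - ?l) * 1 = (1 - ?l) * (- 2 * (r - 1))"
          by (simp only: co mult_1_right mult.assoc mult.left_commute[of "- 2"])
        also have "\<dots> \<longleftrightarrow> 1 = - 2 * (r - 1)" using lam_nz(2)[of x] by simp
        also have "\<dots> \<longleftrightarrow> r = 1 / 2" using two_nonzero by (auto simp: field_simps)
        finally have "1 - ?l = (?l * (1 - m) - m) * (r - 1) \<longleftrightarrow> r = 1 / 2" .
        moreover have "r \<noteq> 2"
        proof
          assume "r = 2"
          then have "y - x = x" using yx by simp
          then show False using l two_lam[of x] by (simp add: algebra_simps)
        qed
        moreover have "r = 1 / 2 \<Longrightarrow> quad_char (2::'a) = 1" using 1 q2 by metis
        ultimately show ?thesis using no by blast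
      qed
    qed
    finally show ?thesis using ymem by simp
  next
    case 2
    have qy: "quad_char y = - quad_char x" using 2 by (simp add: yr quad_char_mult)
    define n where "n = lam ((1 - ?l) * y - ?l * x)"
    have d: "(1 - ?l) * y - ?l * x = ((1 - ?l) * r - ?l) * x" by (simp add: yr algebra_simps)
    have "(0 \<star> x) \<star> (0 \<star> y) = ?l * x + n * ((1 - ?l) * y - ?l * x)"
      unfolding zero_op_same[OF refl, of x] zero_op_flip[OF x qy] n_def by (rule op_lam)
    also have "\<dots> = (?l + n * ((1 - ?l) * r - ?l)) * x" unfolding d by (simp add: algebra_simps)
    finally have "x \<star> y = (0 \<star> x) \<star> (0 \<star> y) \<longleftrightarrow> 1 + m * (r - 1) = ?l + n * ((1 - ?l) * r - ?l)"
      using lhs x by simp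
    also have "\<dots> \<longleftrightarrow> (m - n * (1 - ?l)) * r = ?l - n * ?l - 1 + m" by (auto simp: algebra_simps)
    also have "\<dots> \<longleftrightarrow> quad_char (2::'a) = 1 \<and> r \<in> {2, 1 / 2, - 1, 1 - ?l}"
    proof -
      have "quad_char (1 / 2 :: 'a) = quad_char (2::'a)" by (simp add: quad_char_divide)
      then have no: "r \<noteq> 2 \<and> r \<noteq> 1 / 2" if "quad_char (2::'a) = 1"
        using 2 that by (metis one_neq_neg_one)
      \<comment> \<open>The coefficients m and n that the candidate r = - 1 produces, and in
        \<open>m_bar\<close> those for r = 1 - \<lambda>. A candidate counts only if they agree with
        the coefficients of the case at hand.\<close>
      have m_minus: "m = (if quad_char (2::'a) = 1 then 1 - ?l else ?l)" "n = 1 - ?l" if "r = - 1"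
      proof -
        have e1: "y - x = (- 2) * x" using yx that by simp
        have e2: "quad_char (- 2 :: 'a) = - quad_char (2::'a)" using quad_char_minus[of "2::'a"] minus_one by simp
        show "m = (if quad_char (2::'a) = 1 then 1 - ?l else ?l)"
        proof (cases "quad_char (2::'a) = 1")
          case True
          then have "lam ((- 2) * x) = 1 - ?l" by (intro lam_times_flip[OF x]) (simp only: e2)
          then show ?thesis unfolding m_def e1 using True by simp
        next
          case False
          then have "quad_char (2::'a) = - 1" using quad_char_values[of "2::'a"] two_nonzero by blast
          then have "lam ((- 2) * x) = ?l" by (intro lam_times) (simp only: e2)
          then show ?thesis unfolding m_def e1 using False by simp
        qed
        have "(1 - ?l) * y - ?l * x = - x" using d that by (simp add: algebra_simps)
        then show "n = 1 - ?l" unfolding n_def using lam_neg[OF x] by simp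
      qed
      have m_bar: "m = ?l" "n = (if quad_char (2::'a) = 1 then ?l else 1 - ?l)" if "r = 1 - ?l"
      proof -
        have ql: "quad_char (- ?l) = 1" using quad_char_minus[of ?l] minus_one chi_lam by simp
        have "y - x = (- ?l) * x" using yx that by simp
        then show "m = ?l" unfolding m_def using lam_times[OF ql, of x] by simp
        have "(1 - ?l) * y - ?l * x = ((1 - ?l) * (1 - ?l) - ?l) * x" using d that by simp
        also have "\<dots> = 2 * (- ?l * x)" unfolding lam_bar_sq by (simp add: algebra_simps)
        finally have e: "(1 - ?l) * y - ?l * x = 2 * (- ?l * x)" .
        have "- ?l * x \<noteq> 0" using lam_nz x by simp
        then show "n = (if quad_char (2::'a) = 1 then ?l else 1 - ?l)" unfolding n_def e
          using quad_char_values[of "2::'a"] two_nonzero lam_times[OF ql, of x] lam_times[of 2 "- ?l * x"] lam_times_flip[of "- ?l * x" 2] by auto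
      qed
      have rl: False if "r * c = ?l * c" "c \<noteq> 0" for c using that r by simp
      show ?thesis
      proof (cases rule: lam_cases[of "y - x" x]; cases rule: lam_cases[of "(1 - ?l) * y - ?l * x" x])
        assume A: "lam (y - x) = ?l" "lam ((1 - ?l) * y - ?l * x) = ?l"
        then have mn: "m = ?l" "n = ?l" by (simp_all add: m_def n_def)
        have "(m - n * (1 - ?l)) * r = ?l - n * ?l - 1 + m \<longleftrightarrow> (?l - 1) * r = ?l"
          unfolding mn lam_lam lam_sq by simp
        also have "\<dots> \<longleftrightarrow> (- 1) * (1 - ?l) * r = (- 1) * (1 - ?l) * (1 - ?l)"
          unfolding mult.assoc lam_bar_sq by (simp add: algebra_simps)
        also have "\<dots> \<longleftrightarrow> r = 1 - ?l" using lam_nz(2)[of x] by simp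
        finally have e: "(m - n * (1 - ?l)) * r = ?l - n * ?l - 1 + m \<longleftrightarrow> r = 1 - ?l" .
        have t: "?l \<noteq> 1 - ?l" using two_lam[of x] by (auto simp: algebra_simps)
        have "r \<noteq> - 1" using m_minus(2) mn t by auto
        moreover have "r = 1 - ?l \<Longrightarrow> quad_char (2::'a) = 1" using m_bar(2) mn t by (auto split: if_splits)
        ultimately show ?thesis using e no by auto
      next
        assume A: "lam (y - x) = ?l" "lam ((1 - ?l) * y - ?l * x) = 1 - ?l"
        then have mn: "m = ?l" "n = 1 - ?l" by (simp_all add: m_def n_def)
        have t: "?l \<noteq> 1 - ?l" using two_lam[of x] by (auto simp: algebra_simps)
        \<comment> \<open>For mixed coefficients, here and in the next case, the only root of the
          linear equation is r = \<lambda>, which the assumption y \<noteq> 0 \<star> x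
          excludes.\<close>
        have "(m - n * (1 - ?l)) * r \<noteq> ?l - n * ?l - 1 + m"
        proof
          assume eq: "(m - n * (1 - ?l)) * r = ?l - n * ?l - 1 + m"
          have "r * (2 * ?l) = (?l - (1 - ?l) * (1 - ?l)) * r" unfolding lam_bar_sq by simp
          also have "\<dots> = ?l - ?l * (1 - ?l) - 1 + ?l" using eq unfolding mn by (simp add: mult.commute)
          also have "\<dots> = 2 * (?l * ?l)" unfolding lam_lam lam_sq by (simp add: algebra_simps)
          also have "\<dots> = ?l * (2 * ?l)" by simp
          finally show False using rl nl by blast
        qed
        moreover have "\<not> (quad_char (2::'a) = 1 \<and> r \<in> {2, 1 / 2, - 1, 1 - ?l})"
          using no m_minus(1) m_bar(2) mn t by auto
        ultimately show ?thesis by blast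
      next
        assume A: "lam (y - x) = 1 - ?l" "lam ((1 - ?l) * y - ?l * x) = ?l"
        then have mn: "m = 1 - ?l" "n = ?l" by (simp_all add: m_def n_def)
        have t: "?l \<noteq> 1 - ?l" using two_lam[of x] by (auto simp: algebra_simps)
        have "(m - n * (1 - ?l)) * r \<noteq> ?l - n * ?l - 1 + m"
        proof
          assume eq: "(m - n * (1 - ?l)) * r = ?l - n * ?l - 1 + m"
          have "r * (- ?l) = (1 - ?l - ?l * (1 - ?l)) * r" unfolding lam_lam by simp
          also have "\<dots> = ?l - ?l * ?l - 1 + (1 - ?l)" using eq unfolding mn by simp
          also have "\<dots> = ?l * (- ?l)" by simp
          finally show False using rl lam_nz by fastforce
        qed
        moreover have "\<not> (quad_char (2::'a) = 1 \<and> r \<in> {2, 1 / 2, - 1, 1 - ?l})"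
          using no m_minus(2) m_bar(1) mn t by auto
        ultimately show ?thesis by blast
      next
        assume A: "lam (y - x) = 1 - ?l" "lam ((1 - ?l) * y - ?l * x) = 1 - ?l"
        then have mn: "m = 1 - ?l" "n = 1 - ?l" by (simp_all add: m_def n_def)
        have t: "?l \<noteq> 1 - ?l" using two_lam[of x] by (auto simp: algebra_simps)
        have c1: "m - n * (1 - ?l) = 1" unfolding mn lam_bar_sq by simp
        have c2: "?l - n * ?l - 1 + m = - 1" unfolding mn using lam_lam[of x] by (simp add: algebra_simps)
        have e: "(m - n * (1 - ?l)) * r = ?l - n * ?l - 1 + m \<longleftrightarrow> r = - 1" unfolding c1 c2 by simp
        have "r \<noteq> 1 - ?l" using m_bar(1) mn t by auto
        moreover have "r = - 1 \<Longrightarrow> quad_char (2::'a) = 1" using m_minus(1) mn t by (auto split: if_splits)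
        ultimately show ?thesis using e no by auto
      qed
    qed
    finally show ?thesis using ymem by simp
  qed
qed

end

section \<open>Finite permutation groups\<close>

definition perm_group :: "('a \<Rightarrow> 'a) set \<Rightarrow> bool" where
  "perm_group Q \<longleftrightarrow> id \<in> Q \<and> (\<forall>f\<in>Q. \<forall>g\<in>Q. f \<circ> g \<in> Q) \<and> (\<forall>f\<in>Q. bij f)"

definition perm_monoid :: "('a \<Rightarrow> 'a) set \<Rightarrow> ('a \<Rightarrow> 'a) monoid" where
  "perm_monoid Q = \<lparr>carrier = Q, monoid.mult = (\<circ>), one = id\<rparr>"

lemma perm_group_cancel:
  assumes "perm_group Q" "f \<in> Q" "f \<circ> g = f \<circ> h"
  shows "g = h"
proof
  fix x
  have "bij f" using assms by (auto simp: perm_group_def)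
  then show "g x = h x" using fun_cong[OF assms(3), of x] by (auto simp: bij_def inj_def)
qed

text \<open>On a finite set closure under composition suffices for a group: composing with f is
  injective on Q, hence onto, and so hits the identity.\<close>

lemma perm_group_inverse:
  fixes Q :: "('a::finite \<Rightarrow> 'a) set"
  assumes Q: "perm_group Q" and f: "f \<in> Q"
  obtains g where "g \<in> Q" "f \<circ> g = id" "g \<circ> f = id"
proof -
  have "(\<lambda>g. f \<circ> g) ` Q = Q"
    by (rule endo_inj_surj) (use Q f perm_group_cancel[OF Q f] in \<open>auto simp: perm_group_def inj_on_def\<close>)
  moreover have "id \<in> Q" using Q by (simp add: perm_group_def)
  ultimately have "id \<in> (\<lambda>g. f \<circ> g) ` Q" by simp
  then obtain g where g: "g \<in> Q" "f \<circ> g = id" by auto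
  have "f \<circ> (g \<circ> f) = f \<circ> id" using g(2) by (simp flip: o_assoc add: o_assoc)
  then have "g \<circ> f = id" by (rule perm_group_cancel[OF Q f])
  then show thesis using g that by blast
qed

lemma group_perm_monoid:
  fixes Q :: "('a::finite \<Rightarrow> 'a) set"
  assumes "perm_group Q"
  shows "group (perm_monoid Q)"
proof (rule groupI)
  fix x assume "x \<in> carrier (perm_monoid Q)"
  then have "x \<in> Q" by (simp add: perm_monoid_def)
  from perm_group_inverse[OF assms this] obtain g where "g \<in> Q" "g \<circ> x = id" by blast
  then show "\<exists>y\<in>carrier (perm_monoid Q). y \<otimes>\<^bsub>perm_monoid Q\<^esub> x = \<one>\<^bsub>perm_monoid Q\<^esub>"
    by (auto simp: perm_monoid_def)
qed (use assms in \<open>auto simp: perm_monoid_def perm_group_def comp_assoc\<close>)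

lemma perm_group_sylow:
  fixes Q :: "('a::finite \<Rightarrow> 'a) set"
  assumes Q: "perm_group Q" and c: "2 ^ k dvd card Q"
  obtains M where "M \<subseteq> Q" "perm_group M" "card M = 2 ^ k"
proof -
  obtain m where m: "card Q = 2 ^ k * m" using c by blast
  have "\<exists>H. subgroup H (perm_monoid Q) \<and> card H = 2 ^ k"
    by (rule sylow_thm[of 2 _ k m])
      (use group_perm_monoid[OF Q] m in \<open>auto simp: Coset.order_def perm_monoid_def\<close>)
  then obtain M where M: "subgroup M (perm_monoid Q)" "card M = 2 ^ k" by blast
  have sub: "M \<subseteq> Q" using subgroup.subset[OF M(1)] by (simp add: perm_monoid_def)
  moreover have "perm_group M" unfolding perm_group_def
    using subgroup.one_closed[OF M(1)] subgroup.m_closed[OF M(1)] sub Q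
    by (auto simp: perm_monoid_def perm_group_def)
  ultimately show thesis using that M(2) by blast
qed

lemma perm_group_lagrange:
  fixes Q M :: "('a::finite \<Rightarrow> 'a) set"
  assumes Q: "perm_group Q" and M: "perm_group M" "M \<subseteq> Q"
  shows "card M dvd card Q"
proof -
  interpret group "perm_monoid Q" by (rule group_perm_monoid[OF Q])
  have "subgroup M (perm_monoid Q)"
  proof (rule subgroupI)
    show "M \<subseteq> carrier (perm_monoid Q)" using M by (simp add: perm_monoid_def)
    show "M \<noteq> {}" using M by (auto simp: perm_group_def)
    fix f assume f: "f \<in> M"
    from perm_group_inverse[OF M(1) f] obtain g where g: "g \<in> M" "g \<circ> f = id" by blast
    have "inv\<^bsub>perm_monoid Q\<^esub> f = g"
      by (rule inv_equality) (use g f M in \<open>auto simp: perm_monoid_def\<close>)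
    then show "inv\<^bsub>perm_monoid Q\<^esub> f \<in> M" using g by simp
    fix g assume "g \<in> M"
    then show "f \<otimes>\<^bsub>perm_monoid Q\<^esub> g \<in> M" using f M by (simp add: perm_monoid_def perm_group_def)
  qed
  from lagrange[OF this] have "card (rcosets\<^bsub>perm_monoid Q\<^esub> M) * card M = Coset.order (perm_monoid Q)" .
  then show ?thesis by (simp add: Coset.order_def perm_monoid_def) (metis dvd_triv_right)
qed

text \<open>Both the left and the right coset of g are the complement of M, so M is normal and the
  square of g lies in M.\<close>

lemma index_two:
  fixes Q M :: "('a::finite \<Rightarrow> 'a) set"
  assumes Q: "perm_group Q" and M: "perm_group M" "M \<subseteq> Q" and c: "card Q = 2 * card M"
    and g: "g \<in> Q" "g \<notin> M"
  shows "Q = M \<union> (\<lambda>m. g \<circ> m) ` M" and "g \<circ> g \<in> M" and "m \<in> M \<Longrightarrow> \<exists>m'\<in>M. m \<circ> g = g \<circ> m'"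
proof -
  have notM: "g \<circ> m \<notin> M" "m \<circ> g \<notin> M" if m: "m \<in> M" for m
  proof -
    from perm_group_inverse[OF M(1) m] obtain m' where m': "m' \<in> M" "m \<circ> m' = id" "m' \<circ> m = id" by blast
    show "g \<circ> m \<notin> M"
    proof
      assume "g \<circ> m \<in> M"
      then have "(g \<circ> m) \<circ> m' \<in> M" using m' M by (auto simp: perm_group_def)
      then show False using m' g by (simp add: comp_assoc)
    qed
    show "m \<circ> g \<notin> M"
    proof
      assume "m \<circ> g \<in> M"
      then have "m' \<circ> (m \<circ> g) \<in> M" using m' M by (auto simp: perm_group_def)
      then show False using m' g by (simp flip: comp_assoc)
    qed
  qed
  have "card ((\<lambda>m. g \<circ> m) ` M) = card M"
    by (rule card_image) (use perm_group_cancel[OF Q g(1)] in \<open>auto simp: inj_on_def\<close>)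
  moreover have "M \<inter> (\<lambda>m. g \<circ> m) ` M = {}" using notM by auto
  ultimately have "card (M \<union> (\<lambda>m. g \<circ> m) ` M) = card Q" using c by (simp add: card_Un_disjoint)
  moreover have "M \<union> (\<lambda>m. g \<circ> m) ` M \<subseteq> Q" using M(2) Q g by (auto simp: perm_group_def)
  ultimately show eq: "Q = M \<union> (\<lambda>m. g \<circ> m) ` M" by (metis card_subset_eq finite)
  show "g \<circ> g \<in> M"
  proof (rule ccontr)
    assume "g \<circ> g \<notin> M"
    moreover have "g \<circ> g \<in> Q" using Q g by (auto simp: perm_group_def)
    ultimately obtain m where "m \<in> M" "g \<circ> g = g \<circ> m" using eq by blast
    then show False using perm_group_cancel[OF Q g(1)] g(2) by metis
  qed
  show "\<exists>m'\<in>M. m \<circ> g = g \<circ> m'" if m: "m \<in> M"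
  proof -
    have "m \<circ> g \<in> Q" using Q g m M by (auto simp: perm_group_def)
    then show ?thesis using eq notM(2)[OF m] by blast
  qed
qed

section \<open>Netto systems without Pasch configurations\<close>

context netto_quasigroup
begin

lemma no_pasch:
  assumes two: "quad_char (2::'a) \<noteq> 1" and "c \<noteq> x" "c \<noteq> y" "x \<noteq> y" "y \<noteq> c \<star> x"
  shows "x \<star> y \<noteq> (c \<star> x) \<star> (c \<star> y)"
proof -
  have tr: "(u + c) \<star> (v + c) = u \<star> v + c" for u v by (simp add: op_lam)
  define x' y' where "x' = x - c" and "y' = y - c"
  have xy: "x = x' + c" "y = y' + c" "c = 0 + c" by (simp_all add: x'_def y'_def)
  have "y' \<noteq> 0 \<star> x'" using assms(5) xy tr[of 0 x'] by auto
  then have "x' \<star> y' \<noteq> (0 \<star> x') \<star> (0 \<star> y')"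
    using pasch_0[of x' y'] assms by (auto simp: x'_def y'_def)
  then show ?thesis using tr[of 0 x'] tr[of 0 y'] tr[of "0 \<star> x'" "0 \<star> y'"] tr[of x' y'] xy by auto
qed

text \<open>Without Pasch configurations and mitres, an involutive automorphism of a subsystem with more than three points fixes
  more than three points: if \<open>x\<close> is moved, then \<open>c = x \<star> t x\<close> is fixed, and a further fixed point \<open>d\<close> yields
  the fixed points \<open>c \<star> d\<close> and \<open>(d \<star> x) \<star> t (d \<star> x)\<close>.\<close>

lemma involution_fixes:
  assumes two: "quad_char (2::'a) \<noteq> 1"
    and closed: "\<And>x y. x \<in> S \<Longrightarrow> y \<in> S \<Longrightarrow> x \<star> y \<in> S" and big: "card S > 3"
    and t: "\<And>x. x \<in> S \<Longrightarrow> t x \<in> S" "\<And>x. x \<in> S \<Longrightarrow> t (t x) = x"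
      "\<And>x y. x \<in> S \<Longrightarrow> y \<in> S \<Longrightarrow> t (x \<star> y) = t x \<star> t y"
  shows "card {x\<in>S. t x = x} > 3"
proof (cases "\<forall>x\<in>S. t x = x")
  case True
  then have "{x\<in>S. t x = x} = S" by auto
  then show ?thesis using big by simp
next
  case False
  then obtain x where x: "x \<in> S" "t x \<noteq> x" by blast
  have center: "t (z \<star> t z) = z \<star> t z" if "z \<in> S" for z
    using t(3)[OF that t(1)[OF that]] t(2)[OF that] op_comm by simp
  define c where "c = x \<star> t x"
  have c: "c \<in> S" "t c = c" using center[OF x(1)] closed[OF x(1) t(1)[OF x(1)]] by (auto simp: c_def)
  have cx: "c \<star> x = t x" unfolding c_def using op_comm[of "x \<star> t x" x] op_invol[of x "t x"] by simp
  have cne: "c \<noteq> x" "c \<noteq> t x" using op_eq_left[of x "t x"] op_eq_right[of x "t x"] x(2) by (auto simp: c_def)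
  show ?thesis
  proof (cases "\<exists>d\<in>S. t d = d \<and> d \<noteq> c")
    case False
    then have only: "d = c" if "d \<in> S" "t d = d" for d using that by blast
    \<comment> \<open>If c is the only fixed point, every z \<star> t z equals c, so t acts on S as
      multiplication by c. An automorphism of this kind produces mitres.\<close>
    have R: "c \<star> z = t z" if z: "z \<in> S" for z
    proof -
      have "z \<star> t z = c" by (rule only) (use center[OF z] closed[OF z t(1)[OF z]] in auto)
      then show ?thesis using op_comm[of c z] op_invol[of z "t z"] by simp
    qed
    have "\<not> S \<subseteq> {c, x, t x}"
    proof
      assume "S \<subseteq> {c, x, t x}"
      then have "card S \<le> card {c, x, t x}" by (intro card_mono) auto
      also have "\<dots> \<le> 3" by (simp add: card_insert_if)
      finally show False using big by simp
    qed
    then obtain y where y: "y \<in> S" "y \<noteq> c" "y \<noteq> x" "y \<noteq> t x" by blast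
    have "(c \<star> x) \<star> (c \<star> y) = c \<star> (x \<star> y)"
      using R[OF x(1)] R[OF y(1)] R[OF closed[OF x(1) y(1)]] t(3)[OF x(1) y(1)] by simp
    moreover have "(c \<star> x) \<star> (c \<star> y) \<noteq> c \<star> (x \<star> y)"
      by (rule no_mitre) (use y cne cx in auto)
    ultimately show ?thesis by blast
  next
    case True
    then obtain d where d: "d \<in> S" "t d = d" "d \<noteq> c" by blast
    \<comment> \<open>Both x and y = d \<star> x are moved, and c' is the fixed point belonging to
      y. If c' were c, the points x, y and c would span a Pasch configuration; if it were d \<star>
      c, there would be a mitre centred at d.\<close>
    define y where "y = d \<star> x"
    have yS: "y \<in> S" using closed d x by (simp add: y_def)
    have ty: "t y = d \<star> t x" using t(3)[OF d(1) x(1)] d by (simp add: y_def)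
    have dx: "d \<noteq> x" "d \<noteq> t x" using d x t(2)[OF x(1)] by auto
    have ynx: "y \<noteq> t x"
    proof
      assume "y = t x"
      then have "d = x \<star> t x" using op_invol[of x d] op_comm[of d x] by (simp add: y_def)
      then show False using d by (simp add: c_def)
    qed
    have dy: "d \<star> y = x" unfolding y_def by (rule op_invol)
    define c' where "c' = y \<star> t y"
    have c': "c' \<in> S" "t c' = c'" using center[OF yS] closed[OF yS t(1)[OF yS]] by (auto simp: c'_def)
    have yx: "y \<noteq> x" using op_eq_right[of d x] dx by (auto simp: y_def)
    have cy: "c \<noteq> y"
    proof
      assume "c = y"
      then have "t y = y" using c by simp
      then have "d \<star> t x = d \<star> x" using ty by (simp add: y_def)
      then show False using x(2) op_cancel_left by blast
    qed
    have n1: "c' \<noteq> c"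
    proof
      assume e: "c' = c"
      have "c \<star> y = t y" using e op_comm[of c y] op_invol[of y "t y"] by (simp add: c'_def)
      moreover have "x \<star> y = d" unfolding y_def op_comm[of d x] by (rule op_invol)
      moreover have "t x \<star> t y = d" using ty op_comm[of "t x" "d"] op_invol[of "t x" d] by simp
      ultimately have "x \<star> y = (c \<star> x) \<star> (c \<star> y)" using cx by simp
      moreover have "x \<star> y \<noteq> (c \<star> x) \<star> (c \<star> y)"
        by (rule no_pasch[OF two]) (use cne cy yx ynx cx in auto)
      ultimately show False by blast
    qed
    have n2: "c' \<noteq> d \<star> c"
    proof
      assume e: "c' = d \<star> c"
      then have "(d \<star> x) \<star> (d \<star> t x) = d \<star> (x \<star> t x)" using ty by (simp add: c'_def c_def y_def)
      moreover have "(d \<star> x) \<star> (d \<star> t x) \<noteq> d \<star> (x \<star> t x)"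
        by (rule no_mitre) (use dx x(2) ynx in \<open>auto simp: y_def\<close>)
      ultimately show False by blast
    qed
    have n3: "c' \<noteq> d"
    proof
      assume e: "c' = d"
      have "t y = y \<star> d" using e op_invol[of y "t y"] by (simp add: c'_def)
      then have "t y = x" using dy op_comm by simp
      then have "y = t x" using t(2)[OF yS] by simp
      then show False using ynx by blast
    qed
    have n4: "d \<star> c \<noteq> c" "d \<star> c \<noteq> d" using op_eq_left[of d c] op_eq_right[of d c] d(3) by auto
    have dc: "d \<star> c \<in> S" "t (d \<star> c) = d \<star> c" using closed c d t(3)[OF d(1) c(1)] by auto
    have "card {c, d, d \<star> c, c'} = 4" using n1 n2 n3 n4 d(3) by auto
    moreover have "{c, d, d \<star> c, c'} \<subseteq> {x\<in>S. t x = x}" using c d dc c' by auto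
    ultimately have "4 \<le> card {x\<in>S. t x = x}" using card_mono[of "{x\<in>S. t x = x}" "{c, d, d \<star> c, c'}"] by simp
    then show ?thesis by simp
  qed
qed

text \<open>Induction on the order: the fixed points S of a subgroup M of index two form a subsystem
  with more than three points. An element g outside M normalises M and has its square in M, so it
  acts on S as an involution or trivially.\<close>

lemma two_group_fixes:
  assumes two: "quad_char (2::'a) \<noteq> 1"
  shows "perm_group Q \<Longrightarrow> Q \<subseteq> G \<Longrightarrow> card Q = 2 ^ n \<Longrightarrow> card {x. \<forall>f\<in>Q. f x = x} > 3"
proof (induction n arbitrary: Q)
  case 0
  then have "id \<in> Q" "card Q = 1" by (auto simp: perm_group_def)
  then have "Q = {id}" by (metis card_1_singletonE singletonD)
  then have "{x. \<forall>f\<in>Q. f x = x} = UNIV" by auto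
  moreover have "card {0, 1, a, b} = 4" using ab_nonzero ab by auto
  then have "4 \<le> CARD('a)" by (metis card_mono finite subset_UNIV)
  ultimately show ?case by simp
next
  case (Suc n)
  obtain M where M: "M \<subseteq> Q" "perm_group M" "card M = 2 ^ n"
    using perm_group_sylow[OF Suc.prems(1), of n] Suc.prems(3) by auto
  define S where "S = {x. \<forall>f\<in>M. f x = x}"
  have S3: "card S > 3" unfolding S_def using Suc.IH[OF M(2)] M Suc.prems(2) by auto
  have c2: "card Q = 2 * card M" using Suc.prems(3) M(3) by simp
  have "Q \<noteq> M" using c2 M(3) by auto
  then obtain g where g: "g \<in> Q" "g \<notin> M" using M(1) by blast
  note I = index_two[OF Suc.prems(1) M(2,1) c2 g]
  have gG: "g \<in> G" using g Suc.prems(2) by blast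
  have "card {x\<in>S. g x = x} > 3"
  proof (rule involution_fixes[OF two _ S3])
    fix x y assume xy: "x \<in> S" "y \<in> S"
    have "f (x \<star> y) = x \<star> y" if "f \<in> M" for f
    proof -
      have "f \<in> G" using that M(1) Suc.prems(2) by blast
      moreover have "f x = x" "f y = y" using xy that unfolding S_def by blast+
      ultimately show ?thesis using G_op[of f x y] by simp
    qed
    then show "x \<star> y \<in> S" by (simp add: S_def)
    show "g (x \<star> y) = g x \<star> g y" by (rule G_op[OF gG])
  next
    fix x assume x: "x \<in> S"
    have "m (g x) = g x" if m: "m \<in> M" for m
    proof -
      obtain m' where m': "m' \<in> M" "m \<circ> g = g \<circ> m'" using I(3)[OF m] by blast
      have "m (g x) = g (m' x)" using fun_cong[OF m'(2), of x] by simp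
      moreover have "m' x = x" using m'(1) x unfolding S_def by blast
      ultimately show ?thesis by simp
    qed
    then show "g x \<in> S" by (simp add: S_def)
    show "g (g x) = x" using I(2) x by (auto simp: S_def)
  qed
  moreover have "{x\<in>S. g x = x} \<subseteq> {x. \<forall>f\<in>Q. f x = x}"
  proof safe
    fix x f assume x: "x \<in> S" "g x = x" and f: "f \<in> Q"
    then consider "f \<in> M" | m where "m \<in> M" "f = g \<circ> m" using I(1) by blast
    then show "f x = x" by cases (use x in \<open>auto simp: S_def\<close>)
  qed
  then have "card {x\<in>S. g x = x} \<le> card {x. \<forall>f\<in>Q. f x = x}" by (intro card_mono) auto
  ultimately show ?case by simp
qed

text \<open>A Sylow 2-subgroup would fix two points x and y, so the full power of 2 in card G
  already divides the order of the stabiliser H of both. By two-transitivity the index of H is q (q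
  - 1), which is even, a contradiction.\<close>

lemma pasch_free_not_swapping:
  assumes two: "quad_char (2::'a) \<noteq> 1"
  shows "\<not> swapping"
proof
  assume swap: swapping
  have PG: "perm_group G" unfolding perm_group_def
    using G_id G_comp G_bij by (auto simp: comp_def id_def)
  have G0: "card G > 0" using PG by (auto simp: perm_group_def card_gt_0_iff)
  define k where "k = multiplicity 2 (card G)"
  have kd: "2 ^ k dvd card G" unfolding k_def by (rule multiplicity_dvd)
  obtain Q where Q: "Q \<subseteq> G" "perm_group Q" "card Q = 2 ^ k" using perm_group_sylow[OF PG kd] by blast
  have f3: "card {x. \<forall>f\<in>Q. f x = x} > 3" by (rule two_group_fixes[OF two Q(2,1,3)])
  have "\<exists>x y. x \<noteq> y \<and> (\<forall>f\<in>Q. f x = x) \<and> (\<forall>f\<in>Q. f y = y)"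
  proof (rule ccontr)
    assume "\<not> ?thesis"
    then have "card {x. \<forall>f\<in>Q. f x = x} \<le> Suc 0" by (auto simp: card_le_Suc0_iff_eq)
    then show False using f3 by simp
  qed
  then obtain x y where xy: "x \<noteq> y" "\<And>f. f \<in> Q \<Longrightarrow> f x = x" "\<And>f. f \<in> Q \<Longrightarrow> f y = y" by blast
  define H where "H = {f\<in>G. f x = x \<and> f y = y}"
  have PH: "perm_group H" using PG by (auto simp: perm_group_def H_def)
  have "Q \<subseteq> H" using Q(1) xy by (auto simp: H_def)
  then have "2 ^ k dvd card H" using perm_group_lagrange[OF PH Q(2)] Q(3) by simp
  define D where "D = {(u::'a, v::'a). u \<noteq> v}"
  have fib: "card {f\<in>G. (f x, f y) = p} = card H" if p: "p \<in> D" for p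
  proof -
    obtain u v where uv: "p = (u, v)" "u \<noteq> v" using p by (auto simp: D_def)
    obtain h where h: "h \<in> G" "h 0 = x" "h 1 = y" using swapping_two_transitive[OF swap xy(1)] by blast
    obtain h' where h': "h' \<in> G" "h' 0 = u" "h' 1 = v" using swapping_two_transitive[OF swap uv(2)] by blast
    define w where "w z = h' (inv_into UNIV h z)" for z
    have hx: "inv_into UNIV h x = 0" "inv_into UNIV h y = 1"
      using inv_f_f[OF bij_is_inj[OF G_bij[OF h(1)]], of 0] inv_f_f[OF bij_is_inj[OF G_bij[OF h(1)]], of 1] h by simp_all
    have "w \<in> G" unfolding w_def by (rule G_comp[OF h'(1) G_inv[OF h(1)]])
    moreover have "w x = u" "w y = v" using hx h' by (simp_all add: w_def)
    ultimately have w: "w \<in> G" "w x = u" "w y = v" by auto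
    have "bij_betw (\<lambda>f z. w (f z)) H {f\<in>G. (f x, f y) = p}"
    proof (rule bij_betw_byWitness[where f'="\<lambda>f z. inv_into UNIV w (f z)"])
      have wi: "inv_into UNIV w (w z) = z" "w (inv_into UNIV w z) = z" for z
        using G_bij[OF w(1)] by (auto simp: bij_is_inj bij_is_surj surj_f_inv_f)
      show "\<forall>f\<in>H. (\<lambda>z. inv_into UNIV w (w (f z))) = f" by (simp add: wi)
      show "\<forall>f\<in>{f\<in>G. (f x, f y) = p}. (\<lambda>z. w (inv_into UNIV w (f z))) = f" by (simp add: wi)
      show "(\<lambda>f z. w (f z)) ` H \<subseteq> {f\<in>G. (f x, f y) = p}"
        using G_comp[OF w(1)] w uv by (auto simp: H_def)
      have "inv_into UNIV w u = x" "inv_into UNIV w v = y" using wi w by metis+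
      then show "(\<lambda>f z. inv_into UNIV w (f z)) ` {f\<in>G. (f x, f y) = p} \<subseteq> H"
        using G_comp[OF G_inv[OF w(1)]] uv by (auto simp: H_def)
    qed
    then show ?thesis by (rule bij_betw_same_card[symmetric])
  qed
  have "card G = (\<Sum>f\<in>G. 1)" by simp
  also have "\<dots> = (\<Sum>p\<in>D. \<Sum>f\<in>{f\<in>G. (f x, f y) = p}. 1)"
    by (rule sum.group[symmetric]) (use xy(1) G_inj in \<open>auto simp: D_def\<close>)
  also have "\<dots> = (\<Sum>p\<in>D. card H)" by (rule sum.cong) (use fib in auto)
  finally have cG: "card G = card D * card H" by simp
  have "D = UNIV - (\<lambda>x. (x, x)) ` UNIV" by (auto simp: D_def)
  moreover have "card ((\<lambda>x::'a. (x, x)) ` UNIV) = CARD('a)" by (rule card_image) (auto simp: inj_on_def)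
  ultimately have "card D = CARD('a) * CARD('a) - CARD('a)" by (simp add: card_Diff_subset card_prod)
  then have "even (card D)" using odd_card by simp
  then have "2 * 2 ^ k dvd card G" unfolding cG using \<open>2 ^ k dvd card H\<close> by (rule mult_dvd_mono)
  then have "2 ^ Suc k dvd card G" by simp
  then have "Suc k \<le> multiplicity 2 (card G)" using G0 by (intro multiplicity_geI) auto
  then show False by (simp add: k_def)
qed

end

section \<open>Pasch configurations when 2 is a square\<close>

context netto_quasigroup
begin

text \<open>The points y for which the triples of 0 with x and with y lie in a Pasch configuration.
  Only the operation enters, so automorphisms fixing 0 respect this relation.\<close>

definition pasch_nbrs :: "'a \<Rightarrow> 'a set" where
  "pasch_nbrs x = {y. y \<noteq> 0 \<and> y \<noteq> x \<and> y \<noteq> 0 \<star> x \<and> x \<star> y = (0 \<star> x) \<star> (0 \<star> y)}"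

lemma pasch_nbrs_image:
  assumes f: "f \<in> G" "f 0 = 0" and y: "y \<in> pasch_nbrs x"
  shows "f y \<in> pasch_nbrs (f x)"
proof -
  have "0 \<star> f z = f (0 \<star> z)" for z using G_op[OF f(1), of 0 z] f(2) by simp
  moreover have "f u = 0 \<longleftrightarrow> u = 0" for u using G_inj[OF f(1), of u 0] f(2) by simp
  ultimately show ?thesis
    using y G_inj[OF f(1)] G_op[OF f(1), symmetric] by (simp add: pasch_nbrs_def)
qed

text \<open>The norm of \<open>P + Q l\<close>, where \<open>l\<close> is a root of \<open>X\<^sup>2 - X + 1\<close>.\<close>

lemma norm_zero:
  assumes "P + Q * lam d = 0"
  shows "P * P + P * Q + Q * Q = 0"
proof -
  let ?l = "lam d"
  have "P * P + P * Q + Q * Q = P * P + P * Q + Q * Q * (?l * (1 - ?l))" unfolding lam_lam by simp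
  also have "\<dots> = (P + Q * ?l) * (P + Q * (1 - ?l))" by (simp add: algebra_simps)
  finally show ?thesis using assms by simp
qed

context
  assumes two: "quad_char (2::'a) = 1"
begin

lemma pasch_nbrs_eq:
  assumes x: "x \<noteq> 0"
  shows "pasch_nbrs x = {2 * x, x / 2, - x, (1 - lam x) * x}"
proof -
  have ne: "y \<noteq> 0 \<and> y \<noteq> x \<and> y \<noteq> 0 \<star> x" if "y \<in> {2 * x, x / 2, - x, (1 - lam x) * x}" for y
  proof -
    have "x / 2 = (1 / 2) * x" "- x = (- 1) * x" by simp_all
    then have "y \<in> {2 * x, (1 / 2) * x, (- 1) * x, (1 - lam x) * x}" using that by metis
    then obtain r where r: "r \<in> {2, 1 / 2, - 1, 1 - lam x}" "y = r * x" by blast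
    have "(2::'a) \<noteq> 1" using one_add_one[where 'a='a] by (metis add_cancel_left_left zero_neq_one)
    then have "(1 / 2 :: 'a) \<noteq> 1" "(1 / 2 :: 'a) \<noteq> 0" using two_nonzero by (simp_all add: divide_eq_eq)
    moreover have "(- 1 :: 'a) \<noteq> 0" "1 - lam x \<noteq> 1" using lam_nz[of x] by simp_all
    ultimately have "r \<noteq> 0 \<and> r \<noteq> 1"
      using r(1) \<open>2 \<noteq> 1\<close> two_nonzero lam_nz(2)[of x] one_neq_minus_one by (metis empty_iff insert_iff)
    then have r0: "r \<noteq> 0" "r \<noteq> 1" by auto
    \<comment> \<open>Each of the four coincidences has the form P + Q \<lambda> = 0 with norm 3,
      and 3 is nonzero.\<close>
    have "r \<noteq> lam x"
    proof
      assume rl: "r = lam x"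
      have n: False if "P + Q * lam x = 0" "P * P + P * Q + Q * Q = 3" for P Q
        using norm_zero[OF that(1)] that(2) three_nz by simp
      consider "r = 2" | "r = 1 / 2" | "r = - 1" | "r = 1 - lam x" using r(1) by blast
      then show False
      proof cases
        case 1
        then have "2 + (- 1) * lam x = 0" using rl by simp
        then show False by (rule n) simp
      next
        case 2
        then have "1 + (- 2) * lam x = 0" using rl two_nonzero by (simp add: field_simps)
        then show False by (rule n) simp
      next
        case 3
        then have "1 + 1 * lam x = 0" using rl by (metis add.right_inverse mult_1)
        then show False by (rule n) simp
      next
        case 4
        then have "1 + (- 2) * lam x = 0" using rl by (simp add: algebra_simps)
        then show False by (rule n) simp
      qed
    qed
    then show ?thesis using r(2) r0 x by (simp add: zero_op)
  qed
  show ?thesis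
  proof (rule Set.set_eqI)
    fix y
    show "y \<in> pasch_nbrs x \<longleftrightarrow> y \<in> {2 * x, x / 2, - x, (1 - lam x) * x}"
      using ne[of y] pasch_0[OF x, of y] two unfolding pasch_nbrs_def mem_Collect_eq by blast
  qed
qed

text \<open>An invariant relation that tells the four neighbours of x apart: it holds for - x and
  \<open>(1 - lam x) * x\<close>, and outside characteristic 7 it fails for 2 x and x / 2.\<close>

definition triangle :: "'a \<Rightarrow> 'a \<Rightarrow> bool" where
  "triangle x z \<longleftrightarrow> (\<exists>w\<in>pasch_nbrs x. 0 \<star> w \<in> pasch_nbrs z)"

lemma triangle_image:
  assumes f: "f \<in> G" "f 0 = 0" and t: "triangle x z"
  shows "triangle (f x) (f z)"
proof -
  obtain w where "w \<in> pasch_nbrs x" "0 \<star> w \<in> pasch_nbrs z" using t by (auto simp: triangle_def)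
  then have "f w \<in> pasch_nbrs (f x)" "f (0 \<star> w) \<in> pasch_nbrs (f z)" using pasch_nbrs_image[OF f] by auto
  then show ?thesis using G_op[OF f(1), of 0 w] f(2) by (auto simp: triangle_def)
qed

lemma zero_op_nbrs:
  assumes x: "x \<noteq> 0"
  shows "(\<lambda>w. 0 \<star> w) ` pasch_nbrs x = {2 * lam x * x, lam x / 2 * x, - (1 - lam x) * x, - lam x * x}"
proof -
  have "0 \<star> (2 * x) = 2 * lam x * x" using zero_op_same[of "2 * x" x] two by (simp add: quad_char_mult)
  moreover have "0 \<star> (x / 2) = lam x / 2 * x" using zero_op_same[of "x / 2" x] two by (simp add: quad_char_divide)
  moreover have "0 \<star> (- x) = - (1 - lam x) * x"
  proof -
    have "quad_char (- x) = - quad_char x" using quad_char_minus[of x] minus_one by simp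
    from zero_op_flip[OF x this] show ?thesis by (simp only: mult_minus_right mult_minus_left)
  qed
  moreover have "0 \<star> ((1 - lam x) * x) = - lam x * x"
  proof -
    have "0 \<star> ((1 - lam x) * x) = (1 - lam x) * ((1 - lam x) * x)"
      by (rule zero_op_flip[OF x]) (simp add: quad_char_mult chi_lam)
    also have "\<dots> = - lam x * x" unfolding mult.assoc[symmetric] lam_bar_sq ..
    finally show ?thesis .
  qed
  ultimately show ?thesis unfolding pasch_nbrs_eq[OF x] by (simp only: image_insert image_empty)
qed

lemma triangle_minus:
  assumes x: "x \<noteq> 0"
  shows "triangle x (- x)" and "triangle x ((1 - lam x) * x)"
proof -
  have "- lam x * x \<in> (\<lambda>w. 0 \<star> w) ` pasch_nbrs x" unfolding zero_op_nbrs[OF x] by simp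
  moreover have "- lam x * x \<in> pasch_nbrs (- x)"
    using pasch_nbrs_eq[of "- x"] lam_neg[OF x] x by simp
  ultimately show "triangle x (- x)" unfolding triangle_def by (metis imageE)
  have "- (1 - lam x) * x \<in> (\<lambda>w. 0 \<star> w) ` pasch_nbrs x" unfolding zero_op_nbrs[OF x] by simp
  moreover have nz: "(1 - lam x) * x \<noteq> 0" using lam_nz[of x] x by simp
  have "- (1 - lam x) * x \<in> pasch_nbrs ((1 - lam x) * x)"
    unfolding pasch_nbrs_eq[OF nz] mult_minus_left by blast
  ultimately show "triangle x ((1 - lam x) * x)" unfolding triangle_def by (metis imageE)
qed

text \<open>A common point would give P + Q \<lambda> = 0 with integers P and Q whose norm has no
  prime factors besides 2, 3, 7 and 19. The prime 19 is excluded because 36 = 2 * 19 - 2 would make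
  - 2 a square.\<close>

lemma not_triangle:
  assumes x: "x \<noteq> 0" and seven: "(7::'a) \<noteq> 0"
  shows "\<not> triangle x (2 * x)" and "\<not> triangle x (x / 2)"
proof -
  define l where "l = lam x"
  have nineteen: "(19::'a) \<noteq> 0"
  proof
    assume "(19::'a) = 0"
    moreover have "(6::'a)\<^sup>2 = 2 * 19 + (- 2)" by simp
    ultimately have "(- 2 :: 'a) = 6\<^sup>2" by (metis add_0 mult_zero_right)
    then have "quad_char (- 2 :: 'a) = 1"
      unfolding quad_char_1_iff using two_nonzero by (metis neg_equal_0_iff_equal)
    moreover have "quad_char (- 2 :: 'a) = - 1" using quad_char_minus[of "2::'a"] minus_one two by simp
    ultimately show False by simp
  qed
  have nz: "(2::'a) \<noteq> 0" "(3::'a) \<noteq> 0" "(12::'a) \<noteq> 0" "(21::'a) \<noteq> 0" "(57::'a) \<noteq> 0" "(9::'a) \<noteq> 0" "(4::'a) \<noteq> 0" "(8::'a) \<noteq> 0" "(16::'a) \<noteq> 0"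
    "(27::'a) \<noteq> 0"
  proof -
    have "(12::'a) = 2 * 2 * 3" "(21::'a) = 3 * 7" "(57::'a) = 3 * 19" "(9::'a) = 3 * 3" "(4::'a) = 2 * 2" "(8::'a) = 2 * 2 * 2"
      "(16::'a) = 2 * 2 * 2 * 2" "(27::'a) = 3 * 3 * 3" by simp_all
    then show "(2::'a) \<noteq> 0" "(3::'a) \<noteq> 0" "(12::'a) \<noteq> 0" "(21::'a) \<noteq> 0" "(57::'a) \<noteq> 0" "(9::'a) \<noteq> 0" "(4::'a) \<noteq> 0" "(8::'a) \<noteq> 0" "(16::'a) \<noteq> 0"
      "(27::'a) \<noteq> 0"
      using two_nonzero three_nz seven nineteen by (metis mult_eq_0_iff)+
  qed
  have neqI: "v \<noteq> u" if "k * v = k * u + P + Q * l" "P * P + P * Q + Q * Q \<noteq> 0" for k u v P Q :: 'a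
    using norm_zero[of P Q x] that by (auto simp: l_def add.assoc)
  have far1: "v \<noteq> u" if "v \<in> {4, 1, - 2, 2 * (1 - l)}" "u \<in> {2 * l, l / 2, - (1 - l), - l}" for u v
  proof -
    have n1: "4 \<noteq> 2 * l" by (rule neqI[where k=1 and P="4" and Q="-2"]) (simp_all add: nz field_simps)
    have n2: "4 \<noteq> l / 2" by (rule neqI[where k=2 and P="8" and Q="-1"]) (simp_all add: nz field_simps)
    have n3: "4 \<noteq> - (1 - l)" by (rule neqI[where k=1 and P="5" and Q="-1"]) (simp_all add: nz field_simps)
    have n4: "4 \<noteq> - l" by (rule neqI[where k=1 and P="4" and Q="1"]) (simp_all add: nz field_simps)
    have n5: "1 \<noteq> 2 * l" by (rule neqI[where k=1 and P="1" and Q="-2"]) (simp_all add: nz field_simps)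
    have n6: "1 \<noteq> l / 2" by (rule neqI[where k=2 and P="2" and Q="-1"]) (simp_all add: nz field_simps)
    have n7: "1 \<noteq> - (1 - l)" by (rule neqI[where k=1 and P="2" and Q="-1"]) (simp_all add: nz field_simps)
    have n8: "1 \<noteq> - l" by (rule neqI[where k=1 and P="1" and Q="1"]) (simp_all add: nz field_simps)
    have n9: "- 2 \<noteq> 2 * l" by (rule neqI[where k=1 and P="-2" and Q="-2"]) (simp_all add: nz field_simps)
    have n10: "- 2 \<noteq> l / 2" by (rule neqI[where k=2 and P="-4" and Q="-1"]) (simp_all add: nz field_simps)
    have n11: "- 2 \<noteq> - (1 - l)" by (rule neqI[where k=1 and P="-1" and Q="-1"]) (simp_all add: nz field_simps)
    have n12: "- 2 \<noteq> - l" by (rule neqI[where k=1 and P="-2" and Q="1"]) (simp_all add: nz field_simps)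
    have n13: "2 * (1 - l) \<noteq> 2 * l" by (rule neqI[where k=1 and P="2" and Q="-4"]) (simp_all add: nz field_simps)
    have n14: "2 * (1 - l) \<noteq> l / 2" by (rule neqI[where k=2 and P="4" and Q="-5"]) (simp_all add: nz field_simps)
    have n15: "2 * (1 - l) \<noteq> - (1 - l)" by (rule neqI[where k=1 and P="3" and Q="-3"]) (simp_all add: nz field_simps)
    have n16: "2 * (1 - l) \<noteq> - l" by (rule neqI[where k=1 and P="2" and Q="-1"]) (simp_all add: nz field_simps)
    from that show ?thesis
      by (elim insertE emptyE) (simp_all only: n1 n2 n3 n4 n5 n6 n7 n8 n9 n10 n11 n12 n13 n14 n15 n16 not_False_eq_True)
  qed
  have far2: "v \<noteq> u" if "v \<in> {1, 1 / 4, - 1 / 2, (1 - l) / 2}" "u \<in> {2 * l, l / 2, - (1 - l), - l}" for u v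
  proof -
    have n1: "1 \<noteq> 2 * l" by (rule neqI[where k=1 and P="1" and Q="-2"]) (simp_all add: nz field_simps)
    have n2: "1 \<noteq> l / 2" by (rule neqI[where k=2 and P="2" and Q="-1"]) (simp_all add: nz field_simps)
    have n3: "1 \<noteq> - (1 - l)" by (rule neqI[where k=1 and P="2" and Q="-1"]) (simp_all add: nz field_simps)
    have n4: "1 \<noteq> - l" by (rule neqI[where k=1 and P="1" and Q="1"]) (simp_all add: nz field_simps)
    have n5: "1 / 4 \<noteq> 2 * l" by (rule neqI[where k=4 and P="1" and Q="-8"]) (simp_all add: nz field_simps)
    have n6: "1 / 4 \<noteq> l / 2" by (rule neqI[where k=4 and P="1" and Q="-2"]) (simp_all add: nz field_simps)
    have n7: "1 / 4 \<noteq> - (1 - l)" by (rule neqI[where k=4 and P="5" and Q="-4"]) (simp_all add: nz field_simps)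
    have n8: "1 / 4 \<noteq> - l" by (rule neqI[where k=4 and P="1" and Q="4"]) (simp_all add: nz field_simps)
    have n9: "- 1 / 2 \<noteq> 2 * l" by (rule neqI[where k=2 and P="-1" and Q="-4"]) (simp_all add: nz field_simps)
    have n10: "- 1 / 2 \<noteq> l / 2" by (rule neqI[where k=2 and P="-1" and Q="-1"]) (simp_all add: nz field_simps)
    have n11: "- 1 / 2 \<noteq> - (1 - l)" by (rule neqI[where k=2 and P="1" and Q="-2"]) (simp_all add: nz field_simps)
    have n12: "- 1 / 2 \<noteq> - l" by (rule neqI[where k=2 and P="-1" and Q="2"]) (simp_all add: nz field_simps)
    have n13: "(1 - l) / 2 \<noteq> 2 * l" by (rule neqI[where k=2 and P="1" and Q="-5"]) (simp_all add: nz field_simps)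
    have n14: "(1 - l) / 2 \<noteq> l / 2" by (rule neqI[where k=2 and P="1" and Q="-2"]) (simp_all add: nz field_simps)
    have n15: "(1 - l) / 2 \<noteq> - (1 - l)" by (rule neqI[where k=2 and P="3" and Q="-3"]) (simp_all add: nz field_simps)
    have n16: "(1 - l) / 2 \<noteq> - l" by (rule neqI[where k=2 and P="1" and Q="1"]) (simp_all add: nz field_simps)
    from that show ?thesis
      by (elim insertE emptyE) (simp_all only: n1 n2 n3 n4 n5 n6 n7 n8 n9 n10 n11 n12 n13 n14 n15 n16 not_False_eq_True)
  qed
  have cancel: "u * x \<noteq> v * x" if "v \<noteq> u" for u v using x that by simp
  have lam2: "lam (2 * x) = l" "lam (x / 2) = l"
    unfolding l_def by (rule lam_cong, simp add: quad_char_mult quad_char_divide two)+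
  have N1: "pasch_nbrs (2 * x) = (\<lambda>v. v * x) ` {4, 1, - 2, 2 * (1 - l)}"
    using pasch_nbrs_eq[of "2 * x"] x two_nonzero unfolding lam2 by (simp add: mult_ac)
  have N2: "pasch_nbrs (x / 2) = (\<lambda>v. v * x) ` {1, 1 / 4, - 1 / 2, (1 - l) / 2}"
    using pasch_nbrs_eq[of "x / 2"] x two_nonzero unfolding lam2 by (simp add: mult_ac)
  have R: "(\<lambda>w. 0 \<star> w) ` pasch_nbrs x = (\<lambda>u. u * x) ` {2 * l, l / 2, - (1 - l), - l}"
    unfolding zero_op_nbrs[OF x] l_def by simp
  have gen: "\<not> triangle x z" if N: "pasch_nbrs z = (\<lambda>v. v * x) ` A"
    and far: "\<And>u v. v \<in> A \<Longrightarrow> u \<in> {2 * l, l / 2, - (1 - l), - l} \<Longrightarrow> v \<noteq> u" for z A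
  proof
    assume "triangle x z"
    then obtain w where w: "w \<in> pasch_nbrs x" "0 \<star> w \<in> pasch_nbrs z" by (auto simp: triangle_def)
    have "0 \<star> w \<in> (\<lambda>u. u * x) ` {2 * l, l / 2, - (1 - l), - l}" using w(1) R by blast
    then obtain u where u: "u \<in> {2 * l, l / 2, - (1 - l), - l}" "0 \<star> w = u * x" by (rule imageE) simp
    obtain v where v: "v \<in> A" "0 \<star> w = v * x" using w(2) unfolding N by blast
    then show False using far[OF v(1) u(1)] u(2) x by simp
  qed
  show "\<not> triangle x (2 * x)" by (rule gen[OF N1 far1])
  show "\<not> triangle x (x / 2)" by (rule gen[OF N2 far2])
qed

text \<open>By the invariance of \<open>triangle\<close>, f (2 x) can only be 2 f x or f x / 2. The
  second value is refuted by looking at the same three points 0, x and 2 x from the base point 2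
  x.\<close>

lemma doubling:
  assumes seven: "(7::'a) \<noteq> 0" and f: "f \<in> G" "f 0 = 0"
  shows "f (2 * x) = 2 * f x"
proof (cases "x = 0")
  case True
  then show ?thesis using f(2) by simp
next
  case x: False
  have D: "h y \<in> {2 * h x, h x / 2}" if h: "h \<in> G" "h 0 = 0" and x: "x \<noteq> 0" and y: "y \<in> {2 * x, x / 2}" for h x y
  proof -
    have hx: "h x \<noteq> 0" using x G_inj[OF h(1), of x 0] h(2) by simp
    have "y \<in> pasch_nbrs x" using y unfolding pasch_nbrs_eq[OF x] by blast
    then have mem: "h y \<in> pasch_nbrs (h x)" by (rule pasch_nbrs_image[OF h])
    have nt: "\<not> triangle (h x) (h y)"
    proof
      assume "triangle (h x) (h y)"
      moreover have hi: "inv_into UNIV h \<in> G" by (rule G_inv[OF h(1)])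
      moreover have iv: "inv_into UNIV h (h u) = u" for u using G_bij[OF h(1)] by (simp add: bij_is_inj)
      moreover have "inv_into UNIV h 0 = 0" using iv[of 0] h(2) by simp
      ultimately have "triangle x y" using triangle_image[of "inv_into UNIV h" "h x" "h y"] by simp
      then show False using not_triangle[OF x seven] y by blast
    qed
    then have "h y \<noteq> - h x" "h y \<noteq> (1 - lam (h x)) * h x" using triangle_minus[OF hx] by metis+
    then show ?thesis using mem unfolding pasch_nbrs_eq[OF hx] by blast
  qed
  have "f (2 * x) \<in> {2 * f x, f x / 2}" by (rule D[OF f x]) simp
  moreover have "f (2 * x) \<noteq> f x / 2"
  proof
    assume e: "f (2 * x) = f x / 2"
    \<comment> \<open>The automorphism f seen from 2 x. Under the wrong alternative its values at -
      x and - 2 x are h and - h with h = f x / 2, and neither - h = 2 h nor - h = h / 2 is possible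
      when 3 and h are nonzero.\<close>
    define g where "g z = f (z + 2 * x) + (- f (2 * x))" for z
    have "(\<lambda>z. f (z + 2 * x)) \<in> G" using G_comp[OF f(1) affine_in_G[of 1 "2 * x"]] by simp
    then have g: "g \<in> G" "g 0 = 0" unfolding g_def using shift_in_G by (blast, simp)
    have "g (- x) = f x + (- (f x / 2))" unfolding g_def e by simp
    also have "\<dots> = f x / 2" using two_nonzero by (simp add: field_simps)
    finally have gx: "g (- x) = f x / 2" .
    have g2: "g (2 * (- x)) = - (f x / 2)" unfolding g_def e using f(2) by simp
    have "g (2 * (- x)) \<in> {2 * g (- x), g (- x) / 2}" by (rule D[OF g]) (use x in auto)
    then have "- (f x / 2) = 2 * (f x / 2) \<or> - (f x / 2) = f x / 2 / 2" unfolding gx g2 by blast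
    moreover have "3 * h = 0" if A: "- h = 2 * h \<or> - h = h / 2" for h :: 'a
    proof -
      have "h / 2 * 2 = h" using two_nonzero by simp
      then have "- h = 2 * h \<or> - h * 2 = h" using A by metis
      then show ?thesis
      proof
        assume e: "- h = 2 * h"
        have "3 * h = 2 * h - (- h)" by simp
        then show ?thesis using e by (metis diff_self)
      next
        assume e: "- h * 2 = h"
        have "3 * h = h - (- h * 2)" by simp
        then show ?thesis using e by (metis diff_self)
      qed
    qed
    ultimately have "3 * (f x / 2) = 0" by blast
    then have "f x = 0" using three_nz two_nonzero by simp
    then show False using x G_inj[OF f(1), of x 0] f(2) by simp
  qed
  ultimately show ?thesis by blast
qed

text \<open>Doubling around every base point means that midpoints are preserved, hence additivity.
  Then the x with f (a x) = a f x and those with f (a x) = b f x are two additive subgroups covering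
  the field, so one of them is the whole field and f scales a x by a constant.\<close>

lemma pasch_rigid:
  assumes seven: "(7::'a) \<noteq> 0"
  shows rigid
  unfolding rigid_def
proof (intro ballI impI)
  fix f assume f: "f \<in> G" "f 0 = 0"
  have mid: "f (2 * x + c) = 2 * f (x + c) - f c" for x c
  proof -
    define g where "g z = f (z + c) + (- f c)" for z
    have "(\<lambda>z. f (z + c)) \<in> G" using G_comp[OF f(1) affine_in_G[of 1 c]] by simp
    then have g: "g \<in> G" "g 0 = 0" unfolding g_def using shift_in_G by (blast, simp)
    show ?thesis using doubling[OF seven g, of x] by (simp add: g_def algebra_simps)
  qed
  have add: "f (u + v) = f u + f v" for u v
  proof -
    have e: "2 * ((u - v) / 2) = u - v" "(u - v) / 2 + v = (u + v) / 2" "2 * ((u + v) / 2) = u + v"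
      using two_nonzero by (simp_all add: field_simps)
    have "f u = 2 * f ((u + v) / 2) - f v" using mid[of "(u - v) / 2" v] unfolding e by simp
    moreover have "f (u + v) = 2 * f ((u + v) / 2)" using doubling[OF seven f, of "(u + v) / 2"] unfolding e .
    ultimately show ?thesis by simp
  qed
  have fneg: "f (- x) = - f x" for x using add[of x "- x"] f(2) by (simp add: eq_neg_iff_add_eq_0 add.commute)
  have cases: "f (a * x) = a * f x \<or> f (a * x) = b * f x" for x
  proof -
    have sq: "f (a * x) = a * f x \<or> f (a * x) = b * f x" if "quad_char x = 1" for x
    proof -
      have "f (a * x) = lam (f x) * f x"
        using G_op[OF f(1), of 0 x] that by (simp add: zero_op f(2) lam_square)
      then show ?thesis by (auto simp: lam_def split: if_splits)
    qed
    consider "x = 0" | "quad_char x = 1" | "quad_char (- x) = 1"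
      using quad_char_values[of x] quad_char_minus[of x] minus_one by auto
    then show ?thesis
    proof cases
      case 1 then show ?thesis using f(2) by simp
    next
      case 2 then show ?thesis by (rule sq)
    next
      case 3
      from sq[OF 3] show ?thesis by (simp add: fneg)
    qed
  qed
  have "\<exists>\<beta>. \<forall>x. f (a * x) = \<beta> * f x"
  proof (rule ccontr)
    assume no: "\<not> ?thesis"
    then obtain x y where xy: "f (a * x) \<noteq> a * f x" "f (a * y) \<noteq> b * f y" by blast
    then have xy': "f (a * x) = b * f x" "f (a * y) = a * f y" using cases by blast+
    have s: "f (a * (x + y)) = b * f x + a * f y" using xy' add by (simp add: distrib_left)
    consider "f (a * (x + y)) = a * f x + a * f y" | "f (a * (x + y)) = b * f x + b * f y"
      using cases[of "x + y"] add by (auto simp: distrib_left)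
    then show False
    proof cases
      case 1 then show False using s xy xy' by simp
    next
      case 2 then show False using s xy xy' by simp
    qed
  qed
  then obtain \<beta> where "f (a * x) = \<beta> * f x" for x by blast
  then have "\<exists>e. (e = 1 \<or> e = - 1) \<and> (\<forall>x. quad_char (f x) = e * quad_char x)"
    by (intro scaling_preserves_or_flips[OF f ab])
  then show "(\<forall>x y. f (x + y) = f x + f y) \<and>
      (\<exists>e. (e = 1 \<or> e = - 1) \<and> (\<forall>x. quad_char (f x) = e * quad_char x))" using add by blast
qed

end

text \<open>Here X^2 - X + 1 = (X - 3) (X - 5) and 2 = 3^2. The neighbours 2 u, 4 u, 6 u and (1 -
  \<lambda>) u, together with 0, u and 0 \<star> u = \<lambda> u, are all multiples of u by the
  prime field, so lines over the prime field are preserved. They say nothing when the prime field is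
  everything.\<close>

lemma characteristic_7:
  assumes seven: "(7::'a) = 0"
  shows "rigid \<or> CARD('a) = 7 \<and> {a, b} = {3, 5}"
proof -
  have n: "(9::'a) = 2" "(8::'a) = 1" "(15::'a) = 1" "(10::'a) = 3"  "(16::'a) = 2" "(12::'a) = 5" "(14::'a) = 0"
  proof -
    have "(9::'a) = 7 + 2" "(8::'a) = 7 + 1" "(15::'a) = 7 * 2 + 1" "(10::'a) = 7 + 3" "(16::'a) = 7 * 2 + 2" "(12::'a) = 7 + 5" "(14::'a) = 7 * 2" by simp_all
    then show "(9::'a) = 2" "(8::'a) = 1" "(15::'a) = 1" "(10::'a) = 3"  "(16::'a) = 2" "(12::'a) = 5" "(14::'a) = 0"
      unfolding seven by simp_all
  qed
  have "(2::'a) = 3\<^sup>2" using n by simp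
  then have two: "quad_char (2::'a) = 1" unfolding quad_char_1_iff using two_nonzero by blast
  have roots: "lam d = 3 \<or> lam d = 5" for d
  proof -
    have "(lam d - 3) * (lam d - 5) = lam d * lam d - 8 * lam d + 15" by (simp add: algebra_simps)
    also have "\<dots> = 0" unfolding n lam_sq by simp
    finally show ?thesis by simp
  qed
  have m: "(- 2 :: 'a) = 5" "(- 4 :: 'a) = 3" "(- 1 :: 'a) = 6" "(1 / 2 :: 'a) = 4"
  proof -
    have "(5::'a) = 7 - 2" "(3::'a) = 7 - 4" "(6::'a) = 7 - 1" by simp_all
    then show "(- 2 :: 'a) = 5" "(- 4 :: 'a) = 3" "(- 1 :: 'a) = 6" unfolding seven by simp_all
    show "(1 / 2 :: 'a) = 4" using two_nonzero n by (simp add: field_simps)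
  qed
  have bar: "{lam d, 1 - lam d} = {3, 5}" for d
    using roots[of d] m(1,2) by auto
  have abs: "{a, b} = {3, 5}" using bar[of 1] one_minus by (simp add: lam_def)
  define E :: "'a set" where "E = {0, 1, 2, 3, 4, 5, 6}"
  have Eof: "E = of_nat ` {..<7}"
  proof -
    have "{..<7::nat} = {0, 1, 2, 3, 4, 5, 6}" by auto
    then show ?thesis by (simp add: E_def)
  qed
  have memE: "of_nat k \<in> E" for k
  proof -
    have "(of_nat k :: 'a) = of_nat (7 * (k div 7) + k mod 7)" by simp
    also have "\<dots> = of_nat (k mod 7)" by (simp only: of_nat_add of_nat_mult of_nat_numeral seven) simp
    finally show ?thesis unfolding Eof by simp
  qed
  have E: "is_subfield E"
    unfolding is_subfield_def
  proof (intro conjI ballI)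
    show "1 \<in> E" by (simp add: E_def)
    fix x y assume "x \<in> E" "y \<in> E"
    then obtain i j where ij: "x = of_nat i" "y = of_nat j" "j < 7" unfolding Eof by auto
    have "x - y = of_nat (i + (7 - j))" using ij seven by (simp add: of_nat_diff)
    then show "x - y \<in> E" using memE by metis
    show "x * y \<in> E" using memE[of "i * j"] ij by simp
  qed
  show ?thesis
  proof (cases "E = UNIV")
    case True
    have "inj_on (of_nat :: nat \<Rightarrow> 'a) {..<7}"
    proof (rule linorder_inj_onI)
      fix x y :: nat assume xy: "x < y" "x \<in> {..<7}" "y \<in> {..<7}"
      show "of_nat x \<noteq> (of_nat y :: 'a)"
      proof
        assume "of_nat x = (of_nat y :: 'a)"
        then have z: "of_nat (y - x) = (0::'a)" using xy by (simp add: of_nat_diff)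
        have "CHAR('a) dvd 7" using seven of_nat_eq_0_iff_char_dvd[of 7, where 'a='a] by simp
        then have "CHAR('a) = 7" using primes_dvd_imp_eq[OF prime_char[where 'a='a], of 7] by simp
        then have "7 dvd y - x" using z of_nat_eq_0_iff_char_dvd[of "y - x", where 'a='a] by simp
        then show False using xy by (auto dest: dvd_imp_le)
      qed
    qed auto
    then have "card E = 7" unfolding Eof by (simp add: card_image)
    then show ?thesis using True abs by simp
  next
    case False
    have aE: "a \<in> E" using abs by (auto simp: E_def)
    have rigid
    proof (rule lines_rigid[OF ab E False aE])
      fix f x y c assume f: "f \<in> G" "f 0 = 0" and c: "c \<in> E"
      define g where "g z = f (z + x) + (- f x)" for z
      have "(\<lambda>z. f (z + x)) \<in> G" using G_comp[OF f(1) affine_in_G[of 1 x]] by simp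
      then have g: "g \<in> G" "g 0 = 0" unfolding g_def using shift_in_G by (blast, simp)
      have "\<exists>d\<in>E. g (c * u) = d * g u" for u
      proof (cases "u = 0")
        case True
        then show ?thesis using g(2) by (intro bexI[of _ 0]) (auto simp: E_def)
      next
        case u: False
        have gu: "g u \<noteq> 0" using u G_inj[OF g(1), of u 0] g(2) by simp
        have nb: "\<exists>d\<in>E. g w = d * g u" if "w \<in> pasch_nbrs u" for w
        proof -
          have "g w \<in> pasch_nbrs (g u)" by (rule pasch_nbrs_image[OF g that])
          then have "g w \<in> {2 * g u, g u / 2, - g u, (1 - lam (g u)) * g u}" unfolding pasch_nbrs_eq[OF two gu] .
          moreover have "g u / 2 = 4 * g u" "- g u = 6 * g u"
            using m(3,4) by (metis mult_1 times_divide_eq_left, metis mult_minus1)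
          moreover have "1 - lam (g u) \<in> {3, 5}" using bar[of "g u"] by blast
          ultimately show ?thesis by (auto simp: E_def)
        qed
        have eu: "u / 2 = 4 * u" "- u = 6 * u"
          using m(3,4) by (metis mult_1 times_divide_eq_left, metis mult_minus1)
        have nbu: "pasch_nbrs u = {2 * u, 4 * u, 6 * u, (1 - lam u) * u}" by (simp only: pasch_nbrs_eq[OF two u] eu)
        \<comment> \<open>The remaining residues 3 and 5 are \<lambda> and 1 - \<lambda> in some
          order.\<close>
        have "c \<in> {0, 1, 2, 4, 6, lam u, 1 - lam u}" using c bar[of u] unfolding E_def by blast
        then consider "c = 0" | "c = 1" | "c * u \<in> pasch_nbrs u" | "c = lam u" unfolding nbu by blast
        then show ?thesis
        proof cases
          case 1 then show ?thesis using g(2) by (intro bexI[of _ 0]) (auto simp: E_def)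
        next
          case 2 then show ?thesis by (intro bexI[of _ 1]) (auto simp: E_def)
        next
          case 3 then show ?thesis by (rule nb)
        next
          case 4
          have "g (lam u * u) = lam (g u) * g u" using G_op[OF g(1), of 0 u] g(2) by (simp add: zero_op)
          moreover have "lam (g u) \<in> E" using roots[of "g u"] by (auto simp: E_def)
          ultimately show ?thesis using 4 by blast
        qed
      qed
      from this[of "y - x"] obtain d where "d \<in> E" "g (c * (y - x)) = d * g (y - x)" by blast
      then show "\<exists>d\<in>E. f (x + c * (y - x)) = f x + d * (f y - f x)"
        by (intro bexI[of _ d]) (auto simp: g_def add.commute algebra_simps)
    qed
    then show ?thesis by blast
  qed
qed

end

context quad_quasigroup
begin

theorem swapping_rigid:
  assumes swap: swapping and ab: "a \<noteq> b" and not7: "\<not> (CARD('a) = 7 \<and> {a, b} = {3, 5})"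
  shows rigid
proof (cases netto)
  case True
  interpret netto_quasigroup F a b by unfold_locales (fact True, fact ab)
  show ?thesis
  proof (cases "(7::'a) = 0")
    case True
    then show ?thesis using characteristic_7 not7 by blast
  next
    case False
    have "quad_char (2::'a) = 1" using pasch_free_not_swapping swap by blast
    then show ?thesis using pasch_rigid False by blast
  qed
next
  case False
  then show ?thesis using two_transitive_cases[OF swap ab] by blast
qed

end

section \<open>Semilinear automorphisms\<close>

lemma field_auts_iff:
  "\<alpha> \<in> field_auts \<longleftrightarrow> bij \<alpha> \<and> (\<forall>x y. \<alpha> (x + y) = \<alpha> x + \<alpha> y) \<and> (\<forall>x y. \<alpha> (x * y) = \<alpha> x * \<alpha> y) \<and> \<alpha> 1 = 1"
  by (auto simp: field_auts_def ring_iso_def Ring.ring_hom_def)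

lemma field_auts_simps:
  assumes "\<alpha> \<in> field_auts"
  shows "bij \<alpha>" "\<alpha> (x + y) = \<alpha> x + \<alpha> y" "\<alpha> (x * y) = \<alpha> x * \<alpha> y" "\<alpha> 1 = 1" "\<alpha> 0 = 0"
    "\<alpha> (x - y) = \<alpha> x - \<alpha> y" "\<alpha> x = 0 \<longleftrightarrow> x = 0"
proof -
  show b: "bij \<alpha>" and add: "\<alpha> (x + y) = \<alpha> x + \<alpha> y" and "\<alpha> (x * y) = \<alpha> x * \<alpha> y" and "\<alpha> 1 = 1" for x y
    using assms by (auto simp: field_auts_iff)
  have "\<alpha> 0 = \<alpha> 0 + \<alpha> 0" using add[of 0 0] by (simp only: add_0_left)
  then show z: "\<alpha> 0 = 0" by (rule add_cancel_right_right[THEN iffD1])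
  show "\<alpha> (x - y) = \<alpha> x - \<alpha> y" using add[of "x - y" y] by simp
  show "\<alpha> x = 0 \<longleftrightarrow> x = 0" using b z by (metis bij_is_inj injD)
qed

lemma field_auts_comp: "\<alpha> \<in> field_auts \<Longrightarrow> \<beta> \<in> field_auts \<Longrightarrow> (\<lambda>x. \<alpha> (\<beta> x)) \<in> field_auts"
  using bij_comp[of \<beta> \<alpha>] by (auto simp: field_auts_iff comp_def)

lemma fixed_subfield:
  assumes "\<alpha> \<in> field_auts"
  shows "is_subfield {c. \<alpha> c = c}"
  using field_auts_simps[OF assms] by (auto simp: is_subfield_def)

lemma frobenius_aut: "(\<lambda>x::'a::{field,finite}. x ^ (CHAR('a) ^ k)) \<in> field_auts"
proof -
  let ?\<alpha> = "\<lambda>x::'a. x ^ (CHAR('a) ^ k)"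
  have p: "CHAR('a) > 0" using prime_char[where 'a='a] by (simp add: prime_gt_0_nat)
  have add: "?\<alpha> (x + y) = ?\<alpha> x + ?\<alpha> y" for x y by (rule freshmans_dream'[OF prime_char refl])
  have "inj ?\<alpha>"
  proof (rule injI)
    fix x y assume "?\<alpha> x = ?\<alpha> y"
    then have "?\<alpha> (x - y) = 0" using add[of "x - y" y] by simp
    then show "x = y" by simp
  qed
  then have "bij ?\<alpha>" by (simp add: bij_def finite_UNIV_inj_surj)
  then show ?thesis using add by (simp add: field_auts_iff power_mult_distrib)
qed

context quad_quasigroup
begin

lemma quad_char_aut:
  assumes "\<alpha> \<in> field_auts"
  shows "quad_char (\<alpha> x) = quad_char (x::'a)"
proof -
  note A = field_auts_simps[OF assms]
  have "(\<exists>y. \<alpha> x = y\<^sup>2) \<longleftrightarrow> (\<exists>y. x = y\<^sup>2)"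
  proof
    assume "\<exists>y. \<alpha> x = y\<^sup>2"
    then obtain y where "\<alpha> x = y\<^sup>2" by blast
    moreover obtain z where "y = \<alpha> z" using A(1) by (metis bij_pointE)
    ultimately have "\<alpha> x = \<alpha> (z\<^sup>2)" by (simp add: power2_eq_square A(3))
    then have "x = z\<^sup>2" using A(1) by (metis bij_is_inj injD)
    then show "\<exists>y. x = y\<^sup>2" by blast
  next
    assume "\<exists>y. x = y\<^sup>2"
    then show "\<exists>y. \<alpha> x = y\<^sup>2" by (auto simp: power2_eq_square A(3))
  qed
  then show ?thesis using A(7)[of x] by (simp add: quad_char_def)
qed

text \<open>A nonsquare l changes the class of every difference, so the field automorphism has to
  compensate by exchanging a and b.\<close>

lemma semilinear_in_G:
  assumes \<alpha>: "\<alpha> \<in> field_auts"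
    and "quad_char l = 1 \<and> \<alpha> a = a \<and> \<alpha> b = b \<or> quad_char l = - 1 \<and> \<alpha> a = b \<and> \<alpha> b = a"
  shows "(\<lambda>x. l * \<alpha> x + u) \<in> G"
proof (rule GI)
  note A = field_auts_simps[OF \<alpha>]
  have l: "l \<noteq> 0" using assms(2) by auto
  have "bij (\<lambda>x. l * x + u)"
    using l by (intro bij_betw_byWitness[where f'="\<lambda>x. (x - u) / l"]) auto
  then show "bij (\<lambda>x. l * \<alpha> x + u)" using bij_comp[OF A(1)] by (simp add: comp_def)
  fix x y
  have lam: "lam (l * \<alpha> d) = \<alpha> (lam d)" if "d \<noteq> 0" for d
  proof -
    have "quad_char (l * \<alpha> d) = quad_char l * quad_char d" by (simp add: quad_char_mult quad_char_aut[OF \<alpha>])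
    then show ?thesis using assms(2) quad_char_values[of d] that by (auto simp: lam_def)
  qed
  show "l * \<alpha> (x \<star> y) + u = (l * \<alpha> x + u) \<star> (l * \<alpha> y + u)"
  proof (cases "x = y")
    case False
    have e: "l * \<alpha> y + u - (l * \<alpha> x + u) = l * \<alpha> (y - x)" by (simp add: A(6) algebra_simps)
    have lm: "lam (l * \<alpha> (y - x)) = \<alpha> (lam (y - x))" using lam False by simp
    have e1: "\<alpha> (x \<star> y) = \<alpha> x + \<alpha> (lam (y - x)) * \<alpha> (y - x)" unfolding op_lam by (simp only: A(2,3))
    have e2: "(l * \<alpha> x + u) \<star> (l * \<alpha> y + u) = l * \<alpha> x + u + \<alpha> (lam (y - x)) * (l * \<alpha> (y - x))"
      unfolding op_lam[of "l * \<alpha> x + u"] e lm ..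
    show ?thesis unfolding e1 e2 by (simp add: distrib_left mult_ac add_ac)
  qed simp
qed

lemma aut_flips:
  assumes "a \<noteq> b" "\<not> (CARD('a) = 7 \<and> {a, b} = {3, 5})" and f: "f \<in> G"
  shows "\<exists>e. (e = 1 \<or> e = - 1) \<and> (\<forall>x y. quad_char (f x - f y) = e * quad_char (x - y))"
proof (cases swapping)
  case True
  then have rigid using swapping_rigid assms(1,2) by blast
  then show ?thesis unfolding rigid_def by (intro flips_differences[OF _ f]) blast
next
  case False
  then show ?thesis using not_swapping_preserves[OF False f] by (intro exI[of _ 1]) simp
qed

text \<open>Dividing f - f 0 by l = f 1 - f 0 cancels the sign, and Carlitz's theorem applies. The
  effect on a and b is read off from f (0 \<star> z), once for z = 1 and once for a nonsquare
  z.\<close>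

lemma aut_semilinear:
  assumes ab: "a \<noteq> b" "\<not> (CARD('a) = 7 \<and> {a, b} = {3, 5})" and f: "f \<in> G"
  obtains l u k where "f = (\<lambda>x. l * x ^ (CHAR('a) ^ k) + u)"
    "quad_char l = 1 \<and> a ^ (CHAR('a) ^ k) = a \<and> b ^ (CHAR('a) ^ k) = b \<or>
     quad_char l = - 1 \<and> a ^ (CHAR('a) ^ k) = b \<and> b ^ (CHAR('a) ^ k) = a"
proof -
  obtain e where e: "e = 1 \<or> e = - 1" "\<And>x y. quad_char (f x - f y) = e * quad_char (x - y)"
    using aut_flips[OF ab f] by blast
  define l where "l = f 1 - f 0"
  have le: "quad_char l = e" using e(2)[of 1 0] by (simp add: l_def)
  have l0: "l \<noteq> 0" using le e(1) by auto
  define g where "g x = (f x - f 0) / l" for x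
  have "(g x - g y) ^ half = (x - y) ^ half" for x y
  proof -
    have "g x - g y = (f x - f y) / l" by (simp add: g_def diff_divide_distrib)
    then have "quad_char (g x - g y) = e * quad_char (x - y) * e" using e(2)[of x y] le by (simp add: quad_char_divide)
    then have "quad_char (g x - g y) = quad_char (x - y)" using e(1) by auto
    then show ?thesis using quad_char_power[of "g x - g y"] quad_char_power[of "x - y"] by simp
  qed
  moreover have "g 0 = 0" "g 1 = 1" using l0 by (auto simp: g_def l_def)
  ultimately obtain k where k: "\<And>x. g x = x ^ (CHAR('a) ^ k)" using carlitz[OF card_half, of g] by blast
  have fx: "f x = l * x ^ (CHAR('a) ^ k) + f 0" for x using k[of x] l0 by (simp add: g_def field_simps)
  let ?\<alpha> = "\<lambda>x::'a. x ^ (CHAR('a) ^ k)"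
  note A = field_auts_simps[OF frobenius_aut[where 'a='a and k=k]]
  have al: "?\<alpha> (lam z) = lam (l * ?\<alpha> z)" if z: "z \<noteq> 0" for z
  proof -
    have "f (lam z * z) = f 0 + lam (f z - f 0) * (f z - f 0)"
      using G_op[OF f, of 0 z] by (simp only: zero_op op_lam[of "f 0"])
    moreover have "f (lam z * z) = l * (?\<alpha> (lam z) * ?\<alpha> z) + f 0"
      unfolding fx[of "lam z * z"] power_mult_distrib ..
    moreover have "f z - f 0 = l * ?\<alpha> z" using fx[of z] by simp
    ultimately have "(l * ?\<alpha> z) * ?\<alpha> (lam z) = (l * ?\<alpha> z) * lam (l * ?\<alpha> z)" by (auto simp: mult_ac add.commute)
    then show ?thesis using l0 z by simp
  qed
  have "?\<alpha> a = lam l" using al[of 1] by (simp add: lam_def)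
  moreover obtain z :: 'a where z: "quad_char z = - 1" by (rule nonsquare_exists)
  have "z \<noteq> 0" using z by auto
  then have "?\<alpha> b = lam (l * ?\<alpha> z)" using al[of z] lam_nonsquare[OF z] by simp
  moreover have "quad_char (l * ?\<alpha> z) = - e" using quad_char_aut[OF frobenius_aut, of z k] z le by (simp add: quad_char_mult)
  ultimately have "quad_char l = 1 \<and> ?\<alpha> a = a \<and> ?\<alpha> b = b \<or> quad_char l = - 1 \<and> ?\<alpha> a = b \<and> ?\<alpha> b = a"
    using e(1) le by (auto simp: lam_def)
  then show thesis using that[of l k "f 0"] fx by blast
qed

section \<open>The automorphism group in terms of the subfield K\<close>

context
  fixes K :: "'a set"
  assumes K: "K = least_subfield {a, b}"
begin

lemma K_subfield: "is_subfield K" and K_mem: "a \<in> K" "b \<in> K"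
  using least_subfield_is_subfield[of "{a, b}"] by (auto simp: K)

text \<open>The elements fixed by a field automorphism form a subfield, which contains K as soon as
  it contains a and b.\<close>

lemma Gal_iff: "\<alpha> \<in> Gal K \<longleftrightarrow> \<alpha> \<in> field_auts \<and> \<alpha> a = a \<and> \<alpha> b = b"
proof
  assume "\<alpha> \<in> field_auts \<and> \<alpha> a = a \<and> \<alpha> b = b"
  moreover from this have "K \<subseteq> {c. \<alpha> c = c}" unfolding K
    by (intro least_subfield_minimal fixed_subfield) auto
  ultimately show "\<alpha> \<in> Gal K" by (auto simp: Gal_def)
qed (use K_mem in \<open>auto simp: Gal_def\<close>)

text \<open>The intersection offers two representations of f, one with a square factor and one with
  an automorphism over K. Evaluation at 0 and 1 shows that u and l are determined by f, so the two
  can be merged.\<close>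

lemma AGamma2L1_over_iff:
  "f \<in> AGamma2L1_over K \<longleftrightarrow> (\<exists>l \<alpha> u. f = (\<lambda>x. l * \<alpha> x + u) \<and> quad_char l = 1 \<and> \<alpha> \<in> Gal K)"
proof
  assume "f \<in> AGamma2L1_over K"
  then obtain l \<alpha> u l' \<alpha>' u' where 1: "f = (\<lambda>x. l * \<alpha> x + u)" "quad_char l = 1" "\<alpha> \<in> field_auts"
    and 2: "f = (\<lambda>x. l' * \<alpha>' x + u')" "\<alpha>' \<in> Gal K"
    unfolding AGamma2L1_over_def AGamma2L1_def AGammaL1_over_def by blast
  have \<alpha>': "\<alpha>' \<in> field_auts" using 2 by (simp add: Gal_def)
  have e: "l * \<alpha> x + u = l' * \<alpha>' x + u'" for x using 1(1) 2(1) by metis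
  have "u = u'" using e[of 0] field_auts_simps(5)[OF 1(3)] field_auts_simps(5)[OF \<alpha>'] by simp
  then have "l = l'" using e[of 1] field_auts_simps(4)[OF 1(3)] field_auts_simps(4)[OF \<alpha>'] by simp
  then show "\<exists>l \<alpha> u. f = (\<lambda>x. l * \<alpha> x + u) \<and> quad_char l = 1 \<and> \<alpha> \<in> Gal K" using 1(2) 2 by blast
next
  assume "\<exists>l \<alpha> u. f = (\<lambda>x. l * \<alpha> x + u) \<and> quad_char l = 1 \<and> \<alpha> \<in> Gal K"
  then obtain l \<alpha> u where l: "f = (\<lambda>x. l * \<alpha> x + u)" "quad_char l = 1" "\<alpha> \<in> Gal K" by blast
  moreover have "\<alpha> \<in> field_auts" "l \<noteq> 0" using l by (auto simp: Gal_def)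
  ultimately show "f \<in> AGamma2L1_over K"
    unfolding AGamma2L1_over_def AGamma2L1_def AGammaL1_over_def by blast
qed

lemma AGamma2L1_over_subset: "AGamma2L1_over K \<subseteq> G"
proof
  fix f assume "f \<in> AGamma2L1_over K"
  then obtain l \<alpha> u where "f = (\<lambda>x. l * \<alpha> x + u)" "quad_char l = 1" "\<alpha> \<in> Gal K"
    unfolding AGamma2L1_over_iff by blast
  then show "f \<in> G" using semilinear_in_G[of \<alpha> l u] unfolding Gal_iff by blast
qed

text \<open>Let card K = p^n. By counting roots, no Frobenius power with exponent between 0 and n
  fixes all of K. With r = k mod n the r-th one exchanges a and b, so its square fixes K. As 0 < r <
  n, this forces n = 2 r, and \<gamma> = p^r.\<close>

lemma swap_square:
  assumes ab: "a \<noteq> b" and k: "a ^ (CHAR('a) ^ k) = b" "b ^ (CHAR('a) ^ k) = a"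
  shows "\<exists>\<gamma>::nat. \<gamma>\<^sup>2 = card K \<and> b = a ^ \<gamma>"
proof -
  let ?p = "CHAR('a)"
  let ?\<phi> = "\<lambda>i x::'a. x ^ (?p ^ i)"
  have p1: "?p > 1" by (rule prime_gt_1_nat[OF prime_char])
  obtain n where n: "n > 0" "card K = ?p ^ n" using card_prime_power[OF K_subfield] by blast
  have comp: "?\<phi> (i + j) x = ?\<phi> i (?\<phi> j x)" for i j x
    by (simp only: power_add mult.commute[of "?p ^ i"] power_mult)
  have per: "?\<phi> n x = x" if "x \<in> K" for x using power_card_subfield[OF K_subfield that] n by simp
  have per': "?\<phi> (n * t) x = x" if "x \<in> K" for t x
  proof (induction t)
    case (Suc t)
    have "?\<phi> (n * t + n) x = ?\<phi> (n * t) (?\<phi> n x)" by (rule comp)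
    then show ?case using Suc per[OF that] by (simp add: add.commute)
  qed simp
  define r where "r = k mod n"
  have red: "?\<phi> k x = ?\<phi> r x" if "x \<in> K" for x
  proof -
    have "?\<phi> (r + n * (k div n)) x = ?\<phi> r (?\<phi> (n * (k div n)) x)" by (rule comp)
    then show ?thesis using per'[OF that] by (simp add: r_def)
  qed
  have ra: "?\<phi> r a = b" "?\<phi> r b = a" using red K_mem k by auto
  have r0: "r > 0" using ra ab by (cases r) auto
  have rn: "r < n" using n by (simp add: r_def)
  have fixed: "?\<phi> (2 * r) x = x" if x: "x \<in> K" for x
  proof -
    have "?\<phi> (r + r) a = a" "?\<phi> (r + r) b = b" unfolding comp ra by (simp_all add: ra)
    then have "(\<lambda>x. ?\<phi> (2 * r) x) \<in> Gal K" unfolding Gal_iff using frobenius_aut by (simp add: mult_2)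
    then show ?thesis using x by (simp add: Gal_def)
  qed
  have bound: "n \<le> i" if "i > 0" "\<And>x. x \<in> K \<Longrightarrow> ?\<phi> i x = x" for i
  proof -
    have "?p ^ i > 1" by (rule one_less_power[OF p1 that(1)])
    then have "card K \<le> ?p ^ i" by (intro card_subfield_roots[where c=1]) (use that in auto)
    then show ?thesis using n p1 by simp
  qed
  have "n \<le> 2 * r" by (rule bound) (use r0 fixed in auto)
  moreover have "\<not> n < 2 * r"
  proof
    assume less: "n < 2 * r"
    have "?\<phi> (2 * r - n) x = x" if x: "x \<in> K" for x
    proof -
      have "?\<phi> ((2 * r - n) + n) x = ?\<phi> (2 * r - n) (?\<phi> n x)" by (rule comp)
      then show ?thesis using fixed[OF x] per[OF x] less by simp
    qed
    then have "n \<le> 2 * r - n" using less by (intro bound) auto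
    then show False using rn less by simp
  qed
  ultimately have "n = 2 * r" by simp
  then have "(?p ^ r)\<^sup>2 = card K" using n by (simp add: power_even_eq)
  then show ?thesis using ra by metis
qed

theorem generic_case:
  assumes "a \<noteq> b" "\<not> (\<exists>\<gamma>::nat. \<gamma>\<^sup>2 = card K \<and> b = a ^ \<gamma>)" "\<not> (CARD('a) = 7 \<and> {a, b} = {3, 5})"
  shows "G = AGamma2L1_over K"
proof
  show "G \<subseteq> AGamma2L1_over K"
  proof
    fix f assume "f \<in> G"
    then obtain l u k where f: "f = (\<lambda>x. l * x ^ (CHAR('a) ^ k) + u)"
      and "quad_char l = 1 \<and> a ^ (CHAR('a) ^ k) = a \<and> b ^ (CHAR('a) ^ k) = b \<or>
        quad_char l = - 1 \<and> a ^ (CHAR('a) ^ k) = b \<and> b ^ (CHAR('a) ^ k) = a"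
      using aut_semilinear[OF assms(1,3)] by blast
    then have l: "quad_char l = 1" "a ^ (CHAR('a) ^ k) = a" "b ^ (CHAR('a) ^ k) = b"
      using swap_square[OF assms(1), of k] assms(2) by blast+
    have "(\<lambda>x. x ^ (CHAR('a) ^ k)) \<in> Gal K" unfolding Gal_iff using frobenius_aut l by blast
    then show "f \<in> AGamma2L1_over K" unfolding AGamma2L1_over_iff using f l(1)
      by (intro exI[of _ l] exI[of _ "\<lambda>x. x ^ (CHAR('a) ^ k)"] exI[of _ u]) simp
  qed
qed (rule AGamma2L1_over_subset)

text \<open>As a divisor of card K, \<gamma> is a power of p, so x \<mapsto> x^\<gamma> is a field
  automorphism; it exchanges a and b. Its fixed points in K are too few for a = b, and form the
  subfield L of the twist. The exceptional order 7 cannot occur, since the order of the field is a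
  power of card K and hence a square.\<close>

theorem twisted_case:
  fixes \<gamma> :: nat
  assumes \<gamma>: "\<gamma>\<^sup>2 = card K" "b = a ^ \<gamma>"
  shows "G = AGammaL1_tw K"
proof -
  let ?p = "CHAR('a)"
  have pr: "normalization_semidom_class.prime ?p" by (rule prime_char)
  have p1: "?p > 1" by (rule prime_gt_1_nat[OF pr])
  obtain n where n: "n > 0" "card K = ?p ^ n" using card_prime_power[OF K_subfield] by blast
  have "\<gamma> dvd ?p ^ n" using \<gamma>(1) n by (metis dvd_triv_left power2_eq_square)
  then obtain j where j: "\<gamma> = ?p ^ j" using divides_primepow_nat[OF pr] by blast
  have j0: "j > 0" using \<gamma>(1) n j one_less_power[OF p1 n(1)] by (cases j) auto
  have \<gamma>1: "\<gamma> > 1" unfolding j by (rule one_less_power[OF p1 j0])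
  have \<gamma>aut: "(\<lambda>x::'a. x ^ \<gamma>) \<in> field_auts" unfolding j by (rule frobenius_aut)
  note \<gamma>s = field_auts_simps[OF \<gamma>aut]
  have fix2: "(x ^ \<gamma>) ^ \<gamma> = x" if "x \<in> K" for x
  proof -
    have "(x ^ \<gamma>) ^ \<gamma> = x ^ (\<gamma>\<^sup>2)" by (simp add: power2_eq_square power_mult)
    then show ?thesis using power_card_subfield[OF K_subfield that] \<gamma>(1) by simp
  qed
  have bg: "b ^ \<gamma> = a" unfolding \<gamma>(2) by (rule fix2[OF K_mem(1)])
  have ab: "a \<noteq> b"
  proof
    assume "a = b"
    then have "{a, b} \<subseteq> {c. c ^ \<gamma> = c}" using \<gamma>(2) by auto
    then have "K \<subseteq> {c. c ^ \<gamma> = c}" unfolding K using fixed_subfield[OF \<gamma>aut] by (rule least_subfield_minimal[rotated])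
    then have "card K \<le> \<gamma>" by (intro card_subfield_roots[where c=1]) (use \<gamma>1 in auto)
    then have "\<gamma> * \<gamma> \<le> \<gamma> * 1" using \<gamma>(1) by (simp add: power2_eq_square)
    then show False using \<gamma>1 by simp
  qed
  have not7: "\<not> (CARD('a) = 7 \<and> {a, b} = {3, 5})"
  proof
    assume A: "CARD('a) = 7 \<and> {a, b} = {3, 5}"
    have "is_subfield (UNIV :: 'a set)" by (simp add: is_subfield_def)
    then have "CARD('a) = card K ^ ext_degree UNIV K" by (intro card_subfield_power K_subfield) auto
    then have "(\<gamma> ^ ext_degree UNIV K)\<^sup>2 = 7" using A \<gamma>(1) by (metis power_commutes power_mult mult.commute)
    moreover define s where "s = \<gamma> ^ ext_degree UNIV K"
    ultimately have s7: "s * s = 7" by (simp add: power2_eq_square)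
    have "s \<le> 2 \<or> s \<ge> 3" by auto
    then show False
    proof
      assume "s \<le> 2"
      then have "s * s \<le> 2 * 2" by (rule mult_le_mono) fact
      then show False using s7 by simp
    next
      assume "s \<ge> 3"
      then have "3 * 3 \<le> s * s" by (rule mult_le_mono) fact
      then show False using s7 by simp
    qed
  qed
  define L where "L = {x\<in>K. x ^ \<gamma> = x}"
  have L: "is_subfield L" "L \<subseteq> K"
    using is_subfieldD[OF K_subfield] is_subfieldD[OF fixed_subfield[OF \<gamma>aut]]
    unfolding is_subfield_def L_def by auto
  have "card L \<le> \<gamma>" by (rule card_subfield_roots[where c=1]) (use \<gamma>1 in \<open>auto simp: L_def\<close>)
  moreover have "\<gamma> \<le> card L"
  proof -
    \<comment> \<open>The nonempty fibres of this additive map are cosets of L, and its image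
      consists of roots of y^\<gamma> = - y. Hence card K is at most \<gamma> * card L.\<close>
    define \<psi> where "\<psi> x = x ^ \<gamma> - x" for x :: 'a
    have im: "card (\<psi> ` K) \<le> \<gamma>"
    proof (rule card_subfield_roots[where c="- 1"])
      fix y assume "y \<in> \<psi> ` K"
      then obtain x where x: "x \<in> K" "y = x ^ \<gamma> - x" by (auto simp: \<psi>_def)
      then have "y ^ \<gamma> = (x ^ \<gamma>) ^ \<gamma> - x ^ \<gamma>" using \<gamma>s(6)[of "x ^ \<gamma>" x] by simp
      then show "y ^ \<gamma> = - 1 * y" using fix2[OF x(1)] x(2) by simp
    qed (rule \<gamma>1)
    have fib: "card {x\<in>K. \<psi> x = y} \<le> card L" if y: "y \<in> \<psi> ` K" for y
    proof -
      obtain x0 where x0: "x0 \<in> K" "\<psi> x0 = y" using y by auto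
      have "(\<lambda>x. x - x0) ` {x\<in>K. \<psi> x = y} \<subseteq> L"
      proof
        fix z assume "z \<in> (\<lambda>x. x - x0) ` {x\<in>K. \<psi> x = y}"
        then obtain x where x: "x \<in> K" "\<psi> x = y" "z = x - x0" by auto
        have "z ^ \<gamma> - z = \<psi> x - \<psi> x0" using \<gamma>s(6)[of x x0] x(3) by (simp add: \<psi>_def)
        then have "z ^ \<gamma> = z" using x x0 by simp
        moreover have "z \<in> K" using is_subfieldD(4)[OF K_subfield x(1) x0(1)] x(3) by simp
        ultimately show "z \<in> L" by (simp add: L_def)
      qed
      then show ?thesis by (intro card_inj_on_le[of "\<lambda>x. x - x0"]) (auto simp: inj_on_def)
    qed
    have "card K = (\<Sum>x\<in>K. 1)" by simp
    also have "\<dots> = (\<Sum>y\<in>\<psi> ` K. \<Sum>x\<in>{x\<in>K. \<psi> x = y}. 1)" by (rule sum.group[symmetric]) auto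
    also have "\<dots> \<le> (\<Sum>y\<in>\<psi> ` K. card L)" by (rule sum_mono) (use fib in auto)
    also have "\<dots> = card (\<psi> ` K) * card L" by simp
    also have "\<dots> \<le> \<gamma> * card L" using im by (rule mult_le_mono1)
    finally have "\<gamma> * \<gamma> \<le> \<gamma> * card L" using \<gamma>(1) by (simp add: power2_eq_square)
    then show ?thesis using \<gamma>1 by simp
  qed
  ultimately have cL: "card L = \<gamma>" by simp
  have "card K = card L ^ ext_degree K L" by (rule card_subfield_power[OF L(1) K_subfield L(2)])
  then have "\<gamma> ^ ext_degree K L = \<gamma> ^ 2" using cL \<gamma>(1) by simp
  then have dL: "ext_degree K L = 2" using \<gamma>1 by (metis power_inject_exp)
  show ?thesis
  proof
    show "G \<subseteq> AGammaL1_tw K"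
    proof
      fix f assume "f \<in> G"
      then obtain l u k where f: "f = (\<lambda>x. l * x ^ (?p ^ k) + u)"
        and c: "quad_char l = 1 \<and> a ^ (?p ^ k) = a \<and> b ^ (?p ^ k) = b \<or>
          quad_char l = - 1 \<and> a ^ (?p ^ k) = b \<and> b ^ (?p ^ k) = a"
        using aut_semilinear[OF ab not7] by blast
      show "f \<in> AGammaL1_tw K"
      proof (cases "quad_char l = 1")
        case True
        then have "(\<lambda>x. x ^ (?p ^ k)) \<in> Gal K" unfolding Gal_iff using frobenius_aut c by simp
        then have "f \<in> AGamma2L1_over K" unfolding AGamma2L1_over_iff using f True
          by (intro exI[of _ l] exI[of _ "\<lambda>x. x ^ (?p ^ k)"] exI[of _ u]) simp
        then show ?thesis by (simp add: AGammaL1_tw_def)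
      next
        case False
        then have l: "quad_char l = - 1" "a ^ (?p ^ k) = b" "b ^ (?p ^ k) = a" using c by auto
        obtain N where N: "N > 0" "CARD('a) = ?p ^ N"
          using card_prime_power[of "UNIV :: 'a set"] by (auto simp: is_subfield_def)
        have per: "y ^ (?p ^ (N * t)) = y" for y :: 'a and t
        proof (induction t)
          case (Suc t)
          have "y ^ (?p ^ (N * Suc t)) = (y ^ (?p ^ N)) ^ (?p ^ (N * t))" by (simp add: power_add power_mult)
          then show ?case using Suc power_card[of y] N by simp
        qed simp
        \<comment> \<open>The p^k-th power with x \<mapsto> x^\<gamma> undone: the N-th Frobenius
          power is the identity, so j (N - 1) further Frobenius steps invert the j steps of
          \<gamma>.\<close>
        define \<alpha> where "\<alpha> x = x ^ (?p ^ (k + j * (N - 1)))" for x :: 'a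
        have \<alpha>\<gamma>: "\<alpha> (x ^ \<gamma>) = x ^ (?p ^ k)" for x
        proof -
          have e: "j + (k + j * (N - 1)) = k + N * j" using N(1) by (cases N) (auto simp: mult.commute)
          have "?p ^ j * ?p ^ (k + j * (N - 1)) = ?p ^ k * ?p ^ (N * j)" by (simp only: power_add[symmetric] e)
          then have "\<alpha> (x ^ \<gamma>) = (x ^ (?p ^ k)) ^ (?p ^ (N * j))" unfolding \<alpha>_def j by (simp flip: power_mult)
          then show ?thesis using per by simp
        qed
        have "\<alpha> \<in> Gal K" unfolding Gal_iff
        proof (intro conjI)
          show "\<alpha> \<in> field_auts" unfolding \<alpha>_def by (rule frobenius_aut)
          show "\<alpha> a = a" using \<alpha>\<gamma>[of b] bg l by simp
          show "\<alpha> b = b" using \<alpha>\<gamma>[of a] \<gamma>(2) l by simp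
        qed
        moreover have "f = (\<lambda>x. l * \<alpha> (x ^ card L) + u)" unfolding f cL \<alpha>\<gamma> ..
        moreover have "subfield L F_ring" using L(1) by (simp add: subfield_F_ring_iff)
        ultimately show ?thesis unfolding AGammaL1_tw_def using l(1) L(2) dL by blast
      qed
    qed
    show "AGammaL1_tw K \<subseteq> G"
    proof
      fix f assume "f \<in> AGammaL1_tw K"
      then consider "f \<in> AGamma2L1_over K"
        | l \<alpha> u L' where "f = (\<lambda>x. l * \<alpha> (x ^ card L') + u)" "quad_char l = - 1" "\<alpha> \<in> Gal K"
          "subfield L' F_ring" "L' \<subseteq> K" "ext_degree K L' = 2"
        unfolding AGammaL1_tw_def by blast
      then show "f \<in> G"
      proof cases
        case 1
        then show ?thesis using AGamma2L1_over_subset by blast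
      next
        case 2
        have "is_subfield L'" using 2(4) by (simp add: subfield_F_ring_iff)
        then have "card K = card L' ^ 2" using card_subfield_power[OF _ K_subfield 2(5)] 2(6) by simp
        then have c: "card L' = \<gamma>" using \<gamma>(1) by (simp add: power2_eq_iff_nonneg)
        have \<alpha>: "\<alpha> \<in> field_auts" "\<alpha> a = a" "\<alpha> b = b" using 2(3) unfolding Gal_iff by auto
        have "(\<lambda>x. \<alpha> (x ^ \<gamma>)) \<in> field_auts" by (rule field_auts_comp[OF \<alpha>(1) \<gamma>aut])
        then have "(\<lambda>x. l * (\<lambda>x. \<alpha> (x ^ \<gamma>)) x + u) \<in> G"
          by (rule semilinear_in_G) (use 2(2) \<alpha> bg \<gamma>(2) in simp)
        then show ?thesis using 2(1) c by simp
      qed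
    qed
  qed
qed

text \<open>Here x \<star> y = (1 - a) x + a y. An automorphism fixing 0 commutes with
  multiplication by a and by 1 - a, which makes it additive; the scalars commuting with it then form
  a subfield containing a.\<close>

theorem equal_case:
  assumes ab: "a = b"
  shows "G = {(\<lambda>x. \<sigma> x + \<mu>) | \<sigma> \<mu>. linear_over K \<sigma> \<and> bij \<sigma>}"
proof
  have op: "x \<star> y = (1 - a) * x + a * y" for x y
  proof -
    have "lam (y - x) = a" by (metis ab lam_def)
    then show ?thesis by (simp add: op_lam algebra_simps)
  qed
  show "G \<subseteq> {(\<lambda>x. \<sigma> x + \<mu>) | \<sigma> \<mu>. linear_over K \<sigma> \<and> bij \<sigma>}"
  proof
    fix f assume f: "f \<in> G"
    define g where "g x = f x + (- f 0)" for x
    have g: "g \<in> G" unfolding g_def by (rule shift_in_G[OF f])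
    have g0: "g 0 = 0" by (simp add: g_def)
    have gop: "g ((1 - a) * x + a * y) = (1 - a) * g x + a * g y" for x y using G_op[OF g, of x y] by (simp only: op)
    have ga: "g (a * y) = a * g y" for y using gop[of 0 y] g0 by simp
    have ga1: "g ((1 - a) * x) = (1 - a) * g x" for x using gop[of x 0] g0 by simp
    have a1: "1 - a \<noteq> 0" using ab_nonzero by simp
    have add: "g (u + v) = g u + g v" for u v
    proof -
      have "(1 - a) * (u / (1 - a)) = u" "a * (v / a) = v" using a1 ab_nonzero by auto
      then show ?thesis using gop[of "u / (1 - a)" "v / a"] ga[of "v / a"] ga1[of "u / (1 - a)"] by simp
    qed
    have sub: "g (u - v) = g u - g v" for u v using add[of "u - v" v] by simp
    have "is_subfield {c. \<forall>x. g (c * x) = c * g x}"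
      unfolding is_subfield_def by (auto simp: left_diff_distrib sub mult.assoc)
    then have "K \<subseteq> {c. \<forall>x. g (c * x) = c * g x}" unfolding K
      by (rule least_subfield_minimal) (use ga ab in auto)
    then have "linear_over K g" using add by (auto simp: linear_over_def)
    moreover have "f = (\<lambda>x. g x + f 0)" by (simp add: g_def)
    ultimately show "f \<in> {(\<lambda>x. \<sigma> x + \<mu>) | \<sigma> \<mu>. linear_over K \<sigma> \<and> bij \<sigma>}" using G_bij[OF g] by blast
  qed
  show "{(\<lambda>x. \<sigma> x + \<mu>) | \<sigma> \<mu>. linear_over K \<sigma> \<and> bij \<sigma>} \<subseteq> G"
  proof safe
    fix \<sigma> :: "'a \<Rightarrow> 'a" and \<mu> :: 'a assume s: "linear_over K \<sigma>" "bij \<sigma>"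
    have "1 - a \<in> K" using is_subfieldD[OF K_subfield] K_mem by blast
    then have lin: "\<sigma> ((1 - a) * x + a * y) = (1 - a) * \<sigma> x + a * \<sigma> y" for x y
      using s(1) K_mem by (simp add: linear_over_def)
    have "\<sigma> \<in> G" by (rule GI[OF s(2)]) (simp only: op lin)
    then show "(\<lambda>x. \<sigma> x + \<mu>) \<in> G" by (rule shift_in_G)
  qed
qed

end

end

section \<open>The affine group\<close>

lemma vecs_over_iff: "v \<in> vecs_over n K \<longleftrightarrow> dim_vec v = n \<and> (\<forall>i<n. v $ i \<in> K)"
proof -
  have "set\<^sub>v v \<subseteq> K \<longleftrightarrow> (\<forall>i<dim_vec v. v $ i \<in> K)"
    unfolding vec_set_def by blast
  then show ?thesis unfolding vecs_over_def carrier_vec_def by blast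
qed

lemma mats_over_iff: "A \<in> mats_over n K \<longleftrightarrow> A \<in> carrier_mat n n \<and> (\<forall>i<n. \<forall>j<n. A $$ (i, j) \<in> K)"
proof -
  have "elements_mat A \<subseteq> K \<longleftrightarrow> (\<forall>i<n. \<forall>j<n. A $$ (i, j) \<in> K)" if "A \<in> carrier_mat n n"
    using that unfolding elements_mat_def carrier_mat_def by force
  then show ?thesis unfolding mats_over_def by blast
qed

text \<open>The isomorphism is conjugation by the coordinate map \<Psi> of a K-basis. What remains
  is the dictionary between bijective K-linear maps and matrices over K of nonzero
  determinant.\<close>

theorem affine_group_iso_AGL:
  fixes K :: "'a::{field,finite} set"
  assumes K: "is_subfield K"
  shows "BijGroup UNIV \<lparr>carrier := {(\<lambda>x. \<sigma> x + \<mu>) | \<sigma> \<mu>. linear_over K \<sigma> \<and> bij \<sigma>}\<rparr> \<cong> AGL (ext_degree UNIV K) K"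
proof -
  note Kd = is_subfieldD[OF K]
  define n where "n = ext_degree (UNIV :: 'a set) K"
  define V where "V = vecs_over n K"
  obtain Us where Us: "length Us = n"
    "bij_betw (\<lambda>Ks. \<Sum>i<length Us. Ks ! i * Us ! i) {Ks. set Ks \<subseteq> K \<and> length Ks = length Us} UNIV"
    using subfield_basis[OF K, of UNIV] by (auto simp: n_def)
  define \<Psi> where "\<Psi> v = (\<Sum>i<n. v $ i * Us ! i)" for v :: "'a vec"
  have VD: "v \<in> carrier_vec n" "\<And>i. i < n \<Longrightarrow> v $ i \<in> K" if "v \<in> V" for v :: "'a vec"
    using that by (auto simp: V_def vecs_over_iff)
  have VI: "v \<in> V" if "v \<in> carrier_vec n" "\<And>i. i < n \<Longrightarrow> v $ i \<in> K" for v :: "'a vec"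
    using that by (auto simp: V_def vecs_over_iff)
  have list_form: "\<Psi> v = (\<Sum>i<length Us. map (\<lambda>i. v $ i) [0..<n] ! i * Us ! i)" for v
    unfolding \<Psi>_def Us(1) by (rule sum.cong) auto
  have \<Psi>: "bij_betw \<Psi> V UNIV"
    unfolding bij_betw_def
  proof
    show "inj_on \<Psi> V"
    proof (rule inj_onI)
      fix v w assume vw: "v \<in> V" "w \<in> V" "\<Psi> v = \<Psi> w"
      let ?l = "\<lambda>v::'a vec. map (\<lambda>i. v $ i) [0..<n]"
      have "?l v = ?l w"
        by (rule inj_onD[OF bij_betw_imp_inj_on[OF Us(2)]]) (use vw VD list_form Us(1) in auto)
      then have "v $ i = w $ i" if "i < n" for i using that nth_map[of i "[0..<n]"] by (metis add_0 length_upt minus_nat.diff_0 nth_upt)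
      then show "v = w" using VD(1)[OF vw(1)] VD(1)[OF vw(2)] by (intro eq_vecI) auto
    qed
    show "\<Psi> ` V = UNIV"
    proof (rule UNIV_eq_I[symmetric])
      fix x
      have "x \<in> (\<lambda>Ks. \<Sum>i<length Us. Ks ! i * Us ! i) ` {Ks. set Ks \<subseteq> K \<and> length Ks = length Us}"
        using bij_betw_imp_surj_on[OF Us(2)] by simp
      then obtain Ks where Ks: "set Ks \<subseteq> K" "length Ks = n" "x = (\<Sum>i<n. Ks ! i * Us ! i)" using Us(1) by auto
      let ?v = "vec n (\<lambda>i. Ks ! i)"
      have "?v \<in> V" by (rule VI) (use Ks in auto)
      moreover have "\<Psi> ?v = x" unfolding \<Psi>_def Ks(3) by (rule sum.cong) auto
      ultimately show "x \<in> \<Psi> ` V" by blast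
    qed
  qed
  define \<Phi> where "\<Phi> = inv_into V \<Psi>"
  have \<Phi>V: "\<Phi> x \<in> V" and \<Psi>\<Phi>: "\<Psi> (\<Phi> x) = x" for x
    unfolding \<Phi>_def using bij_betw_imp_surj_on[OF \<Psi>] by (auto intro: inv_into_into f_inv_into_f)
  have \<Phi>\<Psi>: "\<Phi> (\<Psi> v) = v" if "v \<in> V" for v
    unfolding \<Phi>_def by (rule inv_into_f_f[OF bij_betw_imp_inj_on[OF \<Psi>] that])
  have \<Psi>add: "\<Psi> (v + w) = \<Psi> v + \<Psi> w" if "v \<in> V" "w \<in> V" for v w
  proof -
    have "\<Psi> (v + w) = (\<Sum>i<n. v $ i * Us ! i + w $ i * Us ! i)"
      unfolding \<Psi>_def by (rule sum.cong) (use VD(1)[OF that(1)] VD(1)[OF that(2)] in \<open>auto simp: distrib_right\<close>)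
    then show ?thesis by (simp add: \<Psi>_def sum.distrib)
  qed
  have Vadd: "v + w \<in> V" if "v \<in> V" "w \<in> V" for v w
    by (rule VI) (use VD[OF that(1)] VD[OF that(2)] Kd(6) in auto)
  have \<Psi>smult: "\<Psi> (c \<cdot>\<^sub>v v) = c * \<Psi> v" if "v \<in> V" for v c
  proof -
    have "\<Psi> (c \<cdot>\<^sub>v v) = (\<Sum>i<n. c * (v $ i * Us ! i))"
      unfolding \<Psi>_def by (rule sum.cong) (use VD(1)[OF that] in auto)
    then show ?thesis by (simp add: \<Psi>_def sum_distrib_left)
  qed
  have Vsmult: "c \<cdot>\<^sub>v v \<in> V" if "c \<in> K" "v \<in> V" for v c
    by (rule VI) (use VD[OF that(2)] Kd(5)[OF that(1)] in auto)
  have Ksum: "(\<Sum>i\<in>I. f i) \<in> K" if "\<And>i. i \<in> I \<Longrightarrow> f i \<in> K" for I :: "nat set" and f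
    using that by (induction I rule: infinite_finite_induct) (auto simp: Kd)
  have mv: "(A *\<^sub>v v) $ i = (\<Sum>j<n. A $$ (i, j) * v $ j)" if "A \<in> carrier_mat n n" "v \<in> carrier_vec n" "i < n" for A :: "'a mat" and v i
    using that by (auto simp: scalar_prod_def lessThan_atLeast0 intro!: sum.cong)
  have Vmult: "A *\<^sub>v v \<in> V" if A: "A \<in> mats_over n K" and v: "v \<in> V" for A v
  proof (rule VI)
    have Ac: "A \<in> carrier_mat n n" using A by (simp add: mats_over_iff)
    show "A *\<^sub>v v \<in> carrier_vec n" by (rule mult_mat_vec_carrier[OF Ac VD(1)[OF v]])
    fix i assume i: "i < n"
    show "(A *\<^sub>v v) $ i \<in> K" unfolding mv[OF Ac VD(1)[OF v] i]
      by (rule Ksum) (use A VD(2)[OF v] i Kd(5) in \<open>auto simp: mats_over_iff\<close>)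
  qed
  have lin_sum: "\<sigma> (\<Sum>i\<in>I. f i) = (\<Sum>i\<in>I. \<sigma> (f i))" if "linear_over K \<sigma>" for \<sigma> and I :: "nat set" and f
  proof -
    have add: "\<sigma> (x + y) = \<sigma> x + \<sigma> y" for x y using that by (simp add: linear_over_def)
    have "\<sigma> 0 = \<sigma> 0 + \<sigma> 0" using add[of 0 0] by (simp only: add_0_left)
    then have "\<sigma> 0 = 0" by (rule add_cancel_right_right[THEN iffD1])
    then show ?thesis by (induction I rule: infinite_finite_induct) (auto simp: add)
  qed
  have repr: "\<exists>A\<in>mats_over n K. \<forall>v\<in>V. \<Psi> (A *\<^sub>v v) = \<sigma> (\<Psi> v)" if \<sigma>: "linear_over K \<sigma>" for \<sigma>
  proof -
    \<comment> \<open>Column j holds the coordinates of the image of the j-th basis element.\<close>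
    define A where "A = mat n n (\<lambda>(i, j). \<Phi> (\<sigma> (Us ! j)) $ i)"
    have A: "A \<in> mats_over n K" using VD(2)[OF \<Phi>V] by (auto simp: mats_over_iff A_def)
    have Ac: "A \<in> carrier_mat n n" by (simp add: A_def)
    have "\<Psi> (A *\<^sub>v v) = \<sigma> (\<Psi> v)" if v: "v \<in> V" for v
    proof -
      have "\<sigma> (\<Psi> v) = (\<Sum>j<n. v $ j * \<sigma> (Us ! j))"
        unfolding \<Psi>_def lin_sum[OF \<sigma>]
        by (rule sum.cong) (use \<sigma> VD(2)[OF v] in \<open>auto simp: linear_over_def\<close>)
      also have "\<dots> = (\<Sum>j<n. v $ j * (\<Sum>i<n. A $$ (i, j) * Us ! i))"
      proof (rule sum.cong[OF refl])
        fix j assume j: "j \<in> {..<n}"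
        have "\<sigma> (Us ! j) = \<Psi> (\<Phi> (\<sigma> (Us ! j)))" by (simp add: \<Psi>\<Phi>)
        also have "\<dots> = (\<Sum>i<n. A $$ (i, j) * Us ! i)" unfolding \<Psi>_def
          by (rule sum.cong) (use j in \<open>auto simp: A_def\<close>)
        finally show "v $ j * \<sigma> (Us ! j) = v $ j * (\<Sum>i<n. A $$ (i, j) * Us ! i)" by simp
      qed
      also have "\<dots> = (\<Sum>j<n. \<Sum>i<n. A $$ (i, j) * v $ j * Us ! i)"
        by (simp add: sum_distrib_left mult_ac)
      also have "\<dots> = (\<Sum>i<n. \<Sum>j<n. A $$ (i, j) * v $ j * Us ! i)" by (rule sum.swap)
      also have "\<dots> = (\<Sum>i<n. (A *\<^sub>v v) $ i * Us ! i)"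
        by (rule sum.cong) (use mv[OF Ac VD(1)[OF v]] in \<open>auto simp: sum_distrib_right\<close>)
      finally show ?thesis by (simp add: \<Psi>_def)
    qed
    then show ?thesis using A by blast
  qed
  have unitV: "unit_vec n j \<in> V" if "j < n" for j
    by (rule VI) (use that Kd in \<open>auto simp: unit_vec_def\<close>)
  have repr_det: "\<exists>A\<in>mats_over n K. det A \<noteq> 0 \<and> (\<forall>v\<in>V. \<Psi> (A *\<^sub>v v) = \<sigma> (\<Psi> v))"
    if \<sigma>: "linear_over K \<sigma>" "bij \<sigma>" for \<sigma>
  proof -
    \<comment> \<open>The inverse map is K-linear too, and its matrix B satisfies A * B = 1, which
      makes det A nonzero.\<close>
    define \<tau> where "\<tau> = inv_into UNIV \<sigma>"
    have st: "\<sigma> (\<tau> x) = x" "\<tau> (\<sigma> x) = x" for x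
      using \<sigma>(2) by (auto simp: \<tau>_def bij_is_inj bij_is_surj surj_f_inv_f)
    have "linear_over K \<tau>" unfolding linear_over_def
    proof safe
      fix x y
      have "\<sigma> (\<tau> x + \<tau> y) = x + y" using \<sigma>(1) by (simp add: linear_over_def st)
      then show "\<tau> (x + y) = \<tau> x + \<tau> y" using st(2) by metis
    next
      fix c x assume "c \<in> K"
      then have "\<sigma> (c * \<tau> x) = c * x" using \<sigma>(1) by (simp add: linear_over_def st)
      then show "\<tau> (c * x) = c * \<tau> x" using st(2) by metis
    qed
    from repr[OF \<sigma>(1)] repr[OF this] obtain A B where A: "A \<in> mats_over n K" "\<And>v. v \<in> V \<Longrightarrow> \<Psi> (A *\<^sub>v v) = \<sigma> (\<Psi> v)"
      and B: "B \<in> mats_over n K" "\<And>v. v \<in> V \<Longrightarrow> \<Psi> (B *\<^sub>v v) = \<tau> (\<Psi> v)" by blast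
    have Ac: "A \<in> carrier_mat n n" and Bc: "B \<in> carrier_mat n n" using A B by (auto simp: mats_over_iff)
    have AB: "(A * B) *\<^sub>v v = v" if v: "v \<in> V" for v
    proof -
      have "\<Psi> (A *\<^sub>v (B *\<^sub>v v)) = \<Psi> v" using A(2)[OF Vmult[OF B(1) v]] B(2)[OF v] st by simp
      then have "A *\<^sub>v (B *\<^sub>v v) = v" using \<Phi>\<Psi>[OF Vmult[OF A(1) Vmult[OF B(1) v]]] \<Phi>\<Psi>[OF v] by simp
      then show ?thesis using assoc_mult_mat_vec[OF Ac Bc VD(1)[OF v]] by simp
    qed
    have "A * B = 1\<^sub>m n"
    proof (rule eq_matI)
      fix i j assume ij: "i < dim_row (1\<^sub>m n :: 'a mat)" "j < dim_col (1\<^sub>m n :: 'a mat)"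
      then have ij': "i < n" "j < n" by auto
      have ABc: "A * B \<in> carrier_mat n n" using Ac Bc by simp
      have "((A * B) *\<^sub>v unit_vec n j) $ i = (\<Sum>k<n. (A * B) $$ (i, k) * unit_vec n j $ k)"
        by (rule mv[OF ABc _ ij'(1)]) simp
      also have "\<dots> = (\<Sum>k<n. if k = j then (A * B) $$ (i, j) else 0)"
        by (rule sum.cong) (use ij' in \<open>auto simp: unit_vec_def\<close>)
      also have "\<dots> = (A * B) $$ (i, j)" using ij' by simp
      finally show "(A * B) $$ (i, j) = 1\<^sub>m n $$ (i, j)" using AB[OF unitV[OF ij'(2)]] ij' by (auto simp: unit_vec_def)
    qed (use Ac Bc in auto)
    then have "det A * det B = 1" using det_mult[OF Ac Bc] by simp
    then have "det A \<noteq> 0" by auto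
    then show ?thesis using A by blast
  qed
  let ?H = "BijGroup UNIV \<lparr>carrier := {(\<lambda>x. \<sigma> x + \<mu>) | \<sigma> \<mu>. linear_over K \<sigma> \<and> bij \<sigma>}\<rparr>"
  define T :: "('a \<Rightarrow> 'a) set" where "T = {(\<lambda>x. \<sigma> x + \<mu>) | \<sigma> \<mu>. linear_over K \<sigma> \<and> bij \<sigma>}"
  \<comment> \<open>The restriction to V matters: elements of \<open>BijGroup V\<close> are
    extensional functions, with a fixed value outside V.\<close>
  define h where "h f = (\<lambda>v\<in>V. \<Phi> (f (\<Psi> v)))" for f
  have bijT: "bij f" if "f \<in> T" for f
  proof -
    obtain \<sigma> \<mu> where f: "f = (\<lambda>x. \<sigma> x + \<mu>)" "bij \<sigma>" using \<open>f \<in> T\<close> by (auto simp: T_def)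
    have "bij (\<lambda>x. x + \<mu>)" by (intro bij_betw_byWitness[where f'="\<lambda>x. x - \<mu>"]) auto
    then show ?thesis using bij_comp[OF f(2)] f(1) by (simp add: comp_def)
  qed
  have hcarrier: "h ` T = carrier (AGL n K)"
  proof
    show "h ` T \<subseteq> carrier (AGL n K)"
    proof safe
      fix f assume "f \<in> T"
      then obtain \<sigma> \<mu> where f: "f = (\<lambda>x. \<sigma> x + \<mu>)" "linear_over K \<sigma>" "bij \<sigma>" by (auto simp: T_def)
      obtain A where A: "A \<in> mats_over n K" "det A \<noteq> 0" "\<And>v. v \<in> V \<Longrightarrow> \<Psi> (A *\<^sub>v v) = \<sigma> (\<Psi> v)"
        using repr_det[OF f(2,3)] by blast
      have "h f = (\<lambda>v\<in>V. A *\<^sub>v v + \<Phi> \<mu>)"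
        unfolding h_def
      proof (rule restrict_ext)
        fix v assume v: "v \<in> V"
        have "f (\<Psi> v) = \<Psi> (A *\<^sub>v v + \<Phi> \<mu>)" using \<Psi>add[OF Vmult[OF A(1) v] \<Phi>V] A(3)[OF v] by (simp add: f(1) \<Psi>\<Phi>)
        then show "\<Phi> (f (\<Psi> v)) = A *\<^sub>v v + \<Phi> \<mu>" using \<Phi>\<Psi>[OF Vadd[OF Vmult[OF A(1) v] \<Phi>V]] by simp
      qed
      moreover have "\<Phi> \<mu> \<in> vecs_over n K" using \<Phi>V by (simp add: V_def)
      ultimately show "h f \<in> carrier (AGL n K)" unfolding AGL_def V_def using A(1,2) by auto
    qed
    show "carrier (AGL n K) \<subseteq> h ` T"
    proof
      fix F assume "F \<in> carrier (AGL n K)"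
      then obtain A w where F: "F = (\<lambda>x\<in>V. A *\<^sub>v x + w)" and A: "A \<in> mats_over n K" "det A \<noteq> 0" and w: "w \<in> V"
        unfolding AGL_def V_def by auto
      have Ac: "A \<in> carrier_mat n n" using A by (simp add: mats_over_iff)
      define \<sigma> where "\<sigma> x = \<Psi> (A *\<^sub>v \<Phi> x)" for x
      have \<Phi>add: "\<Phi> (x + y) = \<Phi> x + \<Phi> y" for x y
        using \<Phi>\<Psi>[OF Vadd[OF \<Phi>V[of x] \<Phi>V[of y]]] \<Psi>add[OF \<Phi>V[of x] \<Phi>V[of y]] by (simp add: \<Psi>\<Phi>)
      have \<Phi>smult: "\<Phi> (c * x) = c \<cdot>\<^sub>v \<Phi> x" if "c \<in> K" for c x
        using \<Phi>\<Psi>[OF Vsmult[OF that \<Phi>V[of x]]] \<Psi>smult[OF \<Phi>V[of x], of c] by (simp add: \<Psi>\<Phi>)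
      have "linear_over K \<sigma>" unfolding linear_over_def
      proof safe
        fix x y
        show "\<sigma> (x + y) = \<sigma> x + \<sigma> y" unfolding \<sigma>_def \<Phi>add
          using mult_add_distrib_mat_vec[OF Ac VD(1)[OF \<Phi>V] VD(1)[OF \<Phi>V]] \<Psi>add[OF Vmult[OF A(1) \<Phi>V] Vmult[OF A(1) \<Phi>V]] by simp
      next
        fix c x assume c: "c \<in> K"
        show "\<sigma> (c * x) = c * \<sigma> x" unfolding \<sigma>_def \<Phi>smult[OF c]
          using mult_mat_vec[OF Ac VD(1)[OF \<Phi>V]] \<Psi>smult[OF Vmult[OF A(1) \<Phi>V]] by simp
      qed
      moreover have "bij \<sigma>"
      proof -
        have "inj \<sigma>"
        proof (rule injI)
          fix x y assume "\<sigma> x = \<sigma> y"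
          then have "\<Phi> (\<Psi> (A *\<^sub>v \<Phi> x)) = \<Phi> (\<Psi> (A *\<^sub>v \<Phi> y))" unfolding \<sigma>_def by (rule arg_cong)
          then have eq: "A *\<^sub>v \<Phi> x = A *\<^sub>v \<Phi> y" by (simp only: \<Phi>\<Psi>[OF Vmult[OF A(1) \<Phi>V]])
          have cv: "\<Phi> x \<in> carrier_vec n" "\<Phi> y \<in> carrier_vec n" using VD(1)[OF \<Phi>V] by auto
          have "A *\<^sub>v (\<Phi> x - \<Phi> y) = A *\<^sub>v \<Phi> x - A *\<^sub>v \<Phi> y" by (rule mult_minus_distrib_mat_vec[OF Ac cv])
          also have "\<dots> = 0\<^sub>v n" unfolding eq by (rule minus_cancel_vec[OF mult_mat_vec_carrier[OF Ac cv(2)]])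
          finally have "\<Phi> x - \<Phi> y = 0\<^sub>v n" using det_0_iff_vec_prod_zero_field[OF Ac] A(2) cv by (metis minus_carrier_vec)
          then have "\<Phi> x = \<Phi> y" using cv by (metis (no_types, lifting) carrier_vecD eq_vecI index_minus_vec(1) index_zero_vec(1) right_minus_eq)
          then show "x = y" using \<Psi>\<Phi> by metis
        qed
        then show ?thesis by (simp add: bij_def finite_UNIV_inj_surj)
      qed
      ultimately have "(\<lambda>x. \<sigma> x + \<Psi> w) \<in> T" by (auto simp: T_def)
      moreover have "h (\<lambda>x. \<sigma> x + \<Psi> w) = F" unfolding h_def F
      proof (rule restrict_ext)
        fix v assume v: "v \<in> V"
        have "\<sigma> (\<Psi> v) + \<Psi> w = \<Psi> (A *\<^sub>v v + w)" unfolding \<sigma>_def \<Phi>\<Psi>[OF v] using \<Psi>add[OF Vmult[OF A(1) v] w] by simp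
        then show "\<Phi> (\<sigma> (\<Psi> v) + \<Psi> w) = A *\<^sub>v v + w" using \<Phi>\<Psi>[OF Vadd[OF Vmult[OF A(1) v] w]] by simp
      qed
      ultimately show "F \<in> h ` T" by blast
    qed
  qed
  have hinj: "inj_on h T"
  proof (rule inj_onI, rule ext)
    fix f g x assume "h f = h g"
    then have "h f (\<Phi> x) = h g (\<Phi> x)" by simp
    then have "\<Phi> (f x) = \<Phi> (g x)" using \<Phi>V[of x] by (simp add: h_def \<Psi>\<Phi>)
    then show "f x = g x" using \<Psi>\<Phi> by metis
  qed
  have hBij: "h f \<in> Bij V" if f: "f \<in> T" for f
  proof -
    have inj: "inj_on (h f) V"
    proof (rule inj_onI)
      fix v w assume vw: "v \<in> V" "w \<in> V" "h f v = h f w"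
      then have "\<Phi> (f (\<Psi> v)) = \<Phi> (f (\<Psi> w))" by (simp add: h_def)
      then have "f (\<Psi> v) = f (\<Psi> w)" using \<Psi>\<Phi> by metis
      then have "\<Psi> v = \<Psi> w" using bijT[OF f] by (auto simp: bij_def inj_def)
      then show "v = w" using \<Phi>\<Psi> vw by metis
    qed
    have "finite V" using bij_betw_finite[OF \<Psi>] by simp
    moreover have "h f ` V \<subseteq> V" using \<Phi>V by (auto simp: h_def)
    ultimately have "h f ` V = V" using inj by (intro endo_inj_surj) auto
    then show ?thesis using inj by (auto simp: Bij_def bij_betw_def h_def)
  qed
  have "h \<in> iso ?H (AGL n K)"
  proof (rule isoI)
    have TBij: "f \<in> Bij UNIV" if "f \<in> T" for f using bijT[OF that] by (simp add: Bij_def)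
    show "h \<in> hom ?H (AGL n K)"
    proof (rule homI)
      fix f assume "f \<in> carrier ?H"
      then show "h f \<in> carrier (AGL n K)" using hcarrier by (auto simp: T_def)
    next
      fix f g assume "f \<in> carrier ?H" "g \<in> carrier ?H"
      then have fg: "f \<in> T" "g \<in> T" by (auto simp: T_def)
      have m1: "f \<otimes>\<^bsub>?H\<^esub> g = (\<lambda>x. f (g x))" using TBij fg by (simp add: BijGroup_def compose_def restrict_def)
      have m2: "h f \<otimes>\<^bsub>AGL n K\<^esub> h g = compose V (h f) (h g)"
        using hBij fg by (simp add: AGL_def BijGroup_def V_def)
      show "h (f \<otimes>\<^bsub>?H\<^esub> g) = h f \<otimes>\<^bsub>AGL n K\<^esub> h g"
        unfolding m1 m2 using \<Phi>V by (auto simp: h_def compose_def \<Psi>\<Phi> intro!: restrict_ext)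
    qed
    show "bij_betw h (carrier ?H) (carrier (AGL n K))"
      using hinj hcarrier by (simp add: bij_betw_def T_def)
  qed
  then show ?thesis unfolding n_def is_iso_def by blast
qed

section \<open>The field with seven elements\<close>

lemma magma_auts_iso:
  assumes h: "bij h" and hm: "\<And>x y. h (m x y) = m' (h x) (h y)"
  shows "magma_aut_group m \<cong> magma_aut_group m'"
proof -
  define k where "k = inv_into UNIV h"
  have hk: "h (k x) = x" and kh: "k (h y) = y" for x y
    using h by (auto simp: k_def bij_is_inj bij_is_surj surj_f_inv_f)
  have km: "k (m' x y) = m (k x) (k y)" for x y
    using hm[of "k x" "k y"] kh[of "m (k x) (k y)"] by (simp add: hk)
  have k: "bij k" unfolding k_def using h by (rule bij_imp_bij_inv)
  have conj1: "(\<lambda>x. h (f (k x))) \<in> magma_auts m'" if "f \<in> magma_auts m" for f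
  proof -
    have "bij (h \<circ> (f \<circ> k))" using that h k by (intro bij_comp) (auto simp: magma_auts_def)
    then show ?thesis using that by (simp add: magma_auts_def km hm comp_def)
  qed
  have conj2: "(\<lambda>x. k (f (h x))) \<in> magma_auts m" if "f \<in> magma_auts m'" for f
  proof -
    have "bij (k \<circ> (f \<circ> h))" using that h k by (intro bij_comp) (auto simp: magma_auts_def)
    then show ?thesis using that by (simp add: magma_auts_def km hm comp_def)
  qed
  let ?c = "\<lambda>f x. h (f (k x))"
  have "?c \<in> iso (magma_aut_group m) (magma_aut_group m')"
  proof (rule isoI)
    show "?c \<in> hom (magma_aut_group m) (magma_aut_group m')"
    proof (rule homI)
      fix f assume "f \<in> carrier (magma_aut_group m)"
      then show "?c f \<in> carrier (magma_aut_group m')" using conj1 by (simp add: magma_aut_group_def)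
    next
      fix f g assume "f \<in> carrier (magma_aut_group m)" "g \<in> carrier (magma_aut_group m)"
      then have fg: "f \<in> magma_auts m" "g \<in> magma_auts m" by (simp_all add: magma_aut_group_def)
      have B: "f' \<in> Bij UNIV" if "f' \<in> magma_auts m''" for f' and m'' :: "'c \<Rightarrow> 'c \<Rightarrow> 'c"
        using that by (simp add: magma_auts_def Bij_def)
      show "?c (f \<otimes>\<^bsub>magma_aut_group m\<^esub> g) = ?c f \<otimes>\<^bsub>magma_aut_group m'\<^esub> ?c g"
        using B[OF fg(1)] B[OF fg(2)] B[OF conj1[OF fg(1)]] B[OF conj1[OF fg(2)]]
        by (simp add: magma_aut_group_def BijGroup_def compose_def restrict_def kh)
    qed
    show "bij_betw ?c (carrier (magma_aut_group m)) (carrier (magma_aut_group m'))"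
      by (rule bij_betw_byWitness[where f' = "\<lambda>f x. k (f (h x))"])
        (use conj1 conj2 in \<open>auto simp: magma_aut_group_def hk kh\<close>)
  qed
  then show ?thesis unfolding is_iso_def by blast
qed

section \<open>Two-by-two matrices and the group SL_2\<close>

lemma mat_2_eqI:
  assumes "A \<in> carrier_mat 2 2" "B \<in> carrier_mat 2 2"
    and "A $$ (0, 0) = B $$ (0, 0)" "A $$ (0, 1) = B $$ (0, 1)"
    and "A $$ (1, 0) = B $$ (1, 0)" "A $$ (1, 1) = B $$ (1, 1)"
  shows "A = B"
proof (rule eq_matI)
  fix i j assume "i < dim_row B" "j < dim_col B"
  then have "i = 0 \<or> i = 1" "j = 0 \<or> j = 1" using assms(2) by auto
  then show "A $$ (i, j) = B $$ (i, j)" using assms by blast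
qed (use assms in auto)

lemma mult_mat_2:
  fixes A B :: "'a::comm_ring_1 mat"
  assumes "A \<in> carrier_mat 2 2" "B \<in> carrier_mat 2 2" "i < 2" "j < 2"
  shows "(A * B) $$ (i, j) = A $$ (i, 0) * B $$ (0, j) + A $$ (i, 1) * B $$ (1, j)"
  using assms by (simp add: scalar_prod_def numeral_2_eq_2)

lemma det_mat_2:
  fixes A :: "'a::comm_ring_1 mat"
  assumes A: "A \<in> carrier_mat 2 2"
  shows "det A = A $$ (0, 0) * A $$ (1, 1) - A $$ (0, 1) * A $$ (1, 0)"
proof -
  have d: "det (mat_delete A i 0) = A $$ (1 - i, 1)" if "i < 2" for i
  proof -
    have "mat_delete A i 0 \<in> carrier_mat 1 1" using A by (auto simp: mat_delete_def)
    then have "det (mat_delete A i 0) = mat_delete A i 0 $$ (0, 0)" by (rule det_single)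
    also have "\<dots> = A $$ (1 - i, 1)" using A that by (auto simp: mat_delete_def)
    finally show ?thesis .
  qed
  have "det A = (\<Sum>i<2. A $$ (i, 0) * cofactor A i 0)" by (rule laplace_expansion_column[OF A]) simp
  also have "\<dots> = A $$ (0, 0) * cofactor A 0 0 + A $$ (1, 0) * cofactor A 1 0"
    by (simp add: numeral_2_eq_2)
  finally show ?thesis using d[of 0] d[of 1] by (simp add: cofactor_def)
qed

definition mat_2 :: "'a \<Rightarrow> 'a \<Rightarrow> 'a \<Rightarrow> 'a \<Rightarrow> 'a mat" where
  "mat_2 p q r s = mat 2 2 (\<lambda>(i, j). if i = 0 then if j = 0 then p else q else if j = 0 then r else s)"

lemma mat_2_simps [simp]:
  "mat_2 p q r s \<in> carrier_mat 2 2"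
  "mat_2 p q r s $$ (0, 0) = p" "mat_2 p q r s $$ (0, Suc 0) = q"
  "mat_2 p q r s $$ (Suc 0, 0) = r" "mat_2 p q r s $$ (Suc 0, Suc 0) = s"
  by (auto simp: mat_2_def)

lemma SL_2_iff:
  "A \<in> carrier (SL 2 UNIV) \<longleftrightarrow>
    A \<in> carrier_mat 2 2 \<and> A $$ (0, 0) * A $$ (1, 1) - A $$ (0, 1) * A $$ (1, 0) = 1"
  using det_mat_2[of A] by (auto simp: SL_def mats_over_def)

lemma group_SL_2: "group (SL 2 (UNIV :: 'a::field set))"
proof (rule groupI)
  have one: "\<one>\<^bsub>SL 2 (UNIV :: 'a set)\<^esub> = 1\<^sub>m 2" by (simp add: SL_def)
  have mul: "A \<otimes>\<^bsub>SL 2 (UNIV :: 'a set)\<^esub> B = A * B" for A B by (simp add: SL_def)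
  show "\<one>\<^bsub>SL 2 (UNIV :: 'a set)\<^esub> \<in> carrier (SL 2 UNIV)" by (simp add: SL_def mats_over_def)
  fix A B C :: "'a mat"
  assume A: "A \<in> carrier (SL 2 UNIV)" and B: "B \<in> carrier (SL 2 UNIV)"
  have Ac: "A \<in> carrier_mat 2 2" "det A = 1" and Bc: "B \<in> carrier_mat 2 2" "det B = 1"
    using A B by (simp_all add: SL_def mats_over_def)
  show "A \<otimes>\<^bsub>SL 2 UNIV\<^esub> B \<in> carrier (SL 2 UNIV)"
    using Ac Bc det_mult[OF Ac(1) Bc(1)] by (simp add: SL_def mats_over_def)
  {
    assume "C \<in> carrier (SL 2 UNIV)"
    then have "C \<in> carrier_mat 2 2" by (simp add: SL_def mats_over_def)
    then show "A \<otimes>\<^bsub>SL 2 UNIV\<^esub> B \<otimes>\<^bsub>SL 2 UNIV\<^esub> C = A \<otimes>\<^bsub>SL 2 UNIV\<^esub> (B \<otimes>\<^bsub>SL 2 UNIV\<^esub> C)"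
      unfolding mul using Ac(1) Bc(1) by (intro assoc_mult_mat)
  }
  show "\<one>\<^bsub>SL 2 UNIV\<^esub> \<otimes>\<^bsub>SL 2 UNIV\<^esub> A = A"
    unfolding mul one using Ac(1) by simp
  \<comment> \<open>The adjugate of A, which inverts it since the determinant is 1.\<close>
  let ?B = "mat_2 (A $$ (1, 1)) (- A $$ (0, 1)) (- A $$ (1, 0)) (A $$ (0, 0))"
  have "?B \<in> carrier (SL 2 UNIV)" using A by (simp add: SL_2_iff algebra_simps)
  moreover have "?B * A = 1\<^sub>m 2"
    by (rule mat_2_eqI) (use A Ac in \<open>auto simp: mult_mat_2 SL_2_iff algebra_simps intro!: mult_carrier_mat\<close>)
  ultimately show "\<exists>B\<in>carrier (SL 2 UNIV). B \<otimes>\<^bsub>SL 2 UNIV\<^esub> A = \<one>\<^bsub>SL 2 UNIV\<^esub>"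
    unfolding mul one by blast
qed

lemma group_magma_aut_group: "group (magma_aut_group m)"
proof -
  have "subgroup (magma_auts m) (BijGroup UNIV)"
  proof (rule group.subgroupI[OF group_BijGroup])
    show "magma_auts m \<subseteq> carrier (BijGroup UNIV)"
      by (auto simp: BijGroup_def Bij_def magma_auts_def)
    show "magma_auts m \<noteq> {}" using bij_id by (force simp: magma_auts_def)
    fix f assume f: "f \<in> magma_auts m"
    then have fB: "f \<in> Bij UNIV" "bij f" by (auto simp: Bij_def magma_auts_def)
    have i: "inv\<^bsub>BijGroup UNIV\<^esub> f = inv_into UNIV f"
      using inv_BijGroup[OF fB(1)] by (simp add: restrict_def)
    have ff: "f (inv_into UNIV f x) = x" "inv_into UNIV f (f x) = x" for x
      using fB(2) by (auto simp: bij_is_inj bij_is_surj surj_f_inv_f)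
    have "inv_into UNIV f (m x y) = m (inv_into UNIV f x) (inv_into UNIV f y)" for x y
      using f ff unfolding magma_auts_def by (metis (mono_tags, lifting) mem_Collect_eq)
    then show "inv\<^bsub>BijGroup UNIV\<^esub> f \<in> magma_auts m"
      unfolding i using bij_imp_bij_inv[OF fB(2)] by (simp add: magma_auts_def)
    fix g assume g: "g \<in> magma_auts m"
    then have gB: "g \<in> Bij UNIV" "bij g" by (auto simp: Bij_def magma_auts_def)
    have "f \<otimes>\<^bsub>BijGroup UNIV\<^esub> g = (\<lambda>x. f (g x))" using fB gB by (simp add: BijGroup_def compose_def restrict_def)
    then show "f \<otimes>\<^bsub>BijGroup UNIV\<^esub> g \<in> magma_auts m"
      using f g bij_comp[OF gB(2) fB(2)] by (simp add: magma_auts_def comp_def)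
  qed
  then show ?thesis unfolding magma_aut_group_def
    by (rule subgroup.subgroup_is_group) (rule group_BijGroup)
qed

text \<open>Integer models of the operations of the field with seven elements, on which identities are
  decided by computation.\<close>

definition chi7 :: "int \<Rightarrow> int" where
  "chi7 i = (if i mod 7 = 0 then 0 else if i mod 7 = 1 \<or> i mod 7 = 2 \<or> i mod 7 = 4 then 1 else - 1)"

definition mult7 :: "int \<Rightarrow> int \<Rightarrow> int" where
  "mult7 i j = (if chi7 (j - i) \<ge> 0 then i + 3 * (j - i) else i + 5 * (j - i)) mod 7"

text \<open>The fifth power stands for the inverse, as i^6 = 1 for residues prime to 7; it sends 0
  to 0.\<close>

definition rho7 :: "int \<Rightarrow> int" where
  "rho7 i = mult7 0 (- (i ^ 5))"

text \<open>In this order, the residue versions of \<open>rho_op\<close>, \<open>rho_rho\<close>,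
  \<open>rho_scale\<close> and \<open>rho_shift\<close>, and the list of squares behind
  \<open>quad_char_7\<close>.\<close>

lemma checks7:
  "\<forall>i\<in>set [0..6]. \<forall>j\<in>set [0..6]. rho7 (mult7 i j) mod 7 = mult7 (rho7 i) (rho7 j) mod 7"
  "\<forall>i\<in>set [0..6]. rho7 (rho7 i) mod 7 = i mod 7"
  "\<forall>i\<in>set [0..6]. \<forall>j\<in>set [0..6]. i mod 7 \<noteq> 0 \<longrightarrow> rho7 (i\<^sup>2 * j) mod 7 = ((i ^ 5)\<^sup>2 * rho7 j) mod 7"
  "\<forall>i\<in>set [0..6]. \<forall>j\<in>set [0..6]. i mod 7 \<noteq> 0 \<longrightarrow>
     rho7 (i + rho7 j) mod 7 = (- (i ^ 5) + (i ^ 5)\<^sup>2 * rho7 (j - i ^ 5)) mod 7"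
  "\<forall>i\<in>set [0..6]. i mod 7 = 0 \<or> i mod 7 = 1 \<or> i mod 7 = 2 \<or> i mod 7 = 4 \<longleftrightarrow> (\<exists>j\<in>set [0..6]. i mod 7 = j\<^sup>2 mod 7)"
  by code_simp+

section \<open>The quasigroup on seven points and its group\<close>

locale field_7 =
  fixes F :: "'a::{field,finite} itself"
  assumes card_7: "CARD('a) = 7"
begin

lemma char_7: "CHAR('a) = 7"
proof -
  obtain n where n: "n > 0" "CARD('a) = CHAR('a) ^ n"
    using card_prime_power[of "UNIV::'a set"] by (auto simp: is_subfield_def)
  have "CHAR('a) dvd 7" using n card_7 dvd_power[of n "CHAR('a)"] by simp
  moreover have "normalization_semidom_class.prime (7::nat)" by simp
  ultimately show ?thesis using prime_char[where 'a='a] primes_dvd_imp_eq by blast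
qed

lemma of_int_eq_7: "(of_int i = (of_int j :: 'a)) \<longleftrightarrow> i mod 7 = j mod 7"
  unfolding of_int_eq_iff_cong_CHAR char_7 cong_def by simp

lemma of_int_mod_7: "of_int (i mod 7) = (of_int i :: 'a)"
  by (simp add: of_int_eq_7)

lemma ex_int_7: "\<exists>i\<in>set [0..6]. x = (of_int i :: 'a)"
proof -
  have "inj_on (of_int :: int \<Rightarrow> 'a) {0..6}" by (auto simp: inj_on_def of_int_eq_7)
  then have "card ((of_int :: int \<Rightarrow> 'a) ` {0..6}) = CARD('a)" by (simp add: card_image card_7)
  then have "(of_int :: int \<Rightarrow> 'a) ` {0..6} = UNIV" by (intro card_subset_eq) auto
  then show ?thesis by (metis UNIV_I image_iff set_upto)
qed

lemma elements_7: "x = (0::'a) \<or> x = 1 \<or> x = 2 \<or> x = 3 \<or> x = 4 \<or> x = 5 \<or> x = 6"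
proof -
  obtain i :: int where i: "x = of_int i" "0 \<le> i" "i \<le> 6" using ex_int_7[of x] by auto
  then have "i = 0 \<or> i = 1 \<or> i = 2 \<or> i = 3 \<or> i = 4 \<or> i = 5 \<or> i = 6" by presburger
  then show ?thesis unfolding i(1) by (elim disjE) simp_all
qed

lemma inverse_7: "inverse (x::'a) = x ^ 5"
proof (cases "x = 0")
  case False
  then have "x ^ 6 = 1" using power_card_minus_1[of x] card_7 by simp
  then have "x * x ^ 5 = 1" by (simp add: numeral_eq_Suc)
  then show ?thesis by (rule inverse_unique)
qed simp

lemma quad_char_7: "quad_char (of_int i :: 'a) = chi7 i"
proof -
  have sq: "(\<exists>y. (of_int i :: 'a) = y\<^sup>2) \<longleftrightarrow> (\<exists>j\<in>set [0..6]. i mod 7 = j\<^sup>2 mod 7)"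
  proof -
    have "of_int i = (of_int j :: 'a)\<^sup>2 \<longleftrightarrow> i mod 7 = j\<^sup>2 mod 7" for j
      using of_int_eq_7[of i "j\<^sup>2"] by simp
    then show ?thesis using ex_int_7 by metis
  qed
  have z: "(of_int i :: 'a) = 0 \<longleftrightarrow> i mod 7 = 0" using of_int_eq_7[of i 0] by simp
  have m: "i mod 7 \<in> set [0..6]" by simp
  have "i mod 7 = 0 \<or> i mod 7 = 1 \<or> i mod 7 = 2 \<or> i mod 7 = 4 \<longleftrightarrow> (\<exists>j\<in>set [0..6]. i mod 7 = j\<^sup>2 mod 7)"
    using bspec[OF checks7(5) m] by (simp only: mod_mod_trivial)
  then have *: "(\<exists>y. (of_int i :: 'a) = y\<^sup>2) \<longleftrightarrow> i mod 7 = 0 \<or> i mod 7 = 1 \<or> i mod 7 = 2 \<or> i mod 7 = 4"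
    unfolding sq by (rule sym)
  show ?thesis
    by (cases "i mod 7 = 0") (simp_all only: quad_char_def chi7_def z * if_True if_False simp_thms)
qed

abbreviation op7 :: "'a \<Rightarrow> 'a \<Rightarrow> 'a" (infixl "\<diamondop>" 70) where
  "x \<diamondop> y \<equiv> quad_mult 3 5 x y"

lemma op7_of_int: "of_int i \<diamondop> of_int j = (of_int (mult7 i j) :: 'a)"
proof -
  have "of_int j - of_int i = (of_int (j - i) :: 'a)" by simp
  then show ?thesis
    unfolding quad_mult_def mult7_def of_int_mod_7 by (simp only: quad_char_7) simp
qed

sublocale quad_quasigroup F 3 5
proof
  have q: "quad_char (3::'a) = - 1" "quad_char (5::'a) = - 1" "quad_char (1 - 3 :: 'a) = - 1" "quad_char (1 - 5 :: 'a) = - 1"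
    using quad_char_7[of 3] quad_char_7[of 5] quad_char_7[of "- 2"] quad_char_7[of "- 4"] by (simp_all add: chi7_def)
  show "odd CARD('a)" by (simp add: card_7)
  show "quad_params (3::'a) 5"
    unfolding quad_params_def q by simp
qed

text \<open>The action of the Moebius transformation x \<mapsto> - 1 / x, whose value at \<infinity>
  is 0. The convention \<open>inverse 0 = 0\<close> gives the right value at 0: there the
  transformation takes the value \<infinity>, which is neutral and leaves 0.\<close>

definition rho :: "'a \<Rightarrow> 'a" where "rho x = 0 \<diamondop> (- inverse x)"

lemma rho_of_int: "rho (of_int i) = of_int (rho7 i)"
  unfolding rho_def rho7_def inverse_7 using op7_of_int[of 0 "- (i ^ 5)"] by simp

lemma rho_values: "rho 0 = 0" "rho 1 = 2" "rho 2 = 1" "rho 3 = 6" "rho 4 = 4" "rho 5 = 5" "rho 6 = 3"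
proof -
  have "rho7 0 = 0" "rho7 1 = 2" "rho7 2 = 1" "rho7 3 = 6" "rho7 4 = 4" "rho7 5 = 5" "rho7 6 = 3" by code_simp+
  then show "rho 0 = 0" "rho 1 = 2" "rho 2 = 1" "rho 3 = 6" "rho 4 = 4" "rho 5 = 5" "rho 6 = 3"
    using rho_of_int[of 0] rho_of_int[of 1] rho_of_int[of 2] rho_of_int[of 3] rho_of_int[of 4] rho_of_int[of 5] rho_of_int[of 6]
    by simp_all
qed

lemma rho_rho: "rho (rho x) = x"
proof -
  obtain i where i: "i \<in> set [0..6]" "x = of_int i" using ex_int_7 by blast
  show ?thesis unfolding i(2) rho_of_int of_int_eq_7 using bspec[OF checks7(2) i(1)] .
qed

lemma rho_op: "rho (x \<diamondop> y) = rho x \<diamondop> rho y"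
proof -
  obtain i where i: "i \<in> set [0..6]" "x = of_int i" using ex_int_7 by blast
  obtain j where j: "j \<in> set [0..6]" "y = of_int j" using ex_int_7 by blast
  show ?thesis unfolding i(2) j(2) rho_of_int op7_of_int of_int_eq_7
    using bspec[OF bspec[OF checks7(1) i(1)] j(1)] .
qed

lemma rho_scale: "s \<noteq> 0 \<Longrightarrow> rho (s\<^sup>2 * y) = rho y / s\<^sup>2"
proof -
  assume "s \<noteq> 0"
  obtain i where i: "i \<in> set [0..6]" "s = of_int i" using ex_int_7 by blast
  obtain j where j: "j \<in> set [0..6]" "y = of_int j" using ex_int_7 by blast
  have "i mod 7 \<noteq> 0" using \<open>s \<noteq> 0\<close> of_int_eq_7[of i 0] i(2) by simp
  then have "rho7 (i\<^sup>2 * j) mod 7 = ((i ^ 5)\<^sup>2 * rho7 j) mod 7" using bspec[OF bspec[OF checks7(3) i(1)] j(1)] by blast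
  then have "of_int (rho7 (i\<^sup>2 * j)) = (of_int ((i ^ 5)\<^sup>2 * rho7 j) :: 'a)" unfolding of_int_eq_7 .
  moreover have "rho (s\<^sup>2 * y) = of_int (rho7 (i\<^sup>2 * j))"
    unfolding i(2) j(2) using rho_of_int[of "i\<^sup>2 * j"] by simp
  ultimately have "rho (s\<^sup>2 * y) = (s ^ 5)\<^sup>2 * rho y" unfolding i(2) j(2) rho_of_int by simp
  then show ?thesis unfolding inverse_7[symmetric] by (simp add: divide_inverse power_inverse mult.commute)
qed

text \<open>The relation of SL_2 that rewrites inversion, translation by u, inversion as a product
  of translations, a square factor and one inversion.\<close>

lemma rho_shift: "u \<noteq> 0 \<Longrightarrow> rho (u + rho x) = - (1 / u) + rho (x - 1 / u) / u\<^sup>2"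
proof -
  assume "u \<noteq> 0"
  obtain i where i: "i \<in> set [0..6]" "u = of_int i" using ex_int_7 by blast
  obtain j where j: "j \<in> set [0..6]" "x = of_int j" using ex_int_7 by blast
  have "i mod 7 \<noteq> 0" using \<open>u \<noteq> 0\<close> of_int_eq_7[of i 0] i(2) by simp
  then have "rho7 (i + rho7 j) mod 7 = (- (i ^ 5) + (i ^ 5)\<^sup>2 * rho7 (j - i ^ 5)) mod 7"
    using bspec[OF bspec[OF checks7(4) i(1)] j(1)] by blast
  then have "of_int (rho7 (i + rho7 j)) = (of_int (- (i ^ 5) + (i ^ 5)\<^sup>2 * rho7 (j - i ^ 5)) :: 'a)"
    unfolding of_int_eq_7 .
  moreover have "rho (u + rho x) = of_int (rho7 (i + rho7 j))"
    unfolding i(2) j(2) using rho_of_int[of "i + rho7 j"] rho_of_int[of j] by simp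
  moreover have "(of_int (rho7 (j - i ^ 5)) :: 'a) = rho (x - u ^ 5)"
    unfolding i(2) j(2) using rho_of_int[of "j - i ^ 5"] by simp
  ultimately have "rho (u + rho x) = - (u ^ 5) + (u ^ 5)\<^sup>2 * rho (x - u ^ 5)"
    unfolding i(2) j(2) rho_of_int by simp
  then show ?thesis unfolding inverse_7[symmetric] by (simp add: divide_inverse power_inverse mult.commute)
qed

lemma rho_in_G: "rho \<in> G"
  by (rule GI) (auto intro!: bij_betw_byWitness[where f' = rho] simp: rho_rho rho_op)

text \<open>Adding a neutral element \<open>\<infinity>\<close> to the Steiner quasigroup \<open>quad_mult 3 5\<close> gives an elementary abelian
  group, on which \<open>\<infinity>\<close> and the field elements form a projective line. A Moebius transformation \<open>g\<close> acts on the
  quasigroup by \<open>x \<mapsto> g x \<diamondop> g \<infinity>\<close>; this is the map \<open>act p q r s\<close> for \<open>g x = (p * x + q) / (r * x + s)\<close>.\<close>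

definition act :: "'a \<Rightarrow> 'a \<Rightarrow> 'a \<Rightarrow> 'a \<Rightarrow> 'a \<Rightarrow> 'a" where
  "act p q r s x = (if r = 0 then p\<^sup>2 * x + p * q else p / r + rho (r\<^sup>2 * x + r * s))"

text \<open>The cases distinguish how many inversions occur. A square factor passes through one by
  \<open>rho_scale\<close>; two of them cancel by \<open>rho_rho\<close> or merge into one by
  \<open>rho_shift\<close>. The rest is arithmetic with the determinants.\<close>

lemma act_comp:
  assumes d: "p * s - q * r = 1" and d': "p' * s' - q' * r' = 1"
  shows "act p q r s (act p' q' r' s' x) =
    act (p * p' + q * r') (p * q' + q * s') (r * p' + s * r') (r * q' + s * s') x"
proof -
  consider "r = 0" "r' = 0" | "r = 0" "r' \<noteq> 0" | "r \<noteq> 0" "r' = 0" | "r \<noteq> 0" "r' \<noteq> 0" by blast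
  then show ?thesis
  proof cases
    case 1
    then have ps: "p' * s' = 1" using d' by simp
    have "p * p' * (p * q' + q * s') = p\<^sup>2 * (p' * q') + p * q * (p' * s')"
      by (simp add: algebra_simps power2_eq_square)
    then show ?thesis using 1 ps by (simp add: act_def algebra_simps power2_eq_square)
  next
    case 2
    then have ps: "p * s = 1" using d by simp
    then have s: "s \<noteq> 0" by auto
    then have p: "p = 1 / s" using ps by (simp add: field_simps)
    define Y where "Y = r'\<^sup>2 * x + r' * s'"
    have Y: "(s * r')\<^sup>2 * x + s * r' * (s * s') = s\<^sup>2 * Y"
      by (simp add: Y_def algebra_simps power2_eq_square)
    have "act p q r s (act p' q' r' s' x) = p\<^sup>2 * (p' / r' + rho Y) + p * q"
      using 2 by (simp add: act_def Y_def)
    also have "\<dots> = (p * p' + q * r') / (s * r') + rho Y / s\<^sup>2"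
      unfolding p using s 2 by (simp add: field_simps power2_eq_square)
    also have "\<dots> = (p * p' + q * r') / (s * r') + rho (s\<^sup>2 * Y)" unfolding rho_scale[OF s] ..
    finally show ?thesis using 2 s Y by (simp add: act_def)
  next
    case 3
    then have ps: "p' * s' = 1" using d' by simp
    then have p': "p' \<noteq> 0" by auto
    have "(r * p')\<^sup>2 * x + r * p' * (r * q' + s * s') = r\<^sup>2 * (p'\<^sup>2 * x + p' * q') + r * s * (p' * s')"
      by (simp add: algebra_simps power2_eq_square)
    then show ?thesis using 3 p' ps by (simp add: act_def)
  next
    case 4
    define P Q R S where "P = p * p' + q * r'" and "Q = p * q' + q * s'"
      and "R = r * p' + s * r'" and "S = r * q' + s * s'"
    have e1: "r * P = p * R - r'"
    proof -
      have "p * R - r * P = (p * s - q * r) * r'" by (simp add: P_def R_def algebra_simps)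
      then show ?thesis unfolding d by (simp add: algebra_simps)
    qed
    have e2: "r * Q = p * S - s'"
    proof -
      have "p * S - r * Q = (p * s - q * r) * s'" by (simp add: Q_def S_def algebra_simps)
      then show ?thesis unfolding d by (simp add: algebra_simps)
    qed
    have e3: "R * s' - r = r' * S"
    proof -
      have "R * s' - r' * S = r * (p' * s' - q' * r')" by (simp add: S_def R_def algebra_simps)
      then show ?thesis unfolding d' by (simp add: algebra_simps)
    qed
    have e4: "P * S - Q * R = 1"
    proof -
      have "P * S - Q * R = (p * s - q * r) * (p' * s' - q' * r')"
        by (simp add: P_def Q_def R_def S_def algebra_simps)
      then show ?thesis unfolding d d' by simp
    qed
    define Y where "Y = r'\<^sup>2 * x + r' * s'"
    \<comment> \<open>The shift between the two inversions. It vanishes exactly when R does, that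
      is, when the product matrix is upper triangular; then the inversions cancel.\<close>
    define v where "v = r * R / r'"
    have v: "r\<^sup>2 * (p' / r' + rho Y) + r * s = v + r\<^sup>2 * rho Y"
      using 4 by (simp add: v_def R_def field_simps power2_eq_square)
    have rY: "r\<^sup>2 * rho Y = rho (Y / r\<^sup>2)"
      using rho_scale[OF 4(1), of "Y / r\<^sup>2"] 4 by (simp add: field_simps)
    have lhs: "act p q r s (act p' q' r' s' x) = p / r + rho (v + rho (Y / r\<^sup>2))"
      using 4 v rY by (simp add: act_def Y_def)
    show ?thesis
    proof (cases "R = 0")
      case True
      have P: "P = - r' / r" using e1 True 4 by (simp add: field_simps)
      have PS: "P * S = 1" using e4 True by simp
      have "r * (P * Q) = P * (p * S - s')" using e2 by (simp add: mult.left_commute)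
      also have "\<dots> = p * (P * S) - P * s'" by (simp add: algebra_simps)
      finally have PQ: "P * Q = (p - P * s') / r" unfolding PS using 4 by (simp add: field_simps)
      have "P\<^sup>2 * x + P * Q = p / r + Y / r\<^sup>2"
        unfolding PQ unfolding P Y_def using 4 by (simp add: field_simps power2_eq_square)
      then show ?thesis using lhs True
        by (simp add: act_def v_def rho_rho P_def[symmetric] Q_def[symmetric] R_def[symmetric])
    next
      case False
      then have v0: "v \<noteq> 0" using 4 by (simp add: v_def)
      have a: "p / r - 1 / v = P / R"
      proof -
        have "p / r - 1 / v = (p * R - r') / (r * R)" unfolding v_def using 4 False by (simp add: field_simps)
        also have "\<dots> = P / R" unfolding e1[symmetric] using 4 by simp
        finally show ?thesis .
      qed
      have b: "v\<^sup>2 * (Y / r\<^sup>2 - 1 / v) = R\<^sup>2 * x + R * S"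
      proof -
        have c1: "v\<^sup>2 * (Y / r\<^sup>2 - 1 / v) = v\<^sup>2 * Y / r\<^sup>2 - v"
          using v0 by (simp add: field_simps power2_eq_square)
        have c2: "v\<^sup>2 * Y / r\<^sup>2 = R\<^sup>2 * x + R\<^sup>2 * s' / r'"
          unfolding v_def Y_def using 4 by (simp add: field_simps power2_eq_square)
        have "v\<^sup>2 * (Y / r\<^sup>2 - 1 / v) = R\<^sup>2 * x + R * (R * s' - r) / r'"
          unfolding c1 c2 unfolding v_def using 4 by (simp add: field_simps power2_eq_square)
        then show ?thesis unfolding e3 using 4 by simp
      qed
      have "act p q r s (act p' q' r' s' x) = (p / r - 1 / v) + rho (Y / r\<^sup>2 - 1 / v) / v\<^sup>2"
        unfolding lhs rho_shift[OF v0] by simp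
      also have "\<dots> = P / R + rho (R\<^sup>2 * x + R * S)"
        unfolding a b[symmetric] rho_scale[OF v0] ..
      finally show ?thesis using False
        by (simp add: act_def P_def[symmetric] Q_def[symmetric] R_def[symmetric] S_def[symmetric])
    qed
  qed
qed

lemma act_in_G:
  assumes d: "p * s - q * r = 1"
  shows "act p q r s \<in> G"
proof (cases "r = 0")
  case True
  then have "p \<noteq> 0" using d by auto
  then have "(\<lambda>x. p\<^sup>2 * x + p * q) \<in> G" by (intro affine_in_G) (auto simp: quad_char_1_iff)
  then show ?thesis using True by (simp add: act_def[abs_def])
next
  case False
  then have "(\<lambda>x. r\<^sup>2 * x + r * s) \<in> G" by (intro affine_in_G) (auto simp: quad_char_1_iff)
  from shift_in_G[OF G_comp[OF rho_in_G this], of "p / r"] show ?thesis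
    using False by (simp add: act_def[abs_def] add.commute)
qed

text \<open>For r \<noteq> 0 the identity would make \<open>rho\<close> affine, but it sends 0, 1, 2
  to 0, 2, 1, which is not an arithmetic progression modulo 7.\<close>

lemma act_id:
  assumes d: "p * s - q * r = 1" and id: "\<And>x. act p q r s x = x"
  shows "r = 0" "q = 0" "s = p" "p\<^sup>2 = 1"
proof -
  show r: "r = 0"
  proof (rule ccontr)
    assume r: "r \<noteq> 0"
    have lin: "rho y = (y - r * s) / r\<^sup>2 - p / r" for y
      using id[of "(y - r * s) / r\<^sup>2"] r by (simp add: act_def field_simps)
    have "rho 2 - rho 1 = rho 1 - rho 0" unfolding lin using r by (simp add: field_simps)
    then have "of_int (- 1) = (of_int 2 :: 'a)" unfolding rho_values by simp
    then show False unfolding of_int_eq_7 by simp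
  qed
  have pq: "p * q = 0" and pp: "p\<^sup>2 + p * q = 1" using id[of 0] id[of 1] r by (simp_all add: act_def)
  show p2: "p\<^sup>2 = 1" using pp unfolding pq by simp
  then have "p \<noteq> 0" by auto
  then show "q = 0" using pq by simp
  have "p * s = p * p" using d r p2 by (simp add: power2_eq_square)
  then show "s = p" using \<open>p \<noteq> 0\<close> by simp
qed

definition S7 :: "('a \<Rightarrow> 'a) set" where
  "S7 = {act p q r s | p q r s. p * s - q * r = 1}"

lemma S7_I: "p * s - q * r = 1 \<Longrightarrow> f = act p q r s \<Longrightarrow> f \<in> S7"
  unfolding S7_def by blast

lemma S7_comp: "f \<in> S7 \<Longrightarrow> g \<in> S7 \<Longrightarrow> (\<lambda>x. f (g x)) \<in> S7"
proof -
  assume "f \<in> S7" "g \<in> S7"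
  then obtain p q r s p' q' r' s' where
    f: "p * s - q * r = 1" "f = act p q r s" and g: "p' * s' - q' * r' = 1" "g = act p' q' r' s'"
    unfolding S7_def by blast
  show ?thesis
  proof (rule S7_I)
    have "(p * p' + q * r') * (r * q' + s * s') - (p * q' + q * s') * (r * p' + s * r')
      = (p * s - q * r) * (p' * s' - q' * r')" by (simp add: algebra_simps)
    then show "(p * p' + q * r') * (r * q' + s * s') - (p * q' + q * s') * (r * p' + s * r') = 1"
      unfolding f g by simp
  qed (use act_comp[OF f(1) g(1)] in \<open>simp add: f(2) g(2) fun_eq_iff\<close>)
qed

lemma S7_cancel: "g \<in> S7 \<Longrightarrow> (\<lambda>x. g (f x)) \<in> S7 \<Longrightarrow> f \<in> S7"
proof -
  assume g: "g \<in> S7" and gf: "(\<lambda>x. g (f x)) \<in> S7"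
  obtain p q r s where g': "p * s - q * r = 1" "g = act p q r s" using g unfolding S7_def by blast
  have d: "s * p - (- q) * (- r) = 1" using g'(1) by (simp add: algebra_simps)
  have "act s (- q) (- r) p \<in> S7" by (rule S7_I[OF d refl])
  from S7_comp[OF this gf] have "(\<lambda>x. act s (- q) (- r) p (g (f x))) \<in> S7" .
  moreover have "act s (- q) (- r) p (g y) = y" for y
  proof -
    have "s * p + (- q) * r = 1" "s * q + (- q) * s = 0" "(- r) * p + p * r = 0" "(- r) * q + p * s = 1"
      using g'(1) by (simp_all add: algebra_simps)
    then show ?thesis unfolding g'(2) act_comp[OF d g'(1)] by (simp add: act_def)
  qed
  ultimately show ?thesis by simp
qed

lemma affine_in_S7: "quad_char l = 1 \<Longrightarrow> (\<lambda>x. l * x + u) \<in> S7"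
proof -
  assume "quad_char l = 1"
  then obtain t where t: "l = t\<^sup>2" "t \<noteq> 0" unfolding quad_char_1_iff by auto
  \<comment> \<open>The matrix with rows t, u / t and 0, 1 / t.\<close>
  show ?thesis by (rule S7_I[of t "1 / t" "u / t" 0]) (use t in \<open>auto simp: act_def fun_eq_iff\<close>)
qed

text \<open>The matrix with rows 0, - 1 and 1, 0.\<close>

lemma rho_in_S7: "rho \<in> S7"
  by (rule S7_I[of 0 0 "- 1" 1]) (auto simp: act_def fun_eq_iff)

lemma op7_values: "0 \<diamondop> 1 = (3::'a)" "0 \<diamondop> 2 = (6::'a)" "1 \<diamondop> 2 = (4::'a)" "0 \<diamondop> 4 = (5::'a)"
proof -
  have "mult7 0 1 = 3" "mult7 0 2 = 6" "mult7 1 2 = 4" "mult7 0 4 = 5" by code_simp+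
  then show "0 \<diamondop> 1 = (3::'a)" "0 \<diamondop> 2 = (6::'a)" "1 \<diamondop> 2 = (4::'a)" "0 \<diamondop> 4 = (5::'a)"
    using op7_of_int[of 0 1] op7_of_int[of 0 2] op7_of_int[of 1 2] op7_of_int[of 0 4] by simp_all
qed

lemma G_fixes_012:
  assumes f: "f \<in> G" "f 0 = 0" "f 1 = 1" "f 2 = 2"
  shows "f x = x"
proof -
  have "f 3 = 3" using G_op[OF f(1), of 0 1] unfolding f op7_values by simp
  moreover have "f 6 = 6" using G_op[OF f(1), of 0 2] unfolding f op7_values by simp
  moreover have 4: "f 4 = 4" using G_op[OF f(1), of 1 2] unfolding f op7_values by simp
  moreover have "f 5 = 5" using G_op[OF f(1), of 0 4] unfolding f 4 op7_values by simp
  ultimately show ?thesis using elements_7[of x] f by metis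
qed

text \<open>With 0 and 1 also 0 \<star> 1 = 3 is fixed, so 2 can only go to 2, 4, 5 or 6. For each
  of these an element of \<open>S7\<close> fixing 0 and 1 brings the image back to 2, and
  \<open>G_fixes_012\<close> identifies the composite as the identity.\<close>

lemma G_fixes_01:
  assumes f: "f \<in> G" "f 0 = 0" "f 1 = 1"
  shows "f \<in> S7"
proof -
  have f3: "f 3 = 3" using G_op[OF f(1), of 0 1] unfolding f op7_values by simp
  have ne: "(2::'a) \<noteq> 0" "(2::'a) \<noteq> 1" "(2::'a) \<noteq> 3"
    using of_int_eq_7[of 2 0] of_int_eq_7[of 2 1] of_int_eq_7[of 2 3] by simp_all
  have f2: "f 2 = 2 \<or> f 2 = 4 \<or> f 2 = 5 \<or> f 2 = 6"
    using elements_7[of "f 2"] ne f f3 G_inj[OF f(1)] by metis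
  have n: "(7::'a) = 0" "(8::'a) = 1" "(10::'a) = 3" "(12::'a) = 5" "(16::'a) = 2" "(20::'a) = 6"
    "(24::'a) = 3" "(9::'a) = 2" "(11::'a) = 4" "(13::'a) = 6" "(23::'a) = 2" "(19::'a) = 5" "(27::'a) = 6" "(15::'a) = 1"
    using of_int_eq_7[of 7 0] of_int_eq_7[of 8 1] of_int_eq_7[of 10 3] of_int_eq_7[of 12 5] of_int_eq_7[of 16 2] of_int_eq_7[of 20 6]
      of_int_eq_7[of 24 3] of_int_eq_7[of 9 2] of_int_eq_7[of 11 4] of_int_eq_7[of 13 6] of_int_eq_7[of 23 2] of_int_eq_7[of 19 5] of_int_eq_7[of 27 6] of_int_eq_7[of 15 1]
    by simp_all
  have q: "quad_char (2::'a) = 1" "quad_char (4::'a) = 1"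
    using quad_char_7[of 2] quad_char_7[of 4] by (simp_all add: chi7_def)
  \<comment> \<open>As \<open>rho\<close> fixes 0, 4 and 5, its conjugate g1 under doubling fixes 0,
    1 and 3. The map x \<mapsto> 2 x + 1, with inverse 4 x + 3, permutes 0, 1, 3 cyclically, so its
    conjugates g2 and g3 of g1 fix these points as well.\<close>
  define g1 where "g1 x = 2 * rho (4 * x + 0) + 0" for x
  define g2 where "g2 x = 2 * g1 (4 * x + 3) + 1" for x
  define g3 where "g3 x = 2 * g2 (4 * x + 3) + 1" for x
  have g: "g1 \<in> S7" "g2 \<in> S7" "g3 \<in> S7"
  proof -
    show g1: "g1 \<in> S7" unfolding g1_def[abs_def]
      using S7_comp[OF affine_in_S7[OF q(1), of 0] S7_comp[OF rho_in_S7 affine_in_S7[OF q(2), of 0]]] .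
    show g2: "g2 \<in> S7" unfolding g2_def[abs_def]
      using S7_comp[OF affine_in_S7[OF q(1), of 1] S7_comp[OF g1 affine_in_S7[OF q(2), of 3]]] .
    show "g3 \<in> S7" unfolding g3_def[abs_def]
      using S7_comp[OF affine_in_S7[OF q(1), of 1] S7_comp[OF g2 affine_in_S7[OF q(2), of 3]]] .
  qed
  have v1: "g1 0 = 0" "g1 1 = 1" "g1 2 = 4" "g1 3 = 3" "g1 4 = 2" "g1 5 = 6" "g1 6 = 5"
    by (simp_all add: g1_def rho_values n)
  have v2: "g2 0 = 0" "g2 1 = 1" "g2 2 = 5" "g2 3 = 3" "g2 4 = 6" "g2 5 = 2" "g2 6 = 4"
    by (simp_all add: g2_def v1 n)
  have v3: "g3 0 = 0" "g3 1 = 1" "g3 6 = 2"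
    by (simp_all add: g3_def v2 n)
  have S_sub_G: "g \<in> G" if "g \<in> S7" for g using that act_in_G unfolding S7_def by blast
  have fin: "f \<in> S7" if g: "g \<in> S7" "g 0 = 0" "g 1 = 1" "g (f 2) = 2" for g
  proof -
    have "(\<lambda>x. g (f x)) = (\<lambda>x. x)"
      using G_fixes_012[OF G_comp[OF S_sub_G[OF g(1)] f(1)]] g f by (simp add: fun_eq_iff)
    moreover have "(\<lambda>x. x) \<in> S7" using affine_in_S7[of 1 0] by simp
    ultimately show ?thesis using S7_cancel[OF g(1), of f] by simp
  qed
  have id: "(\<lambda>x. x) \<in> S7" using affine_in_S7[of 1 0] by simp
  from f2 show ?thesis
  proof (elim disjE)
    assume "f 2 = 2" then show ?thesis by (intro fin[OF id]) simp_all
  next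
    assume "f 2 = 4" then show ?thesis by (intro fin[OF g(1)]) (simp_all add: v1)
  next
    assume "f 2 = 5" then show ?thesis by (intro fin[OF g(2)]) (simp_all add: v2)
  next
    assume "f 2 = 6" then show ?thesis by (intro fin[OF g(3)]) (simp_all add: v3)
  qed
qed

text \<open>Elements of \<open>S7\<close> normalise an arbitrary automorphism until it fixes 0 and
  1: a translation first, then a square factor, or \<kappa> if the value at 1 is a
  nonsquare.\<close>

lemma G_eq_S7: "G = S7"
proof
  show S_sub_G: "S7 \<subseteq> G" using act_in_G unfolding S7_def by blast
  show "G \<subseteq> S7"
  proof
    fix f assume f: "f \<in> G"
    have nb: "quad_char (1::'a) = 1" by simp
    have T: "(\<lambda>x. x + u) \<in> S7" for u using affine_in_S7[OF nb, of u] by simp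
    have f0: "f \<in> S7" if f: "f \<in> G" "f 0 = 0" for f
    proof -
      define c where "c = f 1"
      have c: "c \<noteq> 0" using G_inj[OF f(1), of 1 0] f(2) by (simp add: c_def)
      show ?thesis
      proof (cases "quad_char c = 1")
        case True
        then have D: "(\<lambda>x. inverse c * x + 0) \<in> S7" by (intro affine_in_S7) (simp add: quad_char_inverse)
        have "(\<lambda>x. inverse c * f x + 0) \<in> S7"
          using G_comp[OF subsetD[OF S_sub_G D] f(1)] f(2) c by (intro G_fixes_01) (simp_all add: c_def[symmetric])
        then show ?thesis using S7_cancel[OF D, of f] by simp
      next
        case False
        then have nc: "quad_char c = - 1" using c quad_char_values[of c] by blast
        have n5: "quad_char (5::'a) = - 1" using quad_char_7[of 5] by (simp add: chi7_def)
        \<comment> \<open>The point c passes through 5, 6 and 3 to 1, while 0 passes through 0, 1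
          and 2 back to 0.\<close>
        define \<kappa> where "\<kappa> x = rho (1 * (5 / c * x + 0) + 1) + (- 2)" for x
        have D: "(\<lambda>x. 5 / c * x + 0) \<in> S7" by (intro affine_in_S7) (simp add: quad_char_divide nc n5)
        have \<kappa>: "\<kappa> \<in> S7" unfolding \<kappa>_def[abs_def]
          using S7_comp[OF T S7_comp[OF rho_in_S7 S7_comp[OF affine_in_S7[OF nb, of 1] D]]] .
        have "\<kappa> 0 = 0" by (simp add: \<kappa>_def rho_values)
        moreover have "\<kappa> c = 1" using c by (simp add: \<kappa>_def rho_values)
        ultimately have "(\<lambda>x. \<kappa> (f x)) \<in> S7"
          using G_comp[OF subsetD[OF S_sub_G \<kappa>] f(1)] f(2) by (intro G_fixes_01) (simp_all add: c_def[symmetric])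
        then show ?thesis by (rule S7_cancel[OF \<kappa>])
      qed
    qed
    have "(\<lambda>x. f x + (- f 0)) \<in> S7" using shift_in_G[OF f, of "- f 0"] by (intro f0) simp_all
    then show "f \<in> S7" by (rule S7_cancel[OF T])
  qed
qed

text \<open>The action of SL_2 is onto by \<open>G_eq_S7\<close>. Its kernel consists of scalar
  matrices by \<open>act_id\<close>, and these are the centre.\<close>

lemma aut_group_iso_PSL: "magma_aut_group (\<diamondop>) \<cong> PSL 2 (UNIV :: 'a set)"
proof -
  let ?SL = "SL 2 (UNIV :: 'a set)" and ?A = "magma_aut_group (\<diamondop>) :: ('a \<Rightarrow> 'a) monoid"
  define \<phi> where "\<phi> M = act (M $$ (0, 0)) (M $$ (0, 1)) (M $$ (1, 0)) (M $$ (1, 1))" for M :: "'a mat"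
  have mul: "A \<otimes>\<^bsub>?SL\<^esub> B = A * B" for A B by (simp add: SL_def)
  have carr: "carrier ?A = G" by (simp add: magma_aut_group_def G_def)
  have GB: "f \<in> Bij UNIV" if "f \<in> G" for f using G_bij[OF that] by (simp add: Bij_def)
  have mulA: "f \<otimes>\<^bsub>?A\<^esub> g = (\<lambda>x. f (g x))" if "f \<in> G" "g \<in> G" for f g
    using GB[OF that(1)] GB[OF that(2)] by (simp add: magma_aut_group_def BijGroup_def compose_def restrict_def)
  have oneA: "\<one>\<^bsub>?A\<^esub> = (\<lambda>x. x)" by (simp add: magma_aut_group_def BijGroup_def restrict_def)
  have \<phi>G: "\<phi> M \<in> G" if "M \<in> carrier ?SL" for M
    unfolding \<phi>_def using that by (intro act_in_G) (simp add: SL_2_iff)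
  have hom: "\<phi> \<in> hom ?SL ?A"
  proof (rule homI)
    fix M N assume M: "M \<in> carrier ?SL" and N: "N \<in> carrier ?SL"
    have Mc: "M \<in> carrier_mat 2 2" "N \<in> carrier_mat 2 2" using M N by (simp_all add: SL_2_iff)
    have "\<phi> M (\<phi> N x) = \<phi> (M * N) x" for x
      unfolding \<phi>_def
      by (subst act_comp) (use M N Mc in \<open>simp_all add: SL_2_iff mult_mat_2 del: index_mult_mat\<close>)
    then show "\<phi> (M \<otimes>\<^bsub>?SL\<^esub> N) = \<phi> M \<otimes>\<^bsub>?A\<^esub> \<phi> N" unfolding mul mulA[OF \<phi>G[OF M] \<phi>G[OF N]] by simp
  qed (simp add: carr \<phi>G)
  have onto: "\<phi> ` carrier ?SL = carrier ?A"
  proof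
    show "\<phi> ` carrier ?SL \<subseteq> carrier ?A" using \<phi>G by (auto simp: carr)
    show "carrier ?A \<subseteq> \<phi> ` carrier ?SL"
    proof
      fix f assume "f \<in> carrier ?A"
      then obtain p q r s where f: "p * s - q * r = 1" "f = act p q r s" by (auto simp: carr G_eq_S7 S7_def)
      have "mat_2 p q r s \<in> carrier ?SL" using f(1) by (simp add: SL_2_iff)
      moreover have "\<phi> (mat_2 p q r s) = f" by (simp add: \<phi>_def f(2))
      ultimately show "f \<in> \<phi> ` carrier ?SL" by blast
    qed
  qed
  have ker: "kernel ?SL ?A \<phi> = group_center ?SL"
  proof (rule Set.set_eqI)
    fix M :: "'a mat"
    define p q r s where "p = M $$ (0, 0)" and "q = M $$ (0, 1)" and "r = M $$ (1, 0)" and "s = M $$ (1, 1)"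
    note e = p_def[symmetric] q_def[symmetric] r_def[symmetric] s_def[symmetric]
    show "M \<in> kernel ?SL ?A \<phi> \<longleftrightarrow> M \<in> group_center ?SL"
    proof (cases "M \<in> carrier ?SL")
      case True
      have Mc: "M \<in> carrier_mat 2 2" and d: "p * s - q * r = 1" using True by (simp_all add: SL_2_iff p_def q_def r_def s_def)
      have "\<phi> M = (\<lambda>x. x) \<longleftrightarrow> r = 0 \<and> q = 0 \<and> s = p"
      proof
        assume "\<phi> M = (\<lambda>x. x)"
        then have "act p q r s x = x" for x by (simp add: \<phi>_def p_def q_def r_def s_def fun_eq_iff)
        from act_id[OF d this] show "r = 0 \<and> q = 0 \<and> s = p" by blast
      next
        assume z: "r = 0 \<and> q = 0 \<and> s = p"
        then have "p\<^sup>2 = 1" using d by (simp add: power2_eq_square)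
        then have "act p q r s x = x" for x using z by (simp add: act_def)
        then show "\<phi> M = (\<lambda>x. x)" by (simp add: \<phi>_def p_def q_def r_def s_def fun_eq_iff)
      qed
      also have "\<dots> \<longleftrightarrow> (\<forall>N\<in>carrier ?SL. M * N = N * M)"
      proof
        assume c: "\<forall>N\<in>carrier ?SL. M * N = N * M"
        \<comment> \<open>Commuting with the two elementary matrices already forces a scalar
          matrix.\<close>
        have TL: "mat_2 1 1 0 1 \<in> carrier ?SL" "mat_2 1 0 1 1 \<in> carrier ?SL" by (simp_all add: SL_2_iff)
        have "(M * mat_2 1 1 0 1) $$ (i, j) = (mat_2 1 1 0 1 * M) $$ (i, j)" for i j using c TL by simp
        from this[of 0 0] this[of 0 1] have "r = 0" "q + p = q + s" using Mc by (auto simp: mult_mat_2 p_def q_def r_def s_def add.commute)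
        moreover have "(M * mat_2 1 0 1 1) $$ (i, j) = (mat_2 1 0 1 1 * M) $$ (i, j)" for i j using c TL by simp
        from this[of 0 0] have "q = 0" using Mc by (auto simp: mult_mat_2 p_def q_def r_def s_def)
        ultimately show "r = 0 \<and> q = 0 \<and> s = p" by simp
      next
        assume z: "r = 0 \<and> q = 0 \<and> s = p"
        have en: "M $$ (0, 0) = p" "M $$ (0, Suc 0) = 0" "M $$ (Suc 0, 0) = 0" "M $$ (Suc 0, Suc 0) = p"
          using z by (simp_all add: p_def q_def r_def s_def)
        show "\<forall>N\<in>carrier ?SL. M * N = N * M"
        proof
          fix N assume "N \<in> carrier ?SL"
          then have Nc: "N \<in> carrier_mat 2 2" by (simp add: SL_2_iff)
          show "M * N = N * M"
            by (rule mat_2_eqI) (use Mc Nc in \<open>auto simp: mult_mat_2 en mult.commute simp del: index_mult_mat intro!: mult_carrier_mat\<close>)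
        qed
      qed
      finally show ?thesis using True by (simp add: kernel_def group_center_def oneA mul)
    qed (simp add: kernel_def group_center_def)
  qed
  interpret group_hom ?SL ?A \<phi>
    by (intro group_hom.intro group_hom_axioms.intro group_SL_2 group_magma_aut_group hom)
  have iso: "PSL 2 (UNIV :: 'a set) \<cong> ?A" using FactGroup_iso[OF onto] unfolding ker PSL_def .
  show ?thesis
    by (rule group.iso_sym[OF _ iso]) (use normal.factorgroup_is_group[OF normal_kernel] in \<open>simp add: PSL_def ker\<close>)
qed

text \<open>The two orders of the parameters are exchanged by x \<mapsto> - x, because - 1 is a
  nonsquare modulo 7.\<close>

lemma aut_group_iso_PSL':
  assumes "{a, b} = {3, 5 :: 'a}"
  shows "magma_aut_group (quad_mult a b) \<cong> PSL 2 (UNIV :: 'a set)"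
proof (cases "a = 3")
  case True
  then have "b = 5" using assms by (auto simp: doubleton_eq_iff)
  then show ?thesis using True aut_group_iso_PSL by simp
next
  case False
  then have ab: "a = 5" "b = 3" using assms by (auto simp: doubleton_eq_iff)
  have m: "quad_char (- x) = - quad_char x" for x :: 'a
  proof -
    have "quad_char (- 1 :: 'a) = - 1" using quad_char_7[of "- 1"] by (simp add: chi7_def)
    then show ?thesis using quad_char_mult[of "- 1" x] by simp
  qed
  have "magma_aut_group (quad_mult a b) \<cong> magma_aut_group (\<diamondop>)"
  proof (rule magma_auts_iso[of uminus])
    show "bij (uminus :: 'a \<Rightarrow> 'a)" by (rule bij_uminus)
    fix x y :: 'a
    have q: "quad_char (- y - - x) = - quad_char (y - x)" using m[of "y - x"] by simp
    show "- quad_mult a b x y = - x \<diamondop> - y"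
      unfolding quad_mult_def q ab using quad_char_values[of "y - x"] by (auto simp: algebra_simps)
  qed
  then show ?thesis using aut_group_iso_PSL by (rule iso_trans)
qed

end

theorem theorem1p2:
  fixes a b :: "'a::{field,finite}" and K :: "'a set"
  assumes "odd CARD('a)"
    and "quad_params a b"
    and "K = least_subfield {a, b}"
  shows
    "(\<not> (a = b) \<and>
      \<not> (\<exists>\<gamma>::nat. \<gamma>\<^sup>2 = card K \<and> b = a ^ \<gamma>) \<and>
      \<not> (CARD('a) = 7 \<and> {a, b} = {3, 5})
      \<longrightarrow> magma_auts (quad_mult a b) = AGamma2L1_over K)
     \<and>
     (a = b \<longrightarrow>
        magma_aut_group (quad_mult a b) \<cong> AGL (ext_degree UNIV K) K \<and>
        magma_auts (quad_mult a b) =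
          {(\<lambda>x. \<sigma> x + \<mu>) | \<sigma> \<mu>. linear_over K \<sigma> \<and> bij \<sigma>})
     \<and>
     (\<forall>\<gamma>::nat. \<gamma>\<^sup>2 = card K \<and> b = a ^ \<gamma> \<longrightarrow>
        magma_auts (quad_mult a b) = AGammaL1_tw K)
     \<and>
     (CARD('a) = 7 \<and> {a, b} = {3, 5} \<longrightarrow>
        magma_aut_group (quad_mult a b) \<cong> PSL 2 (UNIV :: 'a set))"
proof -
  interpret quad_quasigroup "TYPE('a)" a b
    by unfold_locales (rule assms(1,2))+
  have sub: "is_subfield K" unfolding assms(3) by (rule least_subfield_is_subfield)
  note generic = generic_case[OF assms(3), unfolded G_def]
  note equal = equal_case[OF assms(3), unfolded G_def]
  note twisted = twisted_case[OF assms(3), unfolded G_def]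
  show ?thesis
  proof (intro conjI impI allI; (elim conjE)?)
    assume "a \<noteq> b" "\<not> (\<exists>\<gamma>::nat. \<gamma>\<^sup>2 = card K \<and> b = a ^ \<gamma>)" "\<not> (CARD('a) = 7 \<and> {a, b} = {3, 5})"
    then show "magma_auts (quad_mult a b) = AGamma2L1_over K" by (rule generic)
  next
    assume ab: "a = b"
    show "magma_aut_group (quad_mult a b) \<cong> AGL (ext_degree UNIV K) K"
      unfolding magma_aut_group_def equal[OF ab] by (rule affine_group_iso_AGL[OF sub])
    show "magma_auts (quad_mult a b) = {(\<lambda>x. \<sigma> x + \<mu>) | \<sigma> \<mu>. linear_over K \<sigma> \<and> bij \<sigma>}"
      by (rule equal[OF ab])
  next
    fix \<gamma> :: nat
    assume "\<gamma>\<^sup>2 = card K" "b = a ^ \<gamma>"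
    then show "magma_auts (quad_mult a b) = AGammaL1_tw K" by (rule twisted)
  next
    assume "CARD('a) = 7" "{a, b} = {3, 5}"
    then show "magma_aut_group (quad_mult a b) \<cong> PSL 2 (UNIV :: 'a set)"
      by (rule field_7.aut_group_iso_PSL'[OF field_7.intro])
  qed
qed

end
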